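(* Let $1\le p_1,p_2,q\le\infty$. Define $p$ by $\frac1p:=\frac1{p_1}+\frac1{p_2}$ and suppose $p\ge1$. Assume that $f\in\mathcal{UM}^{p_1,q}(\mathbb{R}^n)$ and $g\in\mathcal{UM}^{p_2,q}(\mathbb{R}^n)$. Then $f\cdot g\in\mathcal{UM}^{p,q}(\mathbb{R}^n)$ and $$\|f\cdot g\|_{\mathcal{UM}^{p,q}}\le C\,\|f\|_{\mathcal{UM}^{p_1,q}}\|g\|_{\mathcal{UM}^{p_2,q}}$$ with a positive constant $C$ which depends only on the choice of the frequency-uniform decomposition $(\sigma_k)_k$, the dimension $n$ and the parameter $q$. In particular, for all $1\le p,q\le\infty$ the space $\mathcal{UM}^{p,q}(\mathbb{R}^n)$ is an algebra under pointwise multiplication.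
   Context: Write $\langle x\rangle_*:=(e^{2e}+|x|^2)^{1/2}$ for $x\in\mathbb{R}^n$ ($|\cdot|$ Euclidean norm). The Fourier transform is $\mathcal{F}f(\xi)=(2\pi)^{-n/2}\int_{\mathbb{R}^n}f(x)e^{-ix\cdot\xi}\,dx$, extended to tempered distributions. Fix a function $\rho\in C_0^\infty(\mathbb{R}^n)$ with $\rho:\mathbb{R}^n\to[0,1]$, $\operatorname{supp}\rho\subset[-1,1]^n$ and $\rho=1$ on $[-\tfrac12,\tfrac12]^n$. For $k\in\mathbb{Z}^n$ put $\rho_k(\xi)=\rho(\xi-k)$, $\sigma_k=\rho_k\big(\sum_{m\in\mathbb{Z}^n}\rho_m\big)^{-1}$ (the frequency-uniform decomposition) and $\Box_k f=\mathcal{F}^{-1}(\sigma_k\mathcal{F}f)$. For $1\le p,q\le\infty$ the space $\mathcal{UM}^{p,q}(\mathbb{R}^n)$ is the set of all $f\in L^p(\mathbb{R}^n)$ (complex-valued functions) with $$\|f\|_{\mathcal{UM}^{p,q}}=\Big(\sum_{k\in\mathbb{Z}^n}e^{q\log\langle k\rangle_*\log\log\langle k\rangle_*}\|\Box_kf\|_{L^p}^q\Big)^{1/q}<\infty$$ (supremum over $k$ if $q=\infty$). "Algebra under pointwise multiplication" means: there is a constant $C_1>0$ such that for all $f,g$ in the space, $f\cdot g$ belongs to the space and its norm is at most $C_1\|f\|_{\mathcal{UM}^{p,q}}\|g\|_{\mathcal{UM}^{p,q}}$. *)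

theory Defs
  imports "HOL-Analysis.Analysis" "HOL-Probability.Essential_Supremum"
begin

text \<open>Iterated partial derivatives, indexed by the list of coordinate directions.  By symmetry of
  higher derivatives, for smooth functions these are exactly the derivatives indexed by
  multi-indices.\<close>

primrec partials ::
  "'n::finite list \<Rightarrow> (real^'n \<Rightarrow> 'b::real_normed_vector) \<Rightarrow> real^'n \<Rightarrow> 'b" where
  "partials [] f = f"
| "partials (j # js) f = (\<lambda>x. frechet_derivative (partials js f) (at x) (axis j 1))"

definition smooth :: "(real^'n::finite \<Rightarrow> 'b::real_normed_vector) \<Rightarrow> bool" where
  "smooth f \<longleftrightarrow> (\<forall>js x. partials js f differentiable (at x))"

definition schwartz :: "(real^'n::finite \<Rightarrow> complex) set" where
  "schwartz = {\<phi>. smooth \<phi> \<and>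
     (\<forall>N::nat. \<forall>js. \<exists>B. \<forall>x. (1 + norm x) ^ N * norm (partials js \<phi> x) \<le> B)}"

text \<open>Powers with exponent \<open>a > 0\<close>; note that \<open>0 powr a = 0\<close>.\<close>

definition ennpowr :: "ennreal \<Rightarrow> real \<Rightarrow> ennreal" where
  "ennpowr x a = (if x = \<infinity> then \<infinity> else ennreal (enn2real x powr a))"

definition Lp_norm :: "ennreal \<Rightarrow> (real^'n::finite \<Rightarrow> complex) \<Rightarrow> ennreal" where
  "Lp_norm p f =
    (if p = \<infinity> then esssup lebesgue (\<lambda>x. ennreal (norm (f x)))
     else ennpowr (\<integral>\<^sup>+ x. ennreal (norm (f x) powr enn2real p) \<partial>lebesgue) (1 / enn2real p))"

definition Lp :: "ennreal \<Rightarrow> (real^'n::finite \<Rightarrow> complex) set" where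
  "Lp p = {f \<in> borel_measurable lebesgue. Lp_norm p f < \<infinity>}"

definition fourier :: "(real^'n::finite \<Rightarrow> complex) \<Rightarrow> real^'n \<Rightarrow> complex" where
  "fourier \<phi> \<xi> = of_real ((2 * pi) powr (- real CARD('n) / 2)) *
     (LINT x|lebesgue. \<phi> x * exp (- \<i> * of_real (x \<bullet> \<xi>)))"

definition fourier_inv :: "(real^'n::finite \<Rightarrow> complex) \<Rightarrow> real^'n \<Rightarrow> complex" where
  "fourier_inv \<phi> x = of_real ((2 * pi) powr (- real CARD('n) / 2)) *
     (LINT \<xi>|lebesgue. \<phi> \<xi> * exp (\<i> * of_real (x \<bullet> \<xi>)))"

text \<open>A tempered distribution is represented by a functional of which only the values on
  \<^const>\<open>schwartz\<close> matter.  The Fourier transform, its inverse and multiplication by a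
  smooth function of compact support are extended to distributions by duality.\<close>

type_synonym 'n distr = "(real^'n \<Rightarrow> complex) \<Rightarrow> complex"

definition distr_of :: "(real^'n::finite \<Rightarrow> complex) \<Rightarrow> 'n distr" where
  "distr_of f \<phi> = (LINT x|lebesgue. f x * \<phi> x)"

definition distr_fourier :: "'n::finite distr \<Rightarrow> 'n distr" where
  "distr_fourier u \<phi> = u (fourier \<phi>)"

definition distr_fourier_inv :: "'n::finite distr \<Rightarrow> 'n distr" where
  "distr_fourier_inv u \<phi> = u (fourier_inv \<phi>)"

definition distr_mult :: "(real^'n::finite \<Rightarrow> real) \<Rightarrow> 'n distr \<Rightarrow> 'n distr" where
  "distr_mult s u \<phi> = u (\<lambda>\<xi>. of_real (s \<xi>) * \<phi> \<xi>)"

text \<open>The \<open>L\<^sup>p\<close> norm of a distribution: the functions in \<open>L\<^sup>p\<close> that represent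
  it agree almost everywhere, so the infimum is their common norm; it is \<open>\<infinity>\<close> if the
  distribution is not represented by a function in \<open>L\<^sup>p\<close>.\<close>

definition distr_Lp_norm :: "ennreal \<Rightarrow> 'n::finite distr \<Rightarrow> ennreal" where
  "distr_Lp_norm p u = (INF h \<in> {h \<in> Lp p. \<forall>\<phi>\<in>schwartz. u \<phi> = distr_of h \<phi>}. Lp_norm p h)"

definition lattice_pt :: "int^'n::finite \<Rightarrow> real^'n" where
  "lattice_pt k = (\<chi> i. of_int (k $ i))"

definition freq_window :: "(real^'n::finite \<Rightarrow> real) \<Rightarrow> bool" where
  "freq_window \<rho> \<longleftrightarrow> smooth \<rho> \<and> range \<rho> \<subseteq> {0..1} \<and>
     closure {\<xi>. \<rho> \<xi> \<noteq> 0} \<subseteq> cbox (\<chi> i. -1) (\<chi> i. 1) \<and>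
     (\<forall>\<xi> \<in> cbox (\<chi> i. -1/2) (\<chi> i. 1/2). \<rho> \<xi> = 1)"

text \<open>The sum in the denominator has only finitely many nonzero terms at each point.\<close>

definition freq_sigma :: "(real^'n::finite \<Rightarrow> real) \<Rightarrow> int^'n \<Rightarrow> real^'n \<Rightarrow> real" where
  "freq_sigma \<rho> k \<xi> = \<rho> (\<xi> - lattice_pt k) / (\<Sum>\<^sub>\<infinity>m. \<rho> (\<xi> - lattice_pt m))"

definition freq_box ::
  "(real^'n::finite \<Rightarrow> real) \<Rightarrow> int^'n \<Rightarrow> (real^'n \<Rightarrow> complex) \<Rightarrow> 'n distr" where
  "freq_box \<rho> k f =
     distr_fourier_inv (distr_mult (freq_sigma \<rho> k) (distr_fourier (distr_of f)))"

text \<open>The constant \<open>e\<^sup>2\<^sup>e\<close> makes the iterated logarithm at least 1.\<close>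

definition jbracket :: "real^'n::finite \<Rightarrow> real" where
  "jbracket x = sqrt (exp (2 * exp 1) + (norm x)\<^sup>2)"

definition UM_norm ::
  "(real^'n::finite \<Rightarrow> real) \<Rightarrow> ennreal \<Rightarrow> ennreal \<Rightarrow> (real^'n \<Rightarrow> complex) \<Rightarrow> ennreal" where
  "UM_norm \<rho> p q f =
    (let w = (\<lambda>k. ln (jbracket (lattice_pt k)) * ln (ln (jbracket (lattice_pt k)))) in
     if q = \<infinity> then (SUP k. ennreal (exp (w k)) * distr_Lp_norm p (freq_box \<rho> k f))
     else ennpowr
       (\<Sum>\<^sub>\<infinity>k. ennreal (exp (enn2real q * w k)) *
               ennpowr (distr_Lp_norm p (freq_box \<rho> k f)) (enn2real q))
       (1 / enn2real q))"

definition UM ::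
  "(real^'n::finite \<Rightarrow> real) \<Rightarrow> ennreal \<Rightarrow> ennreal \<Rightarrow> (real^'n \<Rightarrow> complex) set" where
  "UM \<rho> p q = {f \<in> Lp p. UM_norm \<rho> p q f < \<infinity>}"

end

theory Submission
  imports Defs "HOL-Probability.Probability"
begin

text \<open>Every frequency piece of \<open>f\<close> is a convolution with an integrable kernel \<open>\<kappa>\<^sub>k\<close> whose modulus does not
  depend on \<open>k\<close>.  Since the weight \<open>e\<^sup>w\<close> grows faster than every power, the pieces of
  \<open>f\<close> and \<open>g\<close> are summable in \<open>L\<^bsup>p\<^sub>1\<^esup>\<close> and \<open>L\<^bsup>p\<^sub>2\<^esup>\<close>, so that \<open>f g = \<Sum> f\<^sub>m g\<^sub>l\<close> almost everywhere, and the
  \<open>k\<close>-th piece of \<open>f\<^sub>m g\<^sub>l\<close> vanishes unless \<open>k\<close> is within distance 3 of \<open>m + l\<close>.  By Young and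
  Hoelder, the norm of the \<open>k\<close>-th piece of \<open>f g\<close> is therefore bounded by the discrete convolution of
  the norms of the pieces.  For such \<open>k\<close> the weights satisfy
  \<open>w(k) \<le> w(m) + w(l) - 2 n ln \<langle>l\<rangle> + C\<close> if \<open>|l| \<le> |m|\<close>, because \<open>t ln t\<close> is only slightly
  superlinear; the gained factor \<open>\<langle>l\<rangle>\<^bsup>-2n\<^esup>\<close> is summable and Young's inequality on
  the lattice gives the claim.  For the algebra property, Bernstein's inequality puts the second
  factor into the space with \<open>p = \<infinity>\<close>.\<close>

subsection \<open>Lebesgue norms of nonnegative functions\<close>

text \<open>The constant must serve all \<open>p1\<close> and \<open>p2\<close> at once. Therefore
  the quantitative \<open>L^p\<close> estimates are averaging arguments: Minkowski's inequality
  against a weight of total mass \<open>W\<close> costs the factor \<open>W\<close> for every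
  exponent, and Hoelder's inequality costs the factor 1. Bernstein's inequality is the one place
  where the exponent enters the constant, and the constant of the algebra property may depend on
  \<open>p\<close>.

  The norm is an infimum over functions representing a distribution, whereas the estimates concern
  honest convolutions. Two uniqueness questions arise: whether the convolution is the only
  \<open>L^p\<close> function representing its piece, and whether the pieces add up to
  \<open>f\<close> itself. One principle answers both: a function of \<open>L^p\<close> vanishes
  almost everywhere once its pairings with all translates and integer dilates of a single integrable
  function of nonzero integral vanish. The window \<open>\<rho>\<close>, a test function, decides
  the former; \<open>kern 0\<close>, whose spectrum is compact, decides the latter.\<close>

lemma ennpowr_mono: "x \<le> y \<Longrightarrow> 0 \<le> a \<Longrightarrow> ennpowr x a \<le> ennpowr y a"
  unfolding ennpowr_def
  by (auto simp: top_unique less_top intro!: ennreal_leI powr_mono2 enn2real_mono)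

lemma ennpowr_ennreal [simp]: "0 \<le> r \<Longrightarrow> ennpowr (ennreal r) a = ennreal (r powr a)"
  by (simp add: ennpowr_def)

lemma ennpowr_top [simp]: "ennpowr \<infinity> a = \<infinity>" "ennpowr top a = \<infinity>"
  by (simp_all add: ennpowr_def)

lemma ennpowr_0 [simp]: "ennpowr 0 a = 0"
  by (simp add: ennpowr_def)

lemma ennpowr_1 [simp]: "ennpowr x 1 = x"
  by (cases x) (auto simp: ennpowr_def)

lemma ennpowr_eq_0_iff [simp]: "ennpowr x a = 0 \<longleftrightarrow> x = 0"
  by (cases x) (auto simp: ennpowr_def)

lemma ennpowr_eq_top_iff [simp]: "ennpowr x a = top \<longleftrightarrow> x = top"
  by (cases x) (auto simp: ennpowr_def)

lemma ennpowr_mult: "ennpowr (x * y) a = ennpowr x a * ennpowr y a"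
proof (cases "x = 0 \<or> y = 0")
  case False
  then show ?thesis
    by (cases x; cases y)
       (auto simp: ennreal_mult'[symmetric] powr_mult ennreal_top_mult ennreal_mult_top)
qed auto

lemma ennpowr_ennpowr: "ennpowr (ennpowr x a) b = ennpowr x (a * b)"
  by (cases x) (auto simp: powr_powr)

lemma ennpowr_add: "x \<noteq> 0 \<or> 0 < a \<or> 0 < b \<Longrightarrow> x \<noteq> top \<Longrightarrow> ennpowr x (a + b) = ennpowr x a * ennpowr x b"
  by (cases x) (auto simp: powr_add ennreal_mult')

lemma measurable_ennpowr [measurable (raw)]:
  assumes [measurable]: "f \<in> borel_measurable M"
  shows "(\<lambda>x. ennpowr (f x) a) \<in> borel_measurable M"
  unfolding ennpowr_def by measurable

lemma ennpowr_le_iff_root: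
  assumes "0 < a" shows "ennpowr x (1 / a) \<le> c \<longleftrightarrow> x \<le> ennpowr c a"
proof
  assume "ennpowr x (1 / a) \<le> c"
  from ennpowr_mono[OF this, of a] assms show "x \<le> ennpowr c a"
    by (simp add: ennpowr_ennpowr)
next
  assume "x \<le> ennpowr c a"
  from ennpowr_mono[OF this, of "1 / a"] assms show "ennpowr x (1 / a) \<le> c"
    by (simp add: ennpowr_ennpowr)
qed

text \<open>Convexity: the graph of \<open>t powr a\<close> lies above its tangent at
  \<open>s\<close>. The terms are arranged so that both sides are sums of nonnegative quantities,
  which lets the inequality be transferred to \<open>ennreal\<close>.\<close>

lemma powr_tangent:
  fixes s t a :: real
  assumes "0 < s" "0 \<le> t" "1 \<le> a"
  shows "a * s powr (a - 1) * t \<le> t powr a + (a - 1) * s powr a"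
proof (cases "t = 0")
  case False
  have "(t powr a) powr (1 / a) * (s powr a) powr (1 - 1 / a) \<le> 1 / a * t powr a + (1 - 1 / a) * s powr a"
    using assms False by (intro Youngs_inequality_0) (auto simp: field_simps)
  moreover have "a * (1 - 1 / a) = a - 1" using assms by (simp add: field_simps)
  ultimately have "t * s powr (a - 1) \<le> 1 / a * t powr a + (1 - 1 / a) * s powr a"
    using assms by (simp add: powr_powr)
  then have "a * (t * s powr (a - 1)) \<le> a * (1 / a * t powr a + (1 - 1 / a) * s powr a)"
    using assms by (intro mult_left_mono) auto
  also have "\<dots> = t powr a + (a - 1) * s powr a"
  proof -
    have "a * (1 / a * X + (1 - 1 / a) * Y) = X + (a - 1) * Y" for X Y
      using assms by (simp add: field_simps)
    then show ?thesis .
  qed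
  finally show ?thesis by (simp add: ac_simps)
qed (use assms in auto)

text \<open>Jensen's inequality for the probability weight \<open>w / W\<close>, where
  \<open>W\<close> is the mass of \<open>w\<close>, multiplied out so that no division by
  \<open>W\<close> occurs. It comes from integrating \<open>powr_tangent\<close> at the mean value
  of \<open>v\<close>; the cases where the mean is 0 or infinite are split off beforehand.\<close>

lemma nn_integral_jensen:
  fixes w v :: "'a \<Rightarrow> ennreal"
  assumes [measurable]: "w \<in> borel_measurable M" "v \<in> borel_measurable M"
    and a: "1 \<le> a" and W: "(\<integral>\<^sup>+x. w x \<partial>M) < \<infinity>"
  shows "ennpowr (\<integral>\<^sup>+x. w x * v x \<partial>M) a \<le> ennpowr (\<integral>\<^sup>+x. w x \<partial>M) (a - 1) * (\<integral>\<^sup>+x. w x * ennpowr (v x) a \<partial>M)"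
proof -
  define W where "W = (\<integral>\<^sup>+x. w x \<partial>M)"
  define I where "I = (\<integral>\<^sup>+x. w x * v x \<partial>M)"
  define J where "J = (\<integral>\<^sup>+x. w x * ennpowr (v x) a \<partial>M)"
  \<comment> \<open>This crude bound serves the case \<open>I = top\<close>: as \<open>W\<close> is
    finite, an infinite \<open>I\<close> forces \<open>J = top\<close>.\<close>
  have le1: "v x \<le> 1 + ennpowr (v x) a" for x
  proof (cases "v x")
    case (real r)
    have "r \<le> 1 + r powr a"
    proof (cases "r \<le> 1")
      case False
      then have "r powr 1 \<le> r powr a" using a by (intro powr_mono) auto
      then show ?thesis using False by simp
    qed (simp add: add_increasing2)
    with real show ?thesis by (simp flip: ennreal_1 ennreal_plus)
  qed simp
  have Wf: "W < top" using W by (simp add: W_def)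
  consider "I = 0" | "I = top" | "I \<noteq> 0" "I \<noteq> top" by blast
  then show ?thesis
  proof cases
    case 1 then show ?thesis by (simp add: I_def)
  next
    case 2
    have "I \<le> (\<integral>\<^sup>+x. w x + w x * ennpowr (v x) a \<partial>M)"
      unfolding I_def using le1 by (intro nn_integral_mono) (metis distrib_left mult.right_neutral mult_left_mono zero_le)
    also have "\<dots> = W + J" by (simp add: nn_integral_add W_def J_def)
    finally have "J = top" using 2 Wf by (auto simp: top_unique)
    moreover have "W \<noteq> 0"
    proof
      assume "W = 0"
      then have "AE x in M. w x = 0" by (simp add: W_def nn_integral_0_iff_AE)
      then have "I = 0" unfolding I_def by (subst nn_integral_0_iff_AE) auto
      with 2 show False by simp
    qed
    ultimately show ?thesis by (simp add: W_def[symmetric] J_def[symmetric] ennreal_mult_top)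
  next
    case 3
    have W0: "W \<noteq> 0"
    proof
      assume "W = 0"
      then have "AE x in M. w x = 0" by (simp add: W_def nn_integral_0_iff_AE)
      then have "I = 0" unfolding I_def by (subst nn_integral_0_iff_AE) auto
      with 3 show False by simp
    qed
    obtain i where i: "I = ennreal i" "0 < i" using 3 by (cases I) auto
    obtain r where r: "W = ennreal r" "0 < r" using W0 Wf by (cases W) auto
    \<comment> \<open>The tangent is taken at the mean of \<open>v\<close> with respect to
      \<open>w / W\<close>. There the multiples of \<open>s powr a * r\<close> on the two sides
      differ by exactly one, which is what remains to be compared with \<open>J\<close>.\<close>
    define s where "s = i / r"
    have s: "0 < s" using i r by (simp add: s_def)
    have pt: "ennreal (a * s powr (a - 1)) * y \<le> ennpowr y a + ennreal ((a - 1) * s powr a)" for y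
    proof (cases y)
      case (real t)
      with powr_tangent[OF s, of t a] a show ?thesis
        by (simp flip: ennreal_mult' ennreal_plus add: ennreal_leI)
    qed simp
    have "ennreal (a * s powr (a - 1)) * I = (\<integral>\<^sup>+x. w x * (ennreal (a * s powr (a - 1)) * v x) \<partial>M)"
      unfolding I_def by (subst nn_integral_cmult[symmetric]) (auto simp: ac_simps)
    also have "\<dots> \<le> (\<integral>\<^sup>+x. w x * ennpowr (v x) a + ennreal ((a - 1) * s powr a) * w x \<partial>M)"
      by (intro nn_integral_mono) (metis pt distrib_left mult.commute mult_left_mono zero_le)
    also have "\<dots> = J + ennreal ((a - 1) * s powr a) * W"
      by (simp add: nn_integral_add nn_integral_cmult W_def J_def)
    finally have le: "ennreal (a * s powr (a - 1) * i) \<le> J + ennreal ((a - 1) * s powr a * r)"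
      using i r a by (simp add: ennreal_mult')
    show ?thesis
    proof (cases J)
      case (real j)
      have "a * s powr (a - 1) * i \<le> j + (a - 1) * s powr a * r"
        using le real a r by (simp flip: ennreal_plus)
      moreover have "s powr (a - 1) * i = s powr a * r"
        using s i r by (simp add: s_def powr_diff)
      ultimately have "s powr a * r \<le> j" by (simp add: algebra_simps)
      then have "r powr (a - 1) * (s powr a * r) \<le> r powr (a - 1) * j" by (intro mult_left_mono) auto
      moreover have "r powr (a - 1) * (s powr a * r) = i powr a"
        using i r by (simp add: s_def powr_diff powr_divide)
      ultimately have "i powr a \<le> r powr (a - 1) * j" by simp
      then show ?thesis
        using i r real by (simp add: W_def[symmetric] J_def[symmetric] I_def[symmetric] ennreal_leI flip: ennreal_mult')
    next
      case top
      then show ?thesis using W0 by (simp add: W_def[symmetric] J_def[symmetric] ennreal_mult_top)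
    qed
  qed
qed

text \<open>The argument takes values in \<open>ennreal\<close> so that infinite sums of moduli can
  be inserted before they are known to be finite. An arbitrary measure is allowed so that the same
  facts serve the Lebesgue norms on \<open>\<real>^n\<close> and the \<open>l^q\<close> norms on the
  lattice.\<close>

definition eLp :: "'a measure \<Rightarrow> ennreal \<Rightarrow> ('a \<Rightarrow> ennreal) \<Rightarrow> ennreal" where
  "eLp M p u = (if p = \<infinity> then esssup M u
     else ennpowr (\<integral>\<^sup>+x. ennpowr (u x) (enn2real p) \<partial>M) (1 / enn2real p))"

lemma enn2real_ge_1: "1 \<le> p \<Longrightarrow> p \<noteq> \<infinity> \<Longrightarrow> 1 \<le> enn2real p"
  by (cases p) auto

lemma eLp_le_iff:
  assumes "1 \<le> p" "p \<noteq> \<infinity>"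
  shows "eLp M p u \<le> c \<longleftrightarrow> (\<integral>\<^sup>+x. ennpowr (u x) (enn2real p) \<partial>M) \<le> ennpowr c (enn2real p)"
  using enn2real_ge_1[OF assms] assms(2) by (simp add: eLp_def ennpowr_le_iff_root)

lemma eLp_inf_le_iff:
  assumes "u \<in> borel_measurable M"
  shows "eLp M \<infinity> u \<le> c \<longleftrightarrow> (AE x in M. u x \<le> c)"
proof
  assume *: "eLp M \<infinity> u \<le> c"
  show "AE x in M. u x \<le> c"
    using esssup_AE[of u M] by eventually_elim (use * in \<open>auto simp: eLp_def\<close>)
qed (use assms in \<open>auto simp: eLp_def\<close>)

lemma eLp_top_le_iff:
  assumes "u \<in> borel_measurable M"
  shows "eLp M top u \<le> c \<longleftrightarrow> (AE x in M. u x \<le> c)"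
  using eLp_inf_le_iff[OF assms] by simp

lemma eLp_mono_AE:
  assumes "u \<in> borel_measurable M" "v \<in> borel_measurable M" "AE x in M. u x \<le> v x" "1 \<le> p"
  shows "eLp M p u \<le> eLp M p v"
  unfolding eLp_def using assms
  by (auto intro!: esssup_AE_mono ennpowr_mono nn_integral_mono_AE elim!: eventually_mono)

lemma eLp_cong_AE:
  assumes "u \<in> borel_measurable M" "v \<in> borel_measurable M" "AE x in M. u x = v x" "1 \<le> p"
  shows "eLp M p u = eLp M p v"
  using assms by (intro antisym eLp_mono_AE) (auto elim!: eventually_mono)

lemma eLp_eq_0_iff:
  assumes [measurable]: "u \<in> borel_measurable M" and "1 \<le> p"
  shows "eLp M p u = 0 \<longleftrightarrow> (AE x in M. u x = 0)"
proof (cases "p = \<infinity>")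
  case True
  then show ?thesis using eLp_inf_le_iff[OF assms(1), of 0] by simp
next
  case False
  then show ?thesis using eLp_le_iff[OF assms(2) False, of M u 0] by (simp add: nn_integral_0_iff_AE)
qed

lemma eLp_finite_AE:
  assumes [measurable]: "u \<in> borel_measurable M" and "1 \<le> p" "eLp M p u < \<infinity>"
  shows "AE x in M. u x < \<infinity>"
proof (cases "p = \<infinity>")
  case True
  then have "AE x in M. u x \<le> eLp M p u" using eLp_inf_le_iff[OF assms(1)] by blast
  then show ?thesis by eventually_elim (use assms(3) in \<open>auto\<close>)
next
  case False
  then have "(\<integral>\<^sup>+x. ennpowr (u x) (enn2real p) \<partial>M) \<noteq> \<infinity>"
    using assms by (auto simp: eLp_def)
  then have "AE x in M. ennpowr (u x) (enn2real p) \<noteq> \<infinity>" by (intro nn_integral_noteq_infinite) auto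
  then show ?thesis by eventually_elim (auto simp: less_top)
qed

lemma eLp_cmult:
  assumes [measurable]: "u \<in> borel_measurable M" and "1 \<le> p"
  shows "eLp M p (\<lambda>x. c * u x) \<le> c * eLp M p u"
proof (cases "p = \<infinity>")
  case True
  have "AE x in M. u x \<le> eLp M p u" using eLp_inf_le_iff[OF assms(1)] True by blast
  then have "AE x in M. c * u x \<le> c * eLp M p u" by eventually_elim (simp add: mult_left_mono)
  then show ?thesis using True by (simp add: eLp_top_le_iff)
next
  case False
  have "1 \<le> enn2real p" using enn2real_ge_1[OF assms(2) False] .
  then show ?thesis using False
    by (simp add: eLp_def ennpowr_mult nn_integral_cmult ennpowr_ennpowr)
qed

text \<open>Instances: Young's inequality for convolutions on \<open>\<real>\<^sup>n\<close> and on the lattice, and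
  Minkowski's inequality for series.\<close>

lemma eLp_minkowski_weighted:
  fixes v :: "'t \<Rightarrow> 'a \<Rightarrow> ennreal"
  assumes "sigma_finite_measure M" "sigma_finite_measure N"
    and [measurable]: "\<kappa> \<in> borel_measurable N" "(\<lambda>(x, t). v t x) \<in> borel_measurable (M \<Otimes>\<^sub>M N)"
    and p: "1 \<le> p" and c: "\<And>t. t \<in> space N \<Longrightarrow> eLp M p (v t) \<le> c" and W: "(\<integral>\<^sup>+t. \<kappa> t \<partial>N) < \<infinity>"
  shows "eLp M p (\<lambda>x. \<integral>\<^sup>+t. \<kappa> t * v t x \<partial>N) \<le> (\<integral>\<^sup>+t. \<kappa> t \<partial>N) * c"
proof -
  interpret pair_sigma_finite M N using assms(1,2) by (simp add: pair_sigma_finite_def)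
  define W where "W = (\<integral>\<^sup>+t. \<kappa> t \<partial>N)"
  have [measurable]: "(\<lambda>x. \<integral>\<^sup>+t. \<kappa> t * v t x \<partial>N) \<in> borel_measurable M" by measurable
  have vt [measurable]: "v t \<in> borel_measurable M" if "t \<in> space N" for t
    using that by (simp add: measurable_Pair1'[THEN measurable_compose, OF _ assms(4), unfolded split_beta] measurable_compose[OF _ assms(4), of "\<lambda>x. (x, t)", simplified])
  show ?thesis
  proof (cases "p = \<infinity>")
    case True
    have "AE t in N. AE x in M. v t x \<le> c"
      using c vt True by (auto simp: eLp_top_le_iff)
    then have "AE x in M. AE t in N. v t x \<le> c"
      by (subst AE_commute) (auto simp: split_beta')
    then have "AE x in M. (\<integral>\<^sup>+t. \<kappa> t * v t x \<partial>N) \<le> W * c"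
    proof eventually_elim
      case (elim x)
      then have "(\<integral>\<^sup>+t. \<kappa> t * v t x \<partial>N) \<le> (\<integral>\<^sup>+t. \<kappa> t * c \<partial>N)"
        by (intro nn_integral_mono_AE) (auto elim!: eventually_mono intro: mult_left_mono)
      then show ?case by (simp add: nn_integral_multc W_def)
    qed
    then show ?thesis using True by (simp add: eLp_top_le_iff W_def)
  next
    case False
    define a where "a = enn2real p"
    have a: "1 \<le> a" using enn2real_ge_1[OF p False] by (simp add: a_def)
    have "(\<integral>\<^sup>+x. ennpowr (\<integral>\<^sup>+t. \<kappa> t * v t x \<partial>N) a \<partial>M)
        \<le> (\<integral>\<^sup>+x. ennpowr W (a - 1) * (\<integral>\<^sup>+t. \<kappa> t * ennpowr (v t x) a \<partial>N) \<partial>M)"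
      unfolding W_def by (intro nn_integral_mono nn_integral_jensen a W) measurable
    also have "\<dots> = ennpowr W (a - 1) * (\<integral>\<^sup>+x. \<integral>\<^sup>+t. \<kappa> t * ennpowr (v t x) a \<partial>N \<partial>M)"
      by (intro nn_integral_cmult) measurable
    also have "(\<integral>\<^sup>+x. \<integral>\<^sup>+t. \<kappa> t * ennpowr (v t x) a \<partial>N \<partial>M) = (\<integral>\<^sup>+t. \<integral>\<^sup>+x. \<kappa> t * ennpowr (v t x) a \<partial>M \<partial>N)"
      by (intro Fubini'[symmetric]) measurable
    also have "\<dots> \<le> (\<integral>\<^sup>+t. \<kappa> t * ennpowr c a \<partial>N)"
    proof (intro nn_integral_mono)
      fix t assume t: "t \<in> space N"
      have "(\<integral>\<^sup>+x. ennpowr (v t x) a \<partial>M) \<le> ennpowr c a"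
        using c[OF t] eLp_le_iff[OF p False, of M "v t" c] by (simp add: a_def)
      then show "(\<integral>\<^sup>+x. \<kappa> t * ennpowr (v t x) a \<partial>M) \<le> \<kappa> t * ennpowr c a"
        using vt[OF t] by (simp add: nn_integral_cmult mult_left_mono)
    qed
    also have "\<dots> = W * ennpowr c a" by (simp add: nn_integral_multc W_def)
    finally have "(\<integral>\<^sup>+x. ennpowr (\<integral>\<^sup>+t. \<kappa> t * v t x \<partial>N) a \<partial>M) \<le> ennpowr W (a - 1) * (W * ennpowr c a)"
      by (simp add: mult_left_mono)
    \<comment> \<open>Jensen at fixed \<open>x\<close> contributes the power \<open>a - 1\<close> of
      the mass and the integration over \<open>t\<close> after Tonelli one more, so that taking the
      root leaves the factor \<open>W\<close>, independently of the exponent.\<close>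
    also have "ennpowr W (a - 1) * (W * ennpowr c a) = ennpowr (W * c) a"
      using W ennpowr_add[of W "a - 1" 1] by (simp add: W_def[symmetric] ennpowr_mult mult.assoc)
    finally show ?thesis
      by (subst eLp_le_iff[OF p False]) (simp add: a_def W_def)
  qed
qed

lemma eLp_minkowski_series:
  fixes u :: "'i::countable \<Rightarrow> 'a \<Rightarrow> ennreal"
  assumes "sigma_finite_measure M" and [measurable]: "\<And>i. u i \<in> borel_measurable M" and p: "1 \<le> p"
  shows "eLp M p (\<lambda>x. \<integral>\<^sup>+i. u i x \<partial>count_space UNIV) \<le> (\<integral>\<^sup>+i. eLp M p (u i) \<partial>count_space UNIV)"
proof (cases "(\<integral>\<^sup>+i. eLp M p (u i) \<partial>count_space UNIV) = \<infinity>")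
  case False
  define A where "A i = eLp M p (u i)" for i
  \<comment> \<open>Normalising every term to norm at most 1 turns the series into an average with
    weight \<open>A\<close>. A term of norm 0 cannot be normalised, but it vanishes almost
    everywhere.\<close>
  define v where "v i x = (if A i = 0 then 0 else (1 / A i) * u i x)" for i x
  have Af: "A i \<noteq> \<infinity>" for i
  proof
    assume "A i = \<infinity>"
    moreover have "(\<integral>\<^sup>+j. A j * indicator {i} j \<partial>count_space UNIV) \<le> (\<integral>\<^sup>+i. A i \<partial>count_space UNIV)"
      by (intro nn_integral_mono) (auto simp: indicator_def)
    ultimately show False using False by (simp add: A_def nn_integral_indicator_singleton top_unique)
  qed
  have v[measurable]: "v i \<in> borel_measurable M" for i unfolding v_def by measurable
  have inv: "A i * (1 / A i) = 1" if "A i \<noteq> 0" for i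
    using that Af[of i] by (simp add: ennreal_times_divide ennreal_divide_self less_top)
  have v1: "eLp M p (v i) \<le> 1" for i
  proof (cases "A i = 0")
    case True
    then have "eLp M p (v i) = 0" using p by (subst eLp_eq_0_iff) (auto simp: v_def)
    then show ?thesis by simp
  next
    case False
    have "eLp M p (v i) \<le> (1 / A i) * A i" 
      using eLp_cmult[OF _ p, of "u i" M "1 / A i"] False by (simp add: v_def[abs_def] A_def)
    then show ?thesis using inv[OF False] by (simp add: mult.commute)
  qed
  have "AE x in M. u i x = A i * v i x" for i
  proof (cases "A i = 0")
    case True
    then have "AE x in M. u i x = 0" using eLp_eq_0_iff[OF _ p, of "u i" M] by (simp add: A_def)
    then show ?thesis using True by simp
  next
    case False
    then show ?thesis using inv[OF False] by (simp add: v_def mult.assoc[symmetric])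
  qed
  then have "AE x in M. \<forall>i. u i x = A i * v i x" by (simp add: AE_all_countable)
  then have *: "AE x in M. (\<integral>\<^sup>+i. u i x \<partial>count_space UNIV) = (\<integral>\<^sup>+i. A i * v i x \<partial>count_space UNIV)"
    by eventually_elim simp
  have mv: "(\<lambda>(x, t). v t x) \<in> borel_measurable (M \<Otimes>\<^sub>M count_space UNIV)"
    by (subst measurable_pair_swap_iff, rule measurable_pair_measure_countable1) auto
  have [measurable]: "(\<lambda>(x, t). u t x) \<in> borel_measurable (M \<Otimes>\<^sub>M count_space UNIV)"
    by (subst measurable_pair_swap_iff, rule measurable_pair_measure_countable1) auto
  interpret N: sigma_finite_measure "count_space (UNIV :: 'i set)"
    by (rule sigma_finite_measure_count_space)
  have "eLp M p (\<lambda>x. \<integral>\<^sup>+i. u i x \<partial>count_space UNIV) = eLp M p (\<lambda>x. \<integral>\<^sup>+i. A i * v i x \<partial>count_space UNIV)"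
    using mv by (intro eLp_cong_AE * p) measurable
  also have "\<dots> \<le> (\<integral>\<^sup>+i. A i \<partial>count_space UNIV) * 1"
    using False by (intro eLp_minkowski_weighted assms(1) N.sigma_finite_measure_axioms mv v1 p)
       (auto simp: A_def less_top)
  finally show ?thesis by (simp add: A_def)
qed simp

text \<open>The relation between the exponents lives in \<open>ennreal\<close>, where
  \<open>1 / \<infinity> = 0\<close>; an infinite exponent means that one factor is bounded almost
  everywhere. For finite exponents Young's inequality is applied pointwise to the factors divided by
  their norms, which yields the constant 1 for every admissible \<open>p\<close>, not just for
  \<open>p = 1\<close>.\<close>

lemma eLp_holder:
  assumes [measurable]: "u \<in> borel_measurable M" "v \<in> borel_measurable M"
    and p: "1 \<le> p" "1 \<le> p1" "1 \<le> p2" "1 / p = 1 / p1 + 1 / p2"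
  shows "eLp M p (\<lambda>x. u x * v x) \<le> eLp M p1 u * eLp M p2 v"
proof -
  \<comment> \<open>Inversion is injective on exponents from 1 on; this recovers
    \<open>p2 = p\<close> from \<open>p1 = \<infinity>\<close> and \<open>p1 = p\<close> from
    \<open>p2 = \<infinity>\<close>.\<close>
  have inj: "a = b" if t: "1 / a = 1 / b" "1 \<le> a" "1 \<le> b" for a b :: ennreal
  proof (cases "a = top")
    case True
    then show ?thesis using t by (simp add: ennreal_divide_eq_0_iff)
  next
    case False
    then have "b \<noteq> top" using t by (auto simp: ennreal_divide_eq_0_iff)
    then obtain x y where xy: "a = ennreal x" "b = ennreal y" "1 \<le> x" "1 \<le> y"
      using False t by (cases a; cases b) auto
    then have "1 / a = ennreal (1 / x)" "1 / b = ennreal (1 / y)"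
      using divide_ennreal[of 1 x] divide_ennreal[of 1 y] by simp_all
    then show ?thesis using t xy by simp
  qed
  consider "p1 = \<infinity>" | "p2 = \<infinity>" | "p1 \<noteq> \<infinity>" "p2 \<noteq> \<infinity>" by blast
  then show ?thesis
  proof cases
    case 1
    then have "1 / p2 = 1 / p" using p(4) by simp
    then have pp: "p2 = p" by (rule inj[OF _ p(3,1)])
    have "AE x in M. u x \<le> eLp M \<infinity> u" using eLp_inf_le_iff[OF assms(1)] by blast
    then have "AE x in M. u x * v x \<le> eLp M \<infinity> u * v x"
      by eventually_elim (simp add: mult_right_mono)
    then have "eLp M p (\<lambda>x. u x * v x) \<le> eLp M p (\<lambda>x. eLp M \<infinity> u * v x)"
      using p(1) by (intro eLp_mono_AE) auto
    also have "\<dots> \<le> eLp M \<infinity> u * eLp M p v" using p(1) by (intro eLp_cmult) auto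
    finally show ?thesis using 1 pp by simp
  next
    case 2
    then have "1 / p1 = 1 / p" using p(4) by simp
    then have pp: "p1 = p" by (rule inj[OF _ p(2,1)])
    have "AE x in M. v x \<le> eLp M \<infinity> v" using eLp_inf_le_iff[OF assms(2)] by blast
    then have "AE x in M. u x * v x \<le> eLp M \<infinity> v * u x"
      by eventually_elim (subst mult.commute, simp add: mult_right_mono)
    then have "eLp M p (\<lambda>x. u x * v x) \<le> eLp M p (\<lambda>x. eLp M \<infinity> v * u x)"
      using p(1) by (intro eLp_mono_AE) auto
    also have "\<dots> \<le> eLp M \<infinity> v * eLp M p u" using p(1) by (intro eLp_cmult) auto
    finally show ?thesis using 2 pp by (simp add: mult.commute)
  next
    case 3
    define a b where "a = enn2real p1" and "b = enn2real p2"
    have ab: "1 \<le> a" "1 \<le> b" "p1 = ennreal a" "p2 = ennreal b"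
      using 3 enn2real_ge_1 p(2,3) by (auto simp: a_def b_def less_top)
    have "1 / p = ennreal (1 / a + 1 / b)"
      using ab p(4) by (simp add: ennreal_plus divide_ennreal[symmetric])
    moreover have "1 / a + 1 / b > 0" using ab by (simp add: add_pos_pos)
    ultimately have "p \<noteq> \<infinity>" by (auto simp: divide_ennreal_def)
    then obtain r where r: "p = ennreal r" "1 \<le> r" using p(1) by (cases p) auto
    have rr: "1 / r = 1 / a + 1 / b"
    proof -
      have "ennreal (1 / r) = ennreal (1 / a + 1 / b)"
        using \<open>1 / p = ennreal (1 / a + 1 / b)\<close> r divide_ennreal[of 1 r] by simp
      then show ?thesis using r ab by (subst (asm) ennreal_inj) auto
    qed
    \<comment> \<open>\<open>r / a\<close> and \<open>r / b\<close> are the two weights of Young's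
      inequality below.\<close>
    have "r / a + r / b = r * (1 / r)" by (subst rr) (simp add: distrib_left)
    then have r1: "r / a + r / b = 1" using r by simp
    define A where "A = eLp M p1 u"
    define B where "B = eLp M p2 v"
    show ?thesis
    proof (cases "A = 0 \<or> B = 0")
      case True
      then have "AE x in M. u x * v x = 0"
      proof
        assume "A = 0"
        then have "AE x in M. u x = 0" using p(2) by (simp add: A_def eLp_eq_0_iff)
        then show ?thesis by eventually_elim simp
      next
        assume "B = 0"
        then have "AE x in M. v x = 0" using p(3) by (simp add: B_def eLp_eq_0_iff)
        then show ?thesis by eventually_elim simp
      qed
      then have "eLp M p (\<lambda>x. u x * v x) = 0" using p(1) by (subst eLp_eq_0_iff) auto
      then show ?thesis by simp
    next
      case nz: False
      show ?thesis
      proof (cases "A = \<infinity> \<or> B = \<infinity>")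
        case True
        then show ?thesis using nz by (auto simp: A_def B_def ennreal_mult_top ennreal_top_mult)
      next
        case False
        obtain \<alpha> where \<alpha>: "A = ennreal \<alpha>" "0 < \<alpha>" using nz False by (cases A) auto
        obtain \<beta> where \<beta>: "B = ennreal \<beta>" "0 < \<beta>" using nz False by (cases B) auto
        \<comment> \<open>Young's inequality for \<open>(s / \<alpha>) powr a\<close> and
          \<open>(t / \<beta>) powr b\<close>, multiplied by
          \<open>(\<alpha> * \<beta>) powr r\<close>. After integration each of the two terms
          contributes at most its weight, and the weights sum to 1.\<close>
        have pt: "ennpowr (x * y) r \<le> ennreal ((\<alpha> * \<beta>) powr r) *
            (ennreal (r / a * (1 / \<alpha>) powr a) * ennpowr x a + ennreal (r / b * (1 / \<beta>) powr b) * ennpowr y b)" for x y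
        proof (cases "x = 0 \<or> y = 0")
          case F: False
          show ?thesis
          proof (cases "x = top \<or> y = top")
            case True
            then show ?thesis using F \<alpha> \<beta> ab r by (auto simp: ennreal_mult_top)
          next
            case False
            obtain s where s: "x = ennreal s" "0 < s" using F False by (cases x) auto
            obtain t where t: "y = ennreal t" "0 < t" using F False by (cases y) auto
            have "((s / \<alpha>) powr a) powr (r / a) * ((t / \<beta>) powr b) powr (r / b)
                \<le> r / a * (s / \<alpha>) powr a + r / b * (t / \<beta>) powr b"
              using s t \<alpha> \<beta> ab r r1 by (intro Youngs_inequality_0) auto
            moreover have "((s / \<alpha>) powr a) powr (r / a) = (s / \<alpha>) powr r" "((t / \<beta>) powr b) powr (r / b) = (t / \<beta>) powr r"
              using ab by (simp_all add: powr_powr)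
            ultimately have "(\<alpha> * \<beta>) powr r * ((s / \<alpha>) powr r * (t / \<beta>) powr r)
                \<le> (\<alpha> * \<beta>) powr r * (r / a * (s / \<alpha>) powr a + r / b * (t / \<beta>) powr b)"
              by (intro mult_left_mono) auto
            moreover have "(\<alpha> * \<beta>) powr r * ((s / \<alpha>) powr r * (t / \<beta>) powr r) = (s * t) powr r"
              using s t \<alpha> \<beta> by (simp add: powr_mult[symmetric])
            moreover have "(s / \<alpha>) powr a = (1 / \<alpha>) powr a * s powr a" "(t / \<beta>) powr b = (1 / \<beta>) powr b * t powr b"
              using s t \<alpha> \<beta> by (simp_all add: powr_divide)
            ultimately have "(s * t) powr r \<le> (\<alpha> * \<beta>) powr r * (r / a * (1 / \<alpha>) powr a * s powr a + r / b * (1 / \<beta>) powr b * t powr b)"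
              by (simp add: mult.assoc)
            then show ?thesis using s t \<alpha> \<beta> ab r
              by (simp add: ennreal_leI flip: ennreal_mult' ennreal_plus)
          qed
        qed auto
        have Ia: "(\<integral>\<^sup>+x. ennpowr (u x) a \<partial>M) \<le> ennreal (\<alpha> powr a)"
          using eLp_le_iff[OF p(2), of M u A] 3 \<alpha> by (simp add: A_def a_def)
        have Ib: "(\<integral>\<^sup>+x. ennpowr (v x) b \<partial>M) \<le> ennreal (\<beta> powr b)"
          using eLp_le_iff[OF p(3), of M v B] 3 \<beta> by (simp add: B_def b_def)
        have "(\<integral>\<^sup>+x. ennpowr (u x * v x) r \<partial>M) \<le> (\<integral>\<^sup>+x. ennreal ((\<alpha> * \<beta>) powr r) *
            (ennreal (r / a * (1 / \<alpha>) powr a) * ennpowr (u x) a + ennreal (r / b * (1 / \<beta>) powr b) * ennpowr (v x) b) \<partial>M)"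
          by (intro nn_integral_mono pt)
        also have "\<dots> = ennreal ((\<alpha> * \<beta>) powr r) *
            (ennreal (r / a * (1 / \<alpha>) powr a) * (\<integral>\<^sup>+x. ennpowr (u x) a \<partial>M)
           + ennreal (r / b * (1 / \<beta>) powr b) * (\<integral>\<^sup>+x. ennpowr (v x) b \<partial>M))"
          by (simp add: nn_integral_cmult nn_integral_add)
        also have "\<dots> \<le> ennreal ((\<alpha> * \<beta>) powr r) *
            (ennreal (r / a * (1 / \<alpha>) powr a) * ennreal (\<alpha> powr a)
           + ennreal (r / b * (1 / \<beta>) powr b) * ennreal (\<beta> powr b))"
          by (intro mult_left_mono add_mono Ia Ib) auto
        also have "\<dots> = ennreal ((\<alpha> * \<beta>) powr r * (r / a * ((1 / \<alpha>) powr a * \<alpha> powr a) + r / b * ((1 / \<beta>) powr b * \<beta> powr b)))"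
          using r ab by (simp add: mult.assoc flip: ennreal_mult' ennreal_plus)
        also have "\<dots> = ennpowr (A * B) r"
          using \<alpha> \<beta> r1 by (simp add: powr_mult[symmetric] flip: ennreal_mult')
        finally show ?thesis
          using r by (subst eLp_le_iff[OF p(1) \<open>p \<noteq> \<infinity>\<close>]) (simp add: A_def B_def)
      qed
    qed
  qed
qed

subsection \<open>The Fourier integral and its inversion\<close>

text \<open>Lebesgue measure is the image of the product of its one-dimensional copies under the
  coordinate map, so both claims are Fubini's theorem for finitely many independent
  variables.\<close>

lemma
  fixes f :: "'a::euclidean_space \<Rightarrow> real \<Rightarrow> 'b::{real_normed_field,banach,second_countable_topology}"
  assumes f: "\<And>b. b \<in> Basis \<Longrightarrow> integrable lborel (f b)"
  shows integrable_lborel_prod_Basis: "integrable lborel (\<lambda>x::'a. \<Prod>b\<in>Basis. f b (x \<bullet> b))"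
    and integral_lborel_prod_Basis: "(LINT x|lborel. (\<Prod>b\<in>Basis. f b (x \<bullet> b))) = (\<Prod>b\<in>Basis. (LINT t|lborel. f b t))"
proof -
  interpret product_sigma_finite "\<lambda>_::'a. lborel :: real measure" ..
  let ?T = "\<lambda>g :: 'a \<Rightarrow> real. \<Sum>b\<in>Basis. g b *\<^sub>R b"
  have T [measurable]: "?T \<in> (\<Pi>\<^sub>M b\<in>Basis. lborel) \<rightarrow>\<^sub>M borel" by measurable
  have [measurable]: "b \<in> Basis \<Longrightarrow> f b \<in> borel_measurable borel" for b
    using f[of b] by auto
  have F [measurable]: "(\<lambda>x::'a. \<Prod>b\<in>Basis. f b (x \<bullet> b)) \<in> borel_measurable borel" by measurable
  have eq: "(\<Prod>b\<in>Basis. f b (?T g \<bullet> b)) = (\<Prod>b\<in>Basis. f b (g b))" for g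
    by (intro prod.cong) auto
  show "integrable lborel (\<lambda>x::'a. \<Prod>b\<in>Basis. f b (x \<bullet> b))"
    by (subst lborel_eq, subst integrable_distr_eq[OF T F]) (use f in \<open>simp only: eq, intro product_integrable_prod, auto\<close>)
  have "(LINT x|lborel. (\<Prod>b\<in>Basis. f b (x \<bullet> b))) = (LINT g|(\<Pi>\<^sub>M b\<in>Basis. lborel). (\<Prod>b\<in>Basis. f b (g b)))"
    by (subst lborel_eq, subst integral_distr[OF T F]) (simp only: eq)
  also have "\<dots> = (\<Prod>b\<in>Basis. (LINT t|lborel. f b t))" using f by (intro product_integral_prod) auto
  finally show "(LINT x|lborel. (\<Prod>b\<in>Basis. f b (x \<bullet> b))) = (\<Prod>b\<in>Basis. (LINT t|lborel. f b t))" .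
qed

text \<open>A product of one-variable functions rather than a power of \<open>1 + norm x\<close>: it
  is integrable by Fubini, and two derivatives in each coordinate direction suffice to reach
  it.\<close>

definition decay :: "'a::euclidean_space \<Rightarrow> real" where
  "decay x = (\<Prod>b\<in>Basis. 1 / (1 + (x \<bullet> b)\<^sup>2))"

lemma decay_pos: "0 < decay x"
  unfolding decay_def by (intro prod_pos) (auto simp: add_pos_nonneg)

lemma integrable_decay: "integrable lborel (decay :: 'a::euclidean_space \<Rightarrow> real)"
proof -
  have "integrable lborel (\<lambda>x::real. 1 / (1 + x\<^sup>2))"
    using integrable_inverse_1_plus_square by (simp add: set_integrable_def inverse_eq_divide)
  from integrable_lborel_prod_Basis[of "\<lambda>_ x. 1 / (1 + x\<^sup>2)"] this show ?thesis
    unfolding decay_def[abs_def] by blast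
qed

lemma borel_measurable_decay [measurable]: "decay \<in> borel_measurable borel"
  using integrable_decay by auto

text \<open>Each of the \<open>DIM('a)\<close> factors of \<open>decay x\<close> is at least
  \<open>1 / (1 + norm x)\<^sup>2\<close>, whence the exponent.\<close>

lemma decay_ge: "1 / (1 + norm x) ^ (2 * DIM('a)) \<le> decay x" for x :: "'a::euclidean_space"
proof -
  have "1 / (1 + norm x) ^ (2 * DIM('a)) = (\<Prod>b\<in>(Basis::'a set). 1 / (1 + norm x)\<^sup>2)"
    by (simp add: power_mult power_divide)
  also have "\<dots> \<le> decay x"
    unfolding decay_def
  proof (intro prod_mono conjI)
    fix b :: 'a assume b: "b \<in> Basis"
    have "(x \<bullet> b)\<^sup>2 \<le> (norm x)\<^sup>2" using Basis_le_norm[OF b, of x] by (simp add: abs_le_square_iff[symmetric])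
    then have "1 + (x \<bullet> b)\<^sup>2 \<le> (1 + norm x)\<^sup>2" by (simp add: power2_sum add_increasing2)
    then show "1 / (1 + norm x)\<^sup>2 \<le> 1 / (1 + (x \<bullet> b)\<^sup>2)"
      by (intro divide_left_mono) (auto intro!: mult_pos_pos add_pos_nonneg simp: add_nonneg_eq_0_iff)
  qed auto
  finally show ?thesis .
qed

section \<open>Changes of variables and exchange of integrals\<close>

lemma nn_integral_lborel_affine:
  fixes f :: "'a::euclidean_space \<Rightarrow> ennreal"
  assumes [measurable]: "f \<in> borel_measurable borel" and c: "c \<noteq> 0"
  shows "(\<integral>\<^sup>+x. f x \<partial>lborel) = ennreal (\<bar>c\<bar> ^ DIM('a)) * (\<integral>\<^sup>+x. f (t + c *\<^sub>R x) \<partial>lborel)"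
  by (subst lborel_affine[OF c, of t])
     (simp add: nn_integral_density nn_integral_distr nn_integral_cmult)

lemma integrable_lborel_affine:
  fixes f :: "'a::euclidean_space \<Rightarrow> 'b::{banach, second_countable_topology}"
  assumes f: "integrable lborel f" and c: "c \<noteq> 0"
  shows "integrable lborel (\<lambda>x. f (t + c *\<^sub>R x))"
proof -
  have [measurable]: "f \<in> borel_measurable borel" using f by auto
  show ?thesis using f c unfolding integrable_iff_bounded
    by (subst (asm) nn_integral_lborel_affine[OF _ c, of _ t]) (auto simp: ennreal_mult_less_top)
qed

text \<open>An affine change of variables preserves integrability in both directions, so for a
  non-integrable \<open>f\<close> both integrals take the default value 0 and the identity
  persists.\<close>

lemma integral_lborel_affine:
  fixes f :: "'a::euclidean_space \<Rightarrow> 'b::{banach, second_countable_topology}"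
  assumes c: "c \<noteq> 0"
  shows "(LINT x|lborel. f x) = \<bar>c\<bar> ^ DIM('a) *\<^sub>R (LINT x|lborel. f (t + c *\<^sub>R x))"
proof cases
  assume f: "integrable lborel f"
  then have [measurable]: "f \<in> borel_measurable borel" by auto
  show ?thesis using integrable_lborel_affine[OF f c, of t]
    by (subst lborel_affine[OF c, of t]) (simp add: integral_density integral_distr)
next
  assume "\<not> integrable lborel f"
  moreover have "\<not> integrable lborel (\<lambda>x. f (t + c *\<^sub>R x))"
  proof
    assume *: "integrable lborel (\<lambda>x. f (t + c *\<^sub>R x))"
    have "integrable lborel (\<lambda>x. f (t + c *\<^sub>R ((- t /\<^sub>R c) + (1 / c) *\<^sub>R x)))"
      by (rule integrable_lborel_affine[OF *]) (use c in auto)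
    moreover have "t + c *\<^sub>R ((- t /\<^sub>R c) + (1 / c) *\<^sub>R x) = x" for x
      using c by (simp add: scaleR_right_diff_distrib)
    ultimately show False using \<open>\<not> integrable lborel f\<close> by simp
  qed
  ultimately show ?thesis by (simp add: not_integrable_integral_eq)
qed

lemma nn_integral_lborel_shift:
  fixes f :: "'a::euclidean_space \<Rightarrow> ennreal"
  assumes [measurable]: "f \<in> borel_measurable borel"
  shows "(\<integral>\<^sup>+x. f (x - t) \<partial>lborel) = (\<integral>\<^sup>+x. f x \<partial>lborel)" "(\<integral>\<^sup>+x. f (t - x) \<partial>lborel) = (\<integral>\<^sup>+x. f x \<partial>lborel)"
  using nn_integral_lborel_affine[of f 1 "- t"] nn_integral_lborel_affine[of f "-1" t] by simp_all

text \<open>Absolute integrability is assumed in iterated form because the applications verify it by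
  evaluating the inner integral of the modulus and bounding the outer one.\<close>

lemma
  fixes f :: "'a \<Rightarrow> 'b \<Rightarrow> 'c::{banach, second_countable_topology}"
  assumes "sigma_finite_measure M" "sigma_finite_measure N"
    and f [measurable]: "(\<lambda>(x, y). f x y) \<in> borel_measurable (M \<Otimes>\<^sub>M N)"
    and fin: "(\<integral>\<^sup>+x. \<integral>\<^sup>+y. norm (f x y) \<partial>N \<partial>M) < \<infinity>"
  shows Fubini_swap: "(LINT x|M. LINT y|N. f x y) = (LINT y|N. LINT x|M. f x y)"
    and integrable_Fubini_snd: "integrable N (\<lambda>y. LINT x|M. f x y)"
proof -
  interpret pair_sigma_finite M N using assms(1,2) by (simp add: pair_sigma_finite_def)
  have int: "integrable (M \<Otimes>\<^sub>M N) (\<lambda>(x, y). f x y)"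
  proof (rule integrableI_bounded)
    have "(\<integral>\<^sup>+p. norm (case p of (x, y) \<Rightarrow> f x y) \<partial>(M \<Otimes>\<^sub>M N)) = (\<integral>\<^sup>+x. \<integral>\<^sup>+y. norm (f x y) \<partial>N \<partial>M)"
      by (subst M2.nn_integral_fst[symmetric]) auto
    then show "(\<integral>\<^sup>+p. norm (case p of (x, y) \<Rightarrow> f x y) \<partial>(M \<Otimes>\<^sub>M N)) < \<infinity>" using fin by simp
  qed measurable
  from Fubini_integral[OF int] show "(LINT x|M. LINT y|N. f x y) = (LINT y|N. LINT x|M. f x y)" by simp
  from integrable_snd[OF int] show "integrable N (\<lambda>y. LINT x|M. f x y)" by simp
qed

text \<open>The inverse Fourier integral without its power of \<open>2 * pi\<close>; the constants
  are put back in \<open>kern\<close>.\<close>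

definition ftr :: "('a::euclidean_space \<Rightarrow> complex) \<Rightarrow> 'a \<Rightarrow> complex" where
  "ftr s x = (LINT \<xi>|lborel. s \<xi> * cis (x \<bullet> \<xi>))"

lemma borel_measurable_cis [measurable]: "cis \<in> borel_measurable borel"
  by (intro borel_measurable_continuous_onI continuous_intros)

lemma integrable_mult_cis:
  fixes s :: "'a \<Rightarrow> complex"
  assumes "integrable M s" "g \<in> borel_measurable M"
  shows "integrable M (\<lambda>\<xi>. s \<xi> * cis (g \<xi>))"
  by (rule Bochner_Integration.integrable_bound[OF assms(1)]) (use assms in \<open>auto simp: norm_mult\<close>)

lemma borel_measurable_ftr [measurable]:
  assumes [measurable]: "s \<in> borel_measurable borel"
  shows "ftr s \<in> borel_measurable borel"
  unfolding ftr_def[abs_def] by measurable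

lemma norm_ftr_le:
  assumes "integrable lborel s"
  shows "norm (ftr s x) \<le> (LINT \<xi>|lborel. norm (s \<xi>))"
  unfolding ftr_def
  by (rule order_trans[OF integral_norm_bound]) (simp add: norm_mult)

text \<open>Both the Gaussian and the character split over the coordinates, which leaves the
  characteristic function of the standard normal distribution in each of them.\<close>

lemma integral_gauss:
  fixes y :: "'a::euclidean_space"
  shows "integrable lborel (\<lambda>x::'a. exp (- (norm x)\<^sup>2 / 2))"
    and "(LINT x|lborel. of_real (exp (- (norm x)\<^sup>2 / 2)) * cis (x \<bullet> y))
      = of_real (sqrt (2 * pi) ^ DIM('a) * exp (- (norm y)\<^sup>2 / 2))"
proof -
  have i1: "integrable lborel (\<lambda>t::real. exp (- t\<^sup>2 / 2))"
    using integrable_mult_right[OF integrable_std_normal_moment[of 0], of "sqrt (2 * pi)"]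
    by (simp add: std_normal_density_def)
  have sq: "(norm x)\<^sup>2 = (\<Sum>b\<in>Basis. (x \<bullet> b)\<^sup>2)" for x :: 'a
    unfolding power2_norm_eq_inner by (subst euclidean_inner) (simp add: power2_eq_square)
  have ex: "exp (- (norm x)\<^sup>2 / 2) = (\<Prod>b\<in>Basis. exp (- (x \<bullet> b)\<^sup>2 / 2))" for x :: 'a
    by (simp add: sq exp_sum[symmetric] sum_negf sum_divide_distrib)
  show "integrable lborel (\<lambda>x::'a. exp (- (norm x)\<^sup>2 / 2))"
    unfolding ex by (rule integrable_lborel_prod_Basis) (rule i1)
  have ci: "cis (x \<bullet> y) = (\<Prod>b\<in>Basis. cis ((y \<bullet> b) * (x \<bullet> b)))" for x :: 'a
  proof -
    have "cis (sum g A) = (\<Prod>b\<in>A. cis (g b))" if "finite A" for A :: "'a set" and g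
      using that by (induction A rule: finite_induct) (auto simp: cis_mult[symmetric])
    then show ?thesis by (subst euclidean_inner) (simp add: mult.commute)
  qed
  have one: "(LINT t|lborel. of_real (exp (- t\<^sup>2 / 2)) * cis (a * t)) = of_real (sqrt (2 * pi) * exp (- a\<^sup>2 / 2))" for a
  proof -
    have "char std_normal_distribution a = (LINT t|lborel. std_normal_density t *\<^sub>R iexp (a * t))"
      unfolding char_def by (subst integral_density) (auto simp: normal_density_nonneg)
    also have "\<dots> = (LINT t|lborel. of_real (1 / sqrt (2 * pi)) * (of_real (exp (- t\<^sup>2 / 2)) * cis (a * t)))"
      by (intro Bochner_Integration.integral_cong) (auto simp: std_normal_density_def scaleR_conv_of_real cis_conv_exp)
    also have "\<dots> = of_real (1 / sqrt (2 * pi)) * (LINT t|lborel. of_real (exp (- t\<^sup>2 / 2)) * cis (a * t))"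
      by simp
    finally show ?thesis by (simp add: char_std_normal_distribution field_simps)
  qed
  have "(LINT x|lborel. of_real (exp (- (norm x)\<^sup>2 / 2)) * cis (x \<bullet> y)) =
    (LINT x|lborel. (\<Prod>b\<in>Basis. of_real (exp (- (x \<bullet> b)\<^sup>2 / 2)) * cis ((y \<bullet> b) * (x \<bullet> b))))"
    by (simp only: ex ci of_real_prod prod.distrib)
  also have "\<dots> = (\<Prod>b\<in>Basis. (LINT t|lborel. of_real (exp (- t\<^sup>2 / 2)) * cis ((y \<bullet> b) * t)))"
    by (rule integral_lborel_prod_Basis) (intro integrable_mult_cis integrable_of_real i1, measurable)
  also have "\<dots> = of_real (sqrt (2 * pi) ^ DIM('a) * exp (- (norm y)\<^sup>2 / 2))"
    by (simp only: one ex of_real_prod of_real_mult prod.distrib prod_constant of_real_power)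
  finally show "(LINT x|lborel. of_real (exp (- (norm x)\<^sup>2 / 2)) * cis (x \<bullet> y))
      = of_real (sqrt (2 * pi) ^ DIM('a) * exp (- (norm y)\<^sup>2 / 2))" .
qed

text \<open>Damp the outer integral by \<open>exp (- \<epsilon>\<^sup>2 |x|\<^sup>2 / 2)\<close> and let \<open>\<epsilon> \<rightarrow> 0\<close>.\<close>

lemma ftr_inversion:
  fixes s :: "'a::euclidean_space \<Rightarrow> complex"
  assumes cont: "continuous_on UNIV s" and int: "integrable lborel s"
    and bd: "\<And>\<xi>. norm (s \<xi>) \<le> B" and ift: "integrable lborel (ftr s)"
  shows "(LINT x|lborel. ftr s x * cis (- (y \<bullet> x))) = of_real ((2 * pi) ^ DIM('a)) * s y"
proof -
  define e where "e j = 1 / real (Suc j)" for j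
  have e: "e j > 0" for j by (simp add: e_def)
  have e0: "e \<longlonglongrightarrow> 0" unfolding e_def[abs_def] by (rule LIMSEQ_Suc[OF lim_1_over_n])
  have [measurable]: "s \<in> borel_measurable borel" using int by auto
  let ?G = "\<lambda>x::'a. exp (- (norm x)\<^sup>2 / 2)"
  let ?c = "sqrt (2 * pi) ^ DIM('a)"
  \<comment> \<open>With the damping the double integral converges absolutely. Its inner integral
    over \<open>x\<close> is the transform of a Gaussian, a bump of width \<open>e j\<close> around
    \<open>y\<close>; substituting \<open>\<xi> = y + e j *\<^sub>R u\<close> cancels the powers of
    \<open>e j\<close>.\<close>
  have key: "(LINT x|lborel. ftr s x * cis (- (y \<bullet> x)) * of_real (?G (e j *\<^sub>R x)))
     = of_real ?c * (LINT u|lborel. s (y + e j *\<^sub>R u) * of_real (?G u))" for j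
  proof -
    have iG: "integrable lborel (\<lambda>x. ?G (e j *\<^sub>R x))"
      using integrable_lborel_affine[OF integral_gauss(1), of "e j" 0] e[of j] by simp
    have "(LINT x|lborel. ftr s x * cis (- (y \<bullet> x)) * of_real (?G (e j *\<^sub>R x))) =
      (LINT x|lborel. LINT \<xi>|lborel. s \<xi> * (of_real (?G (e j *\<^sub>R x)) * cis (x \<bullet> (\<xi> - y))))"
    proof (intro Bochner_Integration.integral_cong refl)
      fix x
      have "s \<xi> * (of_real (?G (e j *\<^sub>R x)) * cis (x \<bullet> (\<xi> - y))) = 
        s \<xi> * cis (x \<bullet> \<xi>) * (cis (- (y \<bullet> x)) * of_real (?G (e j *\<^sub>R x)))" for \<xi>
    proof -
      have "cis (x \<bullet> (\<xi> - y)) = cis (x \<bullet> \<xi>) * cis (- (y \<bullet> x))"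
        by (simp add: cis_mult inner_diff_right inner_commute)
      then show ?thesis by simp
    qed
      then have "(LINT \<xi>|lborel. s \<xi> * (of_real (?G (e j *\<^sub>R x)) * cis (x \<bullet> (\<xi> - y)))) = 
        (LINT \<xi>|lborel. s \<xi> * cis (x \<bullet> \<xi>)) * (cis (- (y \<bullet> x)) * of_real (?G (e j *\<^sub>R x)))"
        by (simp only: integral_mult_left_zero)
      then show "ftr s x * cis (- (y \<bullet> x)) * of_real (?G (e j *\<^sub>R x)) = 
        (LINT \<xi>|lborel. s \<xi> * (of_real (?G (e j *\<^sub>R x)) * cis (x \<bullet> (\<xi> - y))))"
        by (simp only: ftr_def mult.assoc)
    qed
    also have "\<dots> = (LINT \<xi>|lborel. LINT x|lborel. s \<xi> * (of_real (?G (e j *\<^sub>R x)) * cis (x \<bullet> (\<xi> - y))))"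
    proof (rule Fubini_swap)
      have "(\<integral>\<^sup>+x. \<integral>\<^sup>+\<xi>. norm (s \<xi> * (of_real (?G (e j *\<^sub>R x)) * cis (x \<bullet> (\<xi> - y)))) \<partial>lborel \<partial>lborel) =
        (\<integral>\<^sup>+x. ennreal (?G (e j *\<^sub>R x)) * (\<integral>\<^sup>+\<xi>. norm (s \<xi>) \<partial>lborel) \<partial>lborel)"
        by (subst nn_integral_cmult[symmetric]) (auto simp: norm_mult ennreal_mult mult.commute)
      also have "\<dots> = (\<integral>\<^sup>+x. ennreal (?G (e j *\<^sub>R x)) \<partial>lborel) * (\<integral>\<^sup>+\<xi>. norm (s \<xi>) \<partial>lborel)"
        by (rule nn_integral_multc) measurable
      also have "\<dots> < \<infinity>" using iG int by (auto simp: integrable_iff_bounded ennreal_mult_less_top)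
      finally show "(\<integral>\<^sup>+x. \<integral>\<^sup>+\<xi>. norm (s \<xi> * (of_real (?G (e j *\<^sub>R x)) * cis (x \<bullet> (\<xi> - y)))) \<partial>lborel \<partial>lborel) < \<infinity>" .
    qed (auto intro: lborel.sigma_finite_measure_axioms)
    also have "\<dots> = (LINT \<xi>|lborel. s \<xi> * of_real (1 / e j ^ DIM('a) * (?c * ?G ((\<xi> - y) /\<^sub>R e j))))"
    proof (intro Bochner_Integration.integral_cong refl)
      fix \<xi>
      have "(LINT x|lborel. of_real (?G x) * cis (x \<bullet> ((\<xi> - y) /\<^sub>R e j))) =
        e j ^ DIM('a) *\<^sub>R (LINT x|lborel. of_real (?G (e j *\<^sub>R x)) * cis (x \<bullet> (\<xi> - y)))"
        using integral_lborel_affine[of "e j" "\<lambda>x. of_real (?G x) * cis (x \<bullet> ((\<xi> - y) /\<^sub>R e j))" 0] e[of j]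
        by (simp add: mult.assoc[symmetric])
      then have "of_real (?c * ?G ((\<xi> - y) /\<^sub>R e j)) = e j ^ DIM('a) *\<^sub>R (LINT x|lborel. of_real (?G (e j *\<^sub>R x)) * cis (x \<bullet> (\<xi> - y)))"
        by (simp only: integral_gauss(2))
      then have "(LINT x|lborel. of_real (?G (e j *\<^sub>R x)) * cis (x \<bullet> (\<xi> - y))) = of_real (1 / e j ^ DIM('a) * (?c * ?G ((\<xi> - y) /\<^sub>R e j)))"
        using e[of j] by (simp only: of_real_mult of_real_divide scaleR_conv_of_real) (simp add: field_simps)
      then show "(LINT x|lborel. s \<xi> * (of_real (?G (e j *\<^sub>R x)) * cis (x \<bullet> (\<xi> - y)))) = s \<xi> * of_real (1 / e j ^ DIM('a) * (?c * ?G ((\<xi> - y) /\<^sub>R e j)))"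
        by (simp only: integral_mult_right_zero)
    qed
    also have "\<dots> = e j ^ DIM('a) *\<^sub>R (LINT u|lborel. s (y + e j *\<^sub>R u) * of_real (1 / e j ^ DIM('a) * (?c * ?G u)))"
      using e[of j] by (subst integral_lborel_affine[of "e j" _ y]) auto
    also have "(LINT u|lborel. s (y + e j *\<^sub>R u) * of_real (1 / e j ^ DIM('a) * (?c * ?G u))) =
       (LINT u|lborel. of_real (1 / e j ^ DIM('a)) * of_real ?c * (s (y + e j *\<^sub>R u) * of_real (?G u)))"
      by (intro Bochner_Integration.integral_cong refl) (simp only: of_real_mult ac_simps)
    also have "\<dots> = of_real (1 / e j ^ DIM('a)) * of_real ?c * (LINT u|lborel. s (y + e j *\<^sub>R u) * of_real (?G u))"
      by (rule integral_mult_right_zero)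
    finally show ?thesis using e[of j] by (simp add: scaleR_conv_of_real)
  qed
  have "(\<lambda>j. LINT x|lborel. ftr s x * cis (- (y \<bullet> x)) * of_real (?G (e j *\<^sub>R x)))
      \<longlonglongrightarrow> (LINT x|lborel. ftr s x * cis (- (y \<bullet> x)))"
  proof (rule integral_dominated_convergence[where w = "\<lambda>x. norm (ftr s x)"])
    show "AE x in lborel. (\<lambda>j. ftr s x * cis (- (y \<bullet> x)) * of_real (?G (e j *\<^sub>R x))) \<longlonglongrightarrow> ftr s x * cis (- (y \<bullet> x))"
    proof (rule AE_I2)
      fix x
      have "(\<lambda>j. ftr s x * cis (- (y \<bullet> x)) * of_real (?G (e j *\<^sub>R x))) \<longlonglongrightarrow> ftr s x * cis (- (y \<bullet> x)) * of_real (?G (0 *\<^sub>R x))"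
        by (intro tendsto_intros e0) simp
      then show "(\<lambda>j. ftr s x * cis (- (y \<bullet> x)) * of_real (?G (e j *\<^sub>R x))) \<longlonglongrightarrow> ftr s x * cis (- (y \<bullet> x))" by simp
    qed
    show "AE x in lborel. norm (ftr s x * cis (- (y \<bullet> x)) * of_real (?G (e j *\<^sub>R x))) \<le> norm (ftr s x)" for j
      by (auto simp: norm_mult intro!: mult_left_le)
  qed (use ift in auto)
  moreover have "(\<lambda>j. of_real ?c * (LINT u|lborel. s (y + e j *\<^sub>R u) * of_real (?G u)))
      \<longlonglongrightarrow> of_real ?c * (LINT u|lborel. s y * of_real (?G u))"
  proof (intro tendsto_mult tendsto_const integral_dominated_convergence[where w = "\<lambda>x. B * ?G x"])
    show "AE x in lborel. (\<lambda>j. s (y + e j *\<^sub>R x) * of_real (?G x)) \<longlonglongrightarrow> s y * of_real (?G x)"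
    proof (rule AE_I2)
      fix x
      have "(\<lambda>j. y + e j *\<^sub>R x) \<longlonglongrightarrow> y + 0 *\<^sub>R x" by (intro tendsto_intros e0)
      then have "(\<lambda>j. s (y + e j *\<^sub>R x)) \<longlonglongrightarrow> s y"
        using cont continuous_on_tendsto_compose[OF cont] by simp
      then show "(\<lambda>j. s (y + e j *\<^sub>R x) * of_real (?G x)) \<longlonglongrightarrow> s y * of_real (?G x)" by (intro tendsto_intros)
    qed
    show "AE x in lborel. norm (s (y + e j *\<^sub>R x) * of_real (?G x)) \<le> B * ?G x" for j
      by (auto simp: norm_mult intro!: mult_right_mono bd)
  qed (use integral_gauss(1)[where 'a = 'a] in auto)
  ultimately have "(LINT x|lborel. ftr s x * cis (- (y \<bullet> x))) = of_real ?c * (LINT u|lborel. s y * of_real (?G u))"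
    unfolding key by (rule LIMSEQ_unique)
  \<comment> \<open>The second factor \<open>?c\<close>: the mass of the Gaussian is its transform
    at 0. Together with the one in \<open>key\<close> it makes up
    \<open>(2 * pi) ^ DIM('a)\<close>.\<close>
  moreover have "(LINT u|lborel. (of_real (?G u) :: complex)) = of_real ?c"
    using integral_gauss(2)[of "0 :: 'a"] by simp
  ultimately have "(LINT x|lborel. ftr s x * cis (- (y \<bullet> x))) = of_real (?c * ?c) * s y"
    by (simp only: integral_mult_right_zero of_real_mult ac_simps)
  moreover have "?c * ?c = (2 * pi) ^ DIM('a)"
    by (subst power_mult_distrib[symmetric]) simp
  ultimately show ?thesis by simp
qed

subsection \<open>Smooth functions and the decay of their transforms\<close>

lemma partials_append: "partials (js @ ks) f = partials js (partials ks f)"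
  by (induction js) simp_all

lemma smooth_partials: "smooth f \<Longrightarrow> smooth (partials ks f)"
  unfolding smooth_def by (simp add: partials_append[symmetric])

lemma smooth_differentiable: "smooth f \<Longrightarrow> f differentiable (at x)"
  unfolding smooth_def by (metis partials.simps(1))

lemma smooth_continuous: "smooth f \<Longrightarrow> continuous_on UNIV f"
  by (meson continuous_at_imp_continuous_on differentiable_imp_continuous_within smooth_differentiable)

text \<open>Smoothness speaks of all iterated partial derivatives. A class of differentiable
  functions that is closed under single ones is an invariant for the iteration, so no formula for
  higher derivatives has to be written down.\<close>

lemma smooth_coinduct:
  assumes "P f" and diff: "\<And>f x. P f \<Longrightarrow> f differentiable (at x)" and pd: "\<And>f j. P f \<Longrightarrow> P (partials [j] f)"
  shows "smooth f"
proof -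
  have "P (partials js f)" for js
  proof (induction js)
    case (Cons j js)
    from pd[OF this, of j] show ?case by simp
  qed (use assms(1) in simp)
  then show ?thesis unfolding smooth_def using diff by blast
qed

lemma partials_single_eqI:
  assumes "\<And>x. (f has_derivative f' x) (at x)"
  shows "partials [j] f = (\<lambda>x. f' x (axis j 1))"
  using frechet_derivative_at[OF assms] by (simp add: fun_eq_iff)

lemma smooth_const: "smooth (\<lambda>x. c)"
proof (rule smooth_coinduct[where P = "\<lambda>f. \<exists>c. f = (\<lambda>x. c)"])
  fix f :: "real^'a \<Rightarrow> 'b" and j assume "\<exists>c. f = (\<lambda>x. c)"
  then have "partials [j] f = (\<lambda>x. 0)" by (intro partials_single_eqI) auto
  then show "\<exists>c. partials [j] f = (\<lambda>x. c)" by blast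
qed auto

lemma smooth_affine:
  assumes "smooth f" shows "smooth (\<lambda>x. f (c *\<^sub>R x + a))"
\<comment> \<open>The invariant carries a scalar \<open>d\<close> because each differentiation
  produces a factor \<open>c\<close>.\<close>
proof (rule smooth_coinduct[where P = "\<lambda>g. \<exists>d f. smooth f \<and> g = (\<lambda>x. d *\<^sub>R f (c *\<^sub>R x + a))"])
  show "\<exists>d fa. smooth fa \<and> (\<lambda>x. f (c *\<^sub>R x + a)) = (\<lambda>x. d *\<^sub>R fa (c *\<^sub>R x + a))"
    using assms by (intro exI[of _ 1] exI[of _ f]) auto
next
  fix g :: "real^'a \<Rightarrow> 'b" and x j
  assume "\<exists>d f. smooth f \<and> g = (\<lambda>x. d *\<^sub>R f (c *\<^sub>R x + a))"
  then obtain d f where f: "smooth f" "g = (\<lambda>x. d *\<^sub>R f (c *\<^sub>R x + a))" by blast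
  have D: "(g has_derivative (\<lambda>h. d *\<^sub>R frechet_derivative f (at (c *\<^sub>R x + a)) (c *\<^sub>R h))) (at x)" for x
  proof -
    have "(f has_derivative frechet_derivative f (at (c *\<^sub>R x + a))) (at (c *\<^sub>R x + a))"
      using smooth_differentiable[OF f(1)] frechet_derivative_works by blast
    moreover have "((\<lambda>x. c *\<^sub>R x + a) has_derivative (\<lambda>h. c *\<^sub>R h)) (at x)"
      by (auto intro!: derivative_eq_intros)
    ultimately show ?thesis
      unfolding f(2) by (intro has_derivative_scaleR_right) (rule has_derivative_compose)
  qed
  then show "g differentiable (at x)" by (auto simp: differentiable_def)
  have lin: "linear (frechet_derivative f (at y))" for y
    using smooth_differentiable[OF f(1)] linear_frechet_derivative by blast
  have "partials [j] g = (\<lambda>x. (d * c) *\<^sub>R partials [j] f (c *\<^sub>R x + a))"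
    using partials_single_eqI[OF D, of j] by (simp add: linear_scale[OF lin])
  then show "\<exists>d f. smooth f \<and> partials [j] g = (\<lambda>x. d *\<^sub>R f (c *\<^sub>R x + a))"
    using smooth_partials[OF f(1)] by blast
qed

text \<open>Derivatives of sums, products and inverses are again built from these operations and
  from smooth functions. The closure is therefore an invariant class for
  \<open>smooth_coinduct\<close>, which gives the product and quotient rules of all orders at
  once.\<close>

inductive smooth_closure :: "(real^'n::finite \<Rightarrow> real) \<Rightarrow> bool" where
  base: "smooth f \<Longrightarrow> smooth_closure f"
| add: "smooth_closure f \<Longrightarrow> smooth_closure g \<Longrightarrow> smooth_closure (\<lambda>x. f x + g x)"
| mult: "smooth_closure f \<Longrightarrow> smooth_closure g \<Longrightarrow> smooth_closure (\<lambda>x. f x * g x)"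
| inverse: "smooth_closure f \<Longrightarrow> (\<And>x. f x \<noteq> 0) \<Longrightarrow> smooth_closure (\<lambda>x. inverse (f x))"

lemma smooth_closure_partial:
  "smooth_closure f \<Longrightarrow> (\<forall>x. f differentiable (at x)) \<and> (\<forall>j. smooth_closure (partials [j] f))"
proof (induction rule: smooth_closure.induct)
  case (base f)
  then show ?case using smooth_closure.base smooth_differentiable smooth_partials by blast
next
  case (add f g)
  have D: "((\<lambda>x. f x + g x) has_derivative
      (\<lambda>h. frechet_derivative f (at x) h + frechet_derivative g (at x) h)) (at x)" for x
    using add.IH by (intro has_derivative_add) (auto simp: frechet_derivative_works)
  have "partials [j] (\<lambda>x. f x + g x) = (\<lambda>x. partials [j] f x + partials [j] g x)" for j
    by (subst partials_single_eqI[OF D]) simp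
  moreover have "smooth_closure (\<lambda>x. partials [j] f x + partials [j] g x)" for j
    using add.IH by (intro smooth_closure.add) blast+
  ultimately show ?case using D by (simp add: differentiable_def del: partials.simps) blast
next
  case (mult f g)
  have D: "((\<lambda>x. f x * g x) has_derivative
      (\<lambda>h. f x * frechet_derivative g (at x) h + frechet_derivative f (at x) h * g x)) (at x)" for x
    using mult.IH by (intro has_derivative_mult) (auto simp: frechet_derivative_works)
  have "partials [j] (\<lambda>x. f x * g x) = (\<lambda>x. f x * partials [j] g x + partials [j] f x * g x)" for j
    by (subst partials_single_eqI[OF D]) simp
  moreover have "smooth_closure (\<lambda>x. f x * partials [j] g x + partials [j] f x * g x)" for j
    using mult by (intro smooth_closure.add smooth_closure.mult) blast+
  ultimately show ?case using D by (simp add: differentiable_def del: partials.simps) blast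
next
  case (inverse f)
  have D: "((\<lambda>x. inverse (f x)) has_derivative
      (\<lambda>h. - (inverse (f x) * frechet_derivative f (at x) h * inverse (f x)))) (at x)" for x
    using inverse by (intro Deriv.has_derivative_inverse) (auto simp: frechet_derivative_works)
  \<comment> \<open>The sign is written as a product with the constant function -1, since the
    closure has no clause for negation.\<close>
  have "partials [j] (\<lambda>x. inverse (f x)) = (\<lambda>x. -1 * (inverse (f x) * partials [j] f x * inverse (f x)))" for j
    by (subst partials_single_eqI[OF D]) simp
  moreover have "smooth_closure (\<lambda>x. -1 * (inverse (f x) * partials [j] f x * inverse (f x)))" for j
    using inverse by (intro smooth_closure.mult smooth_closure.inverse smooth_closure.base[OF smooth_const]) blast+
  ultimately show ?case using D by (simp add: differentiable_def del: partials.simps) blast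
qed

lemma smooth_closure_smooth: "smooth_closure f \<Longrightarrow> smooth f"
  by (rule smooth_coinduct[where P = smooth_closure]) (use smooth_closure_partial in auto)

lemma smooth_add: "smooth f \<Longrightarrow> smooth g \<Longrightarrow> smooth (\<lambda>x. f x + g x :: real)"
  and smooth_mult: "smooth f \<Longrightarrow> smooth g \<Longrightarrow> smooth (\<lambda>x. f x * g x :: real)"
  and smooth_inverse: "smooth f \<Longrightarrow> (\<And>x. f x \<noteq> 0) \<Longrightarrow> smooth (\<lambda>x. inverse (f x) :: real)"
  by (auto intro!: smooth_closure_smooth intro: smooth_closure.intros)

lemma smooth_sum: "(\<And>i. i \<in> A \<Longrightarrow> smooth (f i)) \<Longrightarrow> smooth (\<lambda>x. \<Sum>i\<in>A. f i x :: real)"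
  by (induction A rule: infinite_finite_induct) (auto intro: smooth_const smooth_add)

text \<open>On a Euclidean space this amounts to compact support; vanishing outside a ball passes
  directly to the partial derivatives.\<close>

definition bd_support :: "('a::real_normed_vector \<Rightarrow> 'b::zero) \<Rightarrow> bool" where
  "bd_support f \<longleftrightarrow> (\<exists>R. \<forall>x. R < norm x \<longrightarrow> f x = 0)"

lemma bd_support_partials: "bd_support f \<Longrightarrow> bd_support (partials js f)"
proof -
  assume "bd_support f"
  then obtain R where R: "\<And>x. R < norm x \<Longrightarrow> f x = 0" by (auto simp: bd_support_def)
  have o: "open {x. R < norm x}" by (intro open_Collect_less continuous_intros)
  have "\<forall>x. R < norm x \<longrightarrow> partials js f x = 0"
  proof (induction js)
    case (Cons j js)
    show ?case
    proof (intro allI impI)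
      fix x :: "real^'a" assume x: "R < norm x"
      have "(partials js f has_derivative (\<lambda>_. 0)) (at x)"
        by (rule has_derivative_transform_within_open[OF _ o, of "\<lambda>_. 0"]) (use Cons x in auto)
      from frechet_derivative_at[OF this] show "partials (j # js) f x = 0" by (simp add: fun_eq_iff)
    qed
  qed (use R in auto)
  then show ?thesis by (auto simp: bd_support_def)
qed

lemma bd_support_bounded:
  fixes f :: "'a::euclidean_space \<Rightarrow> 'b::real_normed_vector"
  assumes "bd_support f" "continuous_on UNIV f"
  obtains R B where "R > 0" "\<And>x. R < norm x \<Longrightarrow> f x = 0" "\<And>x. norm (f x) \<le> B * indicator (cball 0 R) x" "B \<ge> 0"
proof -
  obtain R where R: "\<And>x. R < norm x \<Longrightarrow> f x = 0" using assms by (auto simp: bd_support_def)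
  define R' where "R' = max R 1"
  have "compact (f ` cball 0 R')" using assms(2)
    by (intro compact_continuous_image) (auto intro: continuous_on_subset)
  then obtain B where B: "\<And>x. x \<in> cball 0 R' \<Longrightarrow> norm (f x) \<le> B" 
    using compact_imp_bounded bounded_iff by (metis imageI)
  show ?thesis
  proof
    show "R' > 0" "\<And>x. R' < norm x \<Longrightarrow> f x = 0" using R by (auto simp: R'_def)
    show "norm (f x) \<le> \<bar>B\<bar> * indicator (cball 0 R') x" for x
      using B[of x] R[of x] by (cases "x \<in> cball 0 R'") (auto simp: R'_def)
  qed auto
qed

lemma bd_support_integrable:
  fixes f :: "'a::euclidean_space \<Rightarrow> 'b::{banach,second_countable_topology}"
  assumes "bd_support f" "continuous_on UNIV f"
  shows "integrable lborel f"
proof -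
  obtain R B where *: "R > 0" "\<And>x. norm (f x) \<le> B * indicator (cball 0 R) x" 
    using bd_support_bounded[OF assms] by metis
  have "emeasure lborel (cball 0 R :: 'a set) < \<infinity>" by (intro emeasure_bounded_finite) auto
  then have "integrable lborel (\<lambda>x. B * indicator (cball (0::'a) R) x :: real)"
    by (intro integrable_mult_right integrable_real_indicator) auto
  then show ?thesis
    by (rule Bochner_Integration.integrable_bound)
       (use assms(2) * in \<open>auto intro!: borel_measurable_continuous_onI order_trans[OF *(2)]\<close>)
qed

section \<open>Decay of the transform of a smooth function of bounded support\<close>

lemma DERIV_along_axis:
  assumes "smooth (s :: real^'n::finite \<Rightarrow> real)"
  shows "((\<lambda>t. s (\<xi> + t *\<^sub>R axis j 1)) has_real_derivative partials [j] s (\<xi> + t *\<^sub>R axis j 1)) (at t)"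
proof -
  let ?y = "\<xi> + t *\<^sub>R axis j 1"
  have D: "(s has_derivative frechet_derivative s (at ?y)) (at ?y)"
    using smooth_differentiable[OF assms] frechet_derivative_works by blast
  have "((\<lambda>t. \<xi> + t *\<^sub>R axis j 1) has_derivative (\<lambda>h. h *\<^sub>R axis j 1)) (at t)"
    by (auto intro!: derivative_eq_intros)
  from has_derivative_compose[OF this D]
  have "((\<lambda>t. s (\<xi> + t *\<^sub>R axis j 1)) has_derivative (\<lambda>h. frechet_derivative s (at ?y) (h *\<^sub>R axis j 1))) (at t)" .
  moreover have "linear (frechet_derivative s (at ?y))"
    using smooth_differentiable[OF assms] linear_frechet_derivative by blast
  ultimately show ?thesis
    by (simp add: has_field_derivative_def linear_scale mult.commute[of _ "frechet_derivative s (at ?y) (axis j 1)"])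
qed

text \<open>Integration by parts without iterated integrals: translating \<open>s\<close> multiplies its transform by a
  character, and the difference quotients converge dominatedly.\<close>

lemma ftr_partial:
  assumes s: "smooth (s :: real^'n::finite \<Rightarrow> real)" and supp: "bd_support s"
  shows "ftr (\<lambda>\<xi>. of_real (partials [j] s \<xi>)) x = - \<i> * of_real (x $ j) * ftr (\<lambda>\<xi>. of_real (s \<xi>)) x"
proof -
  define h where "h k = 1 / real (Suc k)" for k
  have h: "h k > 0" "h k \<le> 1" for k by (auto simp: h_def)
  have h0: "h \<longlonglongrightarrow> 0" unfolding h_def[abs_def] by (rule LIMSEQ_Suc[OF lim_1_over_n])
  let ?e = "axis j 1 :: real^'n"
  let ?d = "partials [j] s"
  obtain R B where RB: "R > 0" "\<And>x. R < norm x \<Longrightarrow> s x = 0" "\<And>x. norm (s x) \<le> B * indicator (cball 0 R) x" 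
    using bd_support_bounded[OF supp smooth_continuous[OF s]] by metis
  have cd: "continuous_on UNIV ?d" using smooth_continuous[OF smooth_partials[OF s]] .
  obtain R' B' where RB': "R' > 0" "\<And>x. R' < norm x \<Longrightarrow> ?d x = 0" "\<And>x. norm (?d x) \<le> B' * indicator (cball 0 R') x" "B' \<ge> 0"
    using bd_support_bounded[OF bd_support_partials[OF supp] cd] by metis
  have ms [measurable]: "s \<in> borel_measurable borel" and [measurable]: "?d \<in> borel_measurable borel"
    using smooth_continuous[OF s] cd by (auto intro: borel_measurable_continuous_onI)
  have ints: "integrable lborel (\<lambda>\<xi>. of_real (s \<xi>) :: complex)"
    by (intro integrable_of_real bd_support_integrable supp smooth_continuous s)
  have ints': "integrable lborel (\<lambda>\<xi>. of_real (s (\<xi> + h k *\<^sub>R ?e)) :: complex)" for k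
    using integrable_lborel_affine[OF ints, of 1 "h k *\<^sub>R ?e"] by (simp add: add.commute)
  have quot: "(LINT \<xi>|lborel. of_real ((s (\<xi> + h k *\<^sub>R ?e) - s \<xi>) / h k) * cis (x \<bullet> \<xi>))
      = (cis (- (h k * x $ j)) - 1) / of_real (h k) * ftr (\<lambda>\<xi>. of_real (s \<xi>)) x" for k
  proof -
    have "(LINT \<xi>|lborel. of_real ((s (\<xi> + h k *\<^sub>R ?e) - s \<xi>) / h k) * cis (x \<bullet> \<xi>))
      = (LINT \<xi>|lborel. (of_real (s (\<xi> + h k *\<^sub>R ?e)) * cis (x \<bullet> \<xi>) - of_real (s \<xi>) * cis (x \<bullet> \<xi>)) / of_real (h k))"
      by (intro Bochner_Integration.integral_cong refl) (simp add: field_simps)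
    also have "\<dots> = ((LINT \<xi>|lborel. of_real (s (\<xi> + h k *\<^sub>R ?e)) * cis (x \<bullet> \<xi>)) - ftr (\<lambda>\<xi>. of_real (s \<xi>)) x) / of_real (h k)"
      unfolding ftr_def by (subst integral_divide_zero, subst Bochner_Integration.integral_diff)
         (auto intro!: integrable_mult_cis ints ints')
    also have "(LINT \<xi>|lborel. of_real (s (\<xi> + h k *\<^sub>R ?e)) * cis (x \<bullet> \<xi>))
       = (LINT \<xi>|lborel. of_real (s \<xi>) * cis (x \<bullet> \<xi>) * cis (- (h k * x $ j)))"
    proof -
      have "cis (x \<bullet> (\<xi> - h k *\<^sub>R ?e)) = cis (x \<bullet> \<xi>) * cis (- (h k * x $ j))" for \<xi>
        by (simp add: cis_mult inner_diff_right inner_axis)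
      then show ?thesis
        by (subst integral_lborel_affine[of 1 _ "- (h k *\<^sub>R ?e)"]) (simp_all add: mult.assoc)
    qed
    also have "\<dots> = ftr (\<lambda>\<xi>. of_real (s \<xi>)) x * cis (- (h k * x $ j))"
      unfolding ftr_def by (rule integral_mult_left_zero)
    finally show ?thesis by (simp add: field_simps)
  qed
  have hat: "filterlim h (at 0) sequentially"
    using h0 h(1) by (auto simp: filterlim_at less_imp_neq[THEN not_sym] intro!: always_eventually)
  have "(\<lambda>k. LINT \<xi>|lborel. of_real ((s (\<xi> + h k *\<^sub>R ?e) - s \<xi>) / h k) * cis (x \<bullet> \<xi>))
     \<longlonglongrightarrow> (LINT \<xi>|lborel. of_real (?d \<xi>) * cis (x \<bullet> \<xi>))"
  \<comment> \<open>By the mean value theorem the difference quotient is a value of the derivative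
    at a point moved by at most \<open>h k \<le> 1\<close>; hence a radius enlarged by 1 contains
    all its supports.\<close>
  proof (rule integral_dominated_convergence[where w = "\<lambda>\<xi>. B' * indicator (cball 0 (max R R' + 1)) \<xi>"])
    have "emeasure lborel (cball 0 (max R R' + 1) :: (real^'n) set) < \<infinity>" by (intro emeasure_bounded_finite) auto
    then show "integrable lborel (\<lambda>\<xi>. B' * indicator (cball (0::real^'n) (max R R' + 1)) \<xi> :: real)"
      by (intro integrable_mult_right integrable_real_indicator) auto
    show "AE \<xi> in lborel. (\<lambda>k. of_real ((s (\<xi> + h k *\<^sub>R ?e) - s \<xi>) / h k) * cis (x \<bullet> \<xi>)) \<longlonglongrightarrow> of_real (?d \<xi>) * cis (x \<bullet> \<xi>)"
    proof (rule AE_I2)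
      fix \<xi>
      from DERIV_along_axis[OF s, of \<xi> j 0]
      have "(\<lambda>h. (s (\<xi> + h *\<^sub>R ?e) - s \<xi>) / h) \<midarrow>0\<rightarrow> ?d \<xi>" by (simp add: DERIV_def)
      from filterlim_compose[OF this hat]
      show "(\<lambda>k. of_real ((s (\<xi> + h k *\<^sub>R ?e) - s \<xi>) / h k) * cis (x \<bullet> \<xi>)) \<longlonglongrightarrow> of_real (?d \<xi>) * cis (x \<bullet> \<xi>)"
        by (intro tendsto_intros)
    qed
    show "AE \<xi> in lborel. norm (of_real ((s (\<xi> + h k *\<^sub>R ?e) - s \<xi>) / h k) * cis (x \<bullet> \<xi>)) \<le> B' * indicator (cball 0 (max R R' + 1)) \<xi>" for k
    proof (rule AE_I2)
      fix \<xi> :: "real^'n"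
      obtain z where z: "z > 0" "z < h k" "s (\<xi> + h k *\<^sub>R ?e) - s (\<xi> + 0 *\<^sub>R ?e) = (h k - 0) * ?d (\<xi> + z *\<^sub>R ?e)"
        using MVT2[OF h(1)[of k], of "\<lambda>t. s (\<xi> + t *\<^sub>R ?e)" "\<lambda>t. ?d (\<xi> + t *\<^sub>R ?e)"] DERIV_along_axis[OF s] by blast
      then have eq: "(s (\<xi> + h k *\<^sub>R ?e) - s \<xi>) / h k = ?d (\<xi> + z *\<^sub>R ?e)"
        using h(1)[of k] by (simp add: field_simps)
      have "norm \<xi> \<le> norm (\<xi> + z *\<^sub>R ?e) + norm (z *\<^sub>R ?e)" by (metis add_diff_cancel_right' norm_triangle_ineq4)
      also have "norm (z *\<^sub>R ?e) \<le> 1" using z h(2)[of k] by simp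
      finally have "norm \<xi> \<le> norm (\<xi> + z *\<^sub>R ?e) + 1" by simp
      then have "\<bar>?d (\<xi> + z *\<^sub>R ?e)\<bar> \<le> B' * indicator (cball 0 (max R R' + 1)) \<xi>"
        using RB'(3)[of "\<xi> + z *\<^sub>R ?e"] RB'(2)[of "\<xi> + z *\<^sub>R ?e"] RB'(4)
        by (cases "\<xi> \<in> cball 0 (max R R' + 1)"; cases "\<xi> + z *\<^sub>R ?e \<in> cball 0 R'") auto
      then show "norm (of_real ((s (\<xi> + h k *\<^sub>R ?e) - s \<xi>) / h k) * cis (x \<bullet> \<xi>)) \<le> B' * indicator (cball 0 (max R R' + 1)) \<xi>"
        unfolding eq by (simp add: norm_mult)
    qed
  qed measurable
  moreover have "(\<lambda>k. (cis (- (h k * x $ j)) - 1) / of_real (h k) * ftr (\<lambda>\<xi>. of_real (s \<xi>)) x)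
     \<longlonglongrightarrow> - \<i> * of_real (x $ j) * ftr (\<lambda>\<xi>. of_real (s \<xi>)) x"
  proof (intro tendsto_mult tendsto_const)
    have "((\<lambda>z. exp (- \<i> * of_real (x $ j) * z)) has_field_derivative - \<i> * of_real (x $ j)) (at 0)"
      by (auto intro!: derivative_eq_intros)
    then have *: "(\<lambda>z. (exp (- \<i> * of_real (x $ j) * z) - 1) / z) \<midarrow>0\<rightarrow> - \<i> * of_real (x $ j)"
      by (simp add: DERIV_def)
    have "filterlim (\<lambda>k. of_real (h k) :: complex) (at 0) sequentially"
      using tendsto_of_real[OF h0, where 'a = complex] h(1) by (auto simp: filterlim_at less_imp_neq[THEN not_sym] intro!: always_eventually)
    from filterlim_compose[OF * this]
    show "(\<lambda>k. (cis (- (h k * x $ j)) - 1) / of_real (h k)) \<longlonglongrightarrow> - \<i> * of_real (x $ j)"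
      by (simp add: cis_conv_exp mult_ac)
  qed
  ultimately show ?thesis unfolding quot using LIMSEQ_unique by (simp only: ftr_def)
qed

text \<open>Two derivatives in direction \<open>j\<close> multiply the modulus of the transform by
  the square of \<open>x $ j\<close>. Passing from \<open>A\<close> to \<open>insert j A\<close>
  thus adds the estimate for the second derivative of \<open>s\<close> to that for \<open>s\<close>,
  which is why the induction leaves \<open>s\<close> arbitrary.\<close>

lemma ftr_decay_aux:
  assumes "finite A"
  shows "smooth (s :: real^'n::finite \<Rightarrow> real) \<Longrightarrow> bd_support s \<Longrightarrow>
    \<exists>C. \<forall>x. (\<Prod>j\<in>A. 1 + (x $ j)\<^sup>2) * norm (ftr (\<lambda>\<xi>. of_real (s \<xi>)) x) \<le> C"
  using assms
proof (induction A arbitrary: s rule: finite_induct)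
  case empty
  have "integrable lborel (\<lambda>\<xi>. of_real (s \<xi>) :: complex)"
    by (intro integrable_of_real bd_support_integrable empty smooth_continuous)
  from norm_ftr_le[OF this] show ?case by auto
next
  case (insert j A)
  let ?s = "partials [j] (partials [j] s)"
  have ss: "smooth ?s" "bd_support ?s"
    using insert.prems by (auto intro: smooth_partials bd_support_partials simp del: partials.simps)
  obtain C1 where C1: "\<And>x. (\<Prod>j\<in>A. 1 + (x $ j)\<^sup>2) * norm (ftr (\<lambda>\<xi>. of_real (s \<xi>)) x) \<le> C1"
    using insert.IH[OF insert.prems] by blast
  obtain C2 where C2: "\<And>x. (\<Prod>j\<in>A. 1 + (x $ j)\<^sup>2) * norm (ftr (\<lambda>\<xi>. of_real (?s \<xi>)) x) \<le> C2"
    using insert.IH[OF ss] by blast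
  have "norm (ftr (\<lambda>\<xi>. of_real (?s \<xi>)) x) = (x $ j)\<^sup>2 * norm (ftr (\<lambda>\<xi>. of_real (s \<xi>)) x)" for x
    using ftr_partial[OF insert.prems, of j x]
      ftr_partial[OF smooth_partials[OF insert.prems(1)] bd_support_partials[OF insert.prems(2)], of j "[j]" x]
    by (simp add: norm_mult power2_eq_square del: partials.simps flip: abs_mult)
  then have "(\<Prod>j\<in>insert j A. 1 + (x $ j)\<^sup>2) * norm (ftr (\<lambda>\<xi>. of_real (s \<xi>)) x) =
     (\<Prod>j\<in>A. 1 + (x $ j)\<^sup>2) * norm (ftr (\<lambda>\<xi>. of_real (s \<xi>)) x)
     + (\<Prod>j\<in>A. 1 + (x $ j)\<^sup>2) * norm (ftr (\<lambda>\<xi>. of_real (?s \<xi>)) x)" for x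
    using insert.hyps by (simp add: algebra_simps del: partials.simps)
  then have "(\<Prod>j\<in>insert j A. 1 + (x $ j)\<^sup>2) * norm (ftr (\<lambda>\<xi>. of_real (s \<xi>)) x) \<le> C1 + C2" for x
    by (simp only:) (intro add_mono C1 C2)
  then show ?case by blast
qed

lemma prod_Basis_vec:
  fixes x :: "real^'n::finite"
  shows "(\<Prod>b\<in>Basis. g (x \<bullet> b)) = (\<Prod>j\<in>UNIV. g (x $ j))"
proof -
  have B: "(Basis :: (real^'n) set) = range (\<lambda>j::'n. axis j (1::real))" by (auto simp: Basis_vec_def)
  have "inj (\<lambda>j::'n. axis j (1::real))" by (auto simp: inj_def axis_eq_axis)
  then show ?thesis unfolding B by (subst prod.reindex) (simp_all add: inner_axis)
qed

lemma ftr_decay: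
  assumes "smooth (s :: real^'n::finite \<Rightarrow> real)" "bd_support s"
  obtains C where "C \<ge> 0" "\<And>x. norm (ftr (\<lambda>\<xi>. of_real (s \<xi>)) x) \<le> C * decay x"
proof -
  obtain C where C: "\<And>x. (\<Prod>j\<in>UNIV. 1 + (x $ j)\<^sup>2) * norm (ftr (\<lambda>\<xi>. of_real (s \<xi>)) x) \<le> C"
    using ftr_decay_aux[OF _ assms] finite by blast
  have eq: "decay x = 1 / (\<Prod>j\<in>UNIV. 1 + (x $ j)\<^sup>2)" for x :: "real^'n"
    unfolding decay_def using prod_Basis_vec[of "\<lambda>t. 1 / (1 + t\<^sup>2)" x] by (simp add: prod_dividef)
  have pos: "0 < (\<Prod>j\<in>UNIV. 1 + (x $ j)\<^sup>2)" for x :: "real^'n"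
    by (intro prod_pos) (auto intro: add_pos_nonneg)
  show ?thesis
  proof
    show "norm (ftr (\<lambda>\<xi>. of_real (s \<xi>)) x) \<le> \<bar>C\<bar> * decay x" for x
    proof -
      have "(\<Prod>j\<in>UNIV. 1 + (x $ j)\<^sup>2) * norm (ftr (\<lambda>\<xi>. of_real (s \<xi>)) x) \<le> \<bar>C\<bar>"
        using C[of x] by simp
      then show ?thesis using pos[of x] by (simp add: eq field_simps)
    qed
  qed simp
qed

subsection \<open>The frequency-uniform decomposition\<close>

lemma finite_int_vec:
  assumes "\<And>i. finite (F i)"
  shows "finite {m :: int^'n::finite. \<forall>i. m $ i \<in> F i}"
proof -
  have "{m :: int^'n. \<forall>i. m $ i \<in> F i} \<subseteq> vec_lambda ` (PiE UNIV F)"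
  proof
    fix m :: "int^'n" assume "m \<in> {m. \<forall>i. m $ i \<in> F i}"
    then have "vec_nth m \<in> PiE UNIV F" by (auto simp: PiE_def Pi_def)
    then show "m \<in> vec_lambda ` (PiE UNIV F)" by (metis imageI vec_nth_inverse)
  qed
  then show ?thesis
    by (rule finite_subset) (use assms in \<open>intro finite_imageI finite_PiE, auto\<close>)
qed

lemma finite_lattice_near: "finite {m :: int^'n::finite. \<forall>i. \<bar>x $ i - of_int (m $ i)\<bar> \<le> (c::real)}"
proof (rule finite_subset)
  show "finite {m :: int^'n. \<forall>i. m $ i \<in> {\<lfloor>x $ i - c\<rfloor>..\<lceil>x $ i + c\<rceil>}}"
    by (rule finite_int_vec) simp
  have "\<lfloor>x $ i - c\<rfloor> \<le> k \<and> k \<le> \<lceil>x $ i + c\<rceil>" if "\<bar>x $ i - of_int k\<bar> \<le> c" for i and k :: int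
    using that by linarith
  then show "{m :: int^'n. \<forall>i. \<bar>x $ i - of_int (m $ i)\<bar> \<le> c} \<subseteq> {m. \<forall>i. m $ i \<in> {\<lfloor>x $ i - c\<rfloor>..\<lceil>x $ i + c\<rceil>}}"
    by auto
qed

lemma lattice_pt_nth [simp]: "lattice_pt k $ i = of_int (k $ i)"
  by (simp add: lattice_pt_def)

lemma lattice_pt_0 [simp]: "lattice_pt 0 = 0"
  by (simp add: vec_eq_iff)

locale window =
  fixes \<rho> :: "real^'n::finite \<Rightarrow> real"
  assumes window: "freq_window \<rho>"
begin

lemma smooth_rho: "smooth \<rho>"
  using window by (simp add: freq_window_def)

lemma rho_nonneg [simp]: "0 \<le> \<rho> \<xi>" and rho_le_1: "\<rho> \<xi> \<le> 1"
  using window unfolding freq_window_def by (meson atLeastAtMost_iff range_subsetD)+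

lemma rho_support: "\<rho> \<xi> \<noteq> 0 \<Longrightarrow> \<bar>\<xi> $ i\<bar> \<le> 1"
proof -
  assume "\<rho> \<xi> \<noteq> 0"
  then have "\<xi> \<in> closure {\<xi>. \<rho> \<xi> \<noteq> 0}" by (intro subsetD[OF closure_subset]) simp
  then have "\<xi> \<in> cbox (\<chi> i. -1) (\<chi> i. 1)" using window by (auto simp: freq_window_def)
  then have "- 1 \<le> \<xi> $ i \<and> \<xi> $ i \<le> 1" by (simp add: mem_box_cart)
  then show ?thesis by (simp add: abs_le_iff)
qed

lemma rho_one: "(\<And>i. \<bar>\<xi> $ i\<bar> \<le> 1 / 2) \<Longrightarrow> \<rho> \<xi> = 1"
proof -
  assume *: "\<And>i. \<bar>\<xi> $ i\<bar> \<le> 1 / 2"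
  have "- 1 / 2 \<le> \<xi> $ i \<and> \<xi> $ i \<le> 1 / 2" for i using *[of i] by linarith
  then have "\<xi> \<in> cbox (\<chi> i. -1/2) (\<chi> i. 1/2)" by (simp add: mem_box_cart)
  then show ?thesis using window unfolding freq_window_def by blast
qed

definition den :: "real^'n \<Rightarrow> real" where
  "den \<xi> = (\<Sum>\<^sub>\<infinity>m. \<rho> (\<xi> - lattice_pt m))"

lemma den_eq_sum:
  assumes "finite A" "\<And>m. \<rho> (\<xi> - lattice_pt m) \<noteq> 0 \<Longrightarrow> m \<in> A"
  shows "den \<xi> = (\<Sum>m\<in>A. \<rho> (\<xi> - lattice_pt m))"
proof -
  have "den \<xi> = (\<Sum>\<^sub>\<infinity>m\<in>A. \<rho> (\<xi> - lattice_pt m))"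
    unfolding den_def by (rule infsum_cong_neutral) (use assms in auto)
  then show ?thesis using assms(1) by simp
qed

definition near :: "real^'n \<Rightarrow> (int^'n) set" where
  "near \<xi> = {m. \<forall>i. \<bar>\<xi> $ i - of_int (m $ i)\<bar> \<le> 1}"

lemma finite_near: "finite (near \<xi>)"
  unfolding near_def by (rule finite_lattice_near)

lemma near_if_rho: "\<rho> (\<xi> - lattice_pt m) \<noteq> 0 \<Longrightarrow> m \<in> near \<xi>"
  using rho_support[of "\<xi> - lattice_pt m"] by (auto simp: near_def)

text \<open>Rounding every coordinate gives a lattice point within 1/2 in each coordinate, and its
  window equals 1 at \<open>\<xi>\<close>.\<close>

lemma sum_rho_ge_1:
  assumes "finite A" "(\<chi> i. round (\<xi> $ i)) \<in> A"
  shows "1 \<le> (\<Sum>m\<in>A. \<rho> (\<xi> - lattice_pt m))"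
proof -
  let ?m = "\<chi> i. round (\<xi> $ i)"
  have "\<rho> (\<xi> - lattice_pt ?m) = 1"
    by (rule rho_one) (use of_int_round_abs_le in \<open>simp add: abs_minus_commute\<close>)
  then show ?thesis
    using member_le_sum[of ?m A "\<lambda>m. \<rho> (\<xi> - lattice_pt m)"] assms by simp
qed

lemma den_ge_1: "1 \<le> den \<xi>"
proof -
  have "\<bar>\<xi> $ i - of_int (round (\<xi> $ i))\<bar> \<le> 1" for i
    using of_int_round_abs_le[of "\<xi> $ i"] by linarith
  then have "(\<chi> i. round (\<xi> $ i)) \<in> near \<xi>" by (simp add: near_def)
  then show ?thesis
    using sum_rho_ge_1[OF finite_near] den_eq_sum[OF finite_near near_if_rho] by simp
qed

lemma den_shift: "den (\<xi> - lattice_pt k) = den \<xi>"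
proof -
  have "bij (\<lambda>m. k + m)" by (rule bij_betw_byWitness[of _ "\<lambda>m. m - k"]) auto
  then have "(\<Sum>\<^sub>\<infinity>m. \<rho> (\<xi> - lattice_pt (k + m))) = den \<xi>"
    unfolding den_def by (rule infsum_reindex_bij_betw)
  moreover have "\<xi> - lattice_pt (k + m) = \<xi> - lattice_pt k - lattice_pt m" for m
    by (simp add: vec_eq_iff)
  ultimately show ?thesis by (simp add: den_def)
qed

abbreviation sig :: "int^'n \<Rightarrow> real^'n \<Rightarrow> real" where
  "sig \<equiv> freq_sigma \<rho>"

lemma sig_eq: "sig k \<xi> = \<rho> (\<xi> - lattice_pt k) / den \<xi>"
  by (simp add: freq_sigma_def den_def)

lemma sig_shift: "sig k \<xi> = sig 0 (\<xi> - lattice_pt k)"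
  by (simp add: sig_eq den_shift)

lemma sig_nonneg [simp]: "0 \<le> sig k \<xi>"
  using den_ge_1[of \<xi>] by (simp add: sig_eq)

lemma sig_le_1: "sig k \<xi> \<le> 1"
  using den_ge_1[of \<xi>] rho_le_1[of "\<xi> - lattice_pt k"] by (simp add: sig_eq divide_le_eq)

lemma sig_support: "sig k \<xi> \<noteq> 0 \<Longrightarrow> \<bar>\<xi> $ i - of_int (k $ i)\<bar> \<le> 1"
  using rho_support[of "\<xi> - lattice_pt k" i] by (auto simp: sig_eq)

lemma sig_sum: "(LINT m|count_space UNIV. sig m \<xi>) = 1" "(\<integral>\<^sup>+m. ennreal (sig m \<xi>) \<partial>count_space UNIV) = 1"
proof -
  have fin: "finite {m. sig m \<xi> \<noteq> 0}"
    by (rule finite_subset[OF _ finite_near[of \<xi>]]) (auto simp: near_def dest: sig_support)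
  have "(\<Sum>m | sig m \<xi> \<noteq> 0. sig m \<xi>) = (\<Sum>m\<in>near \<xi>. sig m \<xi>)"
    by (rule sum.mono_neutral_left[OF finite_near]) (auto simp: near_def dest: sig_support)
  also have "\<dots> = (\<Sum>m\<in>near \<xi>. \<rho> (\<xi> - lattice_pt m)) / den \<xi>"
    by (simp add: sig_eq sum_divide_distrib)
  also have "\<dots> = 1"
    using den_ge_1[of \<xi>] den_eq_sum[OF finite_near near_if_rho, of \<xi>] by simp
  finally have s: "(\<Sum>m | sig m \<xi> \<noteq> 0. sig m \<xi>) = 1" .
  then show "(LINT m|count_space UNIV. sig m \<xi>) = 1"
    by (subst lebesgue_integral_count_space_finite_support) (use fin in auto)
  have "{m. 0 < sig m \<xi>} = {m. sig m \<xi> \<noteq> 0}" by (metis less_eq_real_def less_irrefl sig_nonneg)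
  then show "(\<integral>\<^sup>+m. ennreal (sig m \<xi>) \<partial>count_space UNIV) = 1"
    using s fin by (subst nn_integral_count_space) (auto simp: sum_ennreal)
qed

text \<open>The quotient rule asks for a smooth denominator without zeros on the whole space. Where
  \<open>\<rho>\<close> does not vanish, \<open>den\<close> has nonzero terms only for indices in
  the fixed finite set \<open>A\<close>, with bound 2 = 1 + 1 in each coordinate; but the sum over
  \<open>A\<close> vanishes far out. The function \<open>D\<close> agrees with \<open>den\<close>
  where it matters and stays at least 1 everywhere.\<close>

lemma smooth_sig0: "smooth (sig 0)"
proof -
  define A :: "(int^'n) set" where "A = {m. \<forall>i. \<bar>0 $ i - of_int (m $ i)\<bar> \<le> (2::real)}"
  have A: "finite A" unfolding A_def by (rule finite_lattice_near)
  have mA: "m \<in> A \<longleftrightarrow> (\<forall>i. \<bar>of_int (m $ i)\<bar> \<le> (2::real))" for m by (simp add: A_def)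
  \<comment> \<open>The correction \<open>1 - \<rho> (\<xi> / 2)\<close> is 0 where
    \<open>\<rho> \<xi> \<noteq> 0\<close>, because then \<open>\<xi> / 2\<close> lies in the cube
    on which the window is 1. It is 1 where \<open>\<rho> (\<xi> / 2) = 0\<close>; at the remaining
    points the coordinates are at most 2 in modulus, so the rounded point belongs to
    \<open>A\<close>.\<close>
  define D where "D \<xi> = (\<Sum>m\<in>A. \<rho> (1 *\<^sub>R \<xi> + (- lattice_pt m))) + (1 + (-1) * \<rho> ((1/2) *\<^sub>R \<xi> + 0))" for \<xi>
  have D1: "D \<xi> \<ge> 1" for \<xi>
  proof (cases "\<rho> ((1/2) *\<^sub>R \<xi>) = 0")
    case True
    then show ?thesis by (simp add: D_def sum_nonneg)
  next
    case False
    have "\<bar>round (\<xi> $ i)\<bar> \<le> 2" for i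
    proof -
      have "\<bar>\<xi> $ i\<bar> \<le> 2" using rho_support[OF False, of i] by simp
      then show ?thesis using of_int_round_abs_le[of "\<xi> $ i"] by linarith
    qed
    then have "(\<chi> i. round (\<xi> $ i)) \<in> A" unfolding mA by (simp flip: of_int_abs)
    from sum_rho_ge_1[OF A this] rho_le_1[of "(1/2) *\<^sub>R \<xi>"] show ?thesis by (simp add: D_def)
  qed
  have "sig 0 \<xi> = \<rho> \<xi> * inverse (D \<xi>)" for \<xi>
  proof (cases "\<rho> \<xi> = 0")
    case False
    have "\<rho> ((1/2) *\<^sub>R \<xi>) = 1" by (rule rho_one) (use rho_support[OF False] in auto)
    moreover have "den \<xi> = (\<Sum>m\<in>A. \<rho> (\<xi> - lattice_pt m))"
    proof (rule den_eq_sum[OF A])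
      fix m assume nz: "\<rho> (\<xi> - lattice_pt m) \<noteq> 0"
      have "\<bar>of_int (m $ i)\<bar> \<le> (2::real)" for i
      proof -
        have "\<bar>\<xi> $ i - of_int (m $ i)\<bar> \<le> 1" using rho_support[OF nz, of i] by simp
        then show ?thesis using rho_support[OF False, of i] by linarith
      qed
      then show "m \<in> A" by (simp add: mA)
    qed
    ultimately have "D \<xi> = den \<xi>" by (simp add: D_def)
    then show ?thesis by (simp only: sig_eq lattice_pt_0 diff_zero divide_inverse)
  qed (simp add: sig_eq)
  then have "sig 0 = (\<lambda>\<xi>. \<rho> \<xi> * inverse (D \<xi>))" by auto
  moreover have "smooth D" unfolding D_def[abs_def]
    by (intro smooth_add smooth_sum smooth_mult smooth_const smooth_affine smooth_rho)
  ultimately show ?thesis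
    using D1 by (simp only:) (intro smooth_mult smooth_inverse smooth_rho, auto, metis not_one_le_zero)
qed

lemma bd_support_if_box:
  assumes "\<And>\<xi> i. s \<xi> \<noteq> 0 \<Longrightarrow> \<bar>\<xi> $ i\<bar> \<le> 1"
  shows "bd_support (s :: real^'n \<Rightarrow> real)"
proof -
  have "s \<xi> = 0" if "real CARD('n) < norm \<xi>" for \<xi>
  proof (rule ccontr)
    assume "s \<xi> \<noteq> 0"
    then have "(\<Sum>i\<in>UNIV. \<bar>\<xi> $ i\<bar>) \<le> (\<Sum>i\<in>(UNIV::'n set). 1)" by (intro sum_mono assms)
    then show False using norm_le_l1_cart[of \<xi>] that by simp
  qed
  then show ?thesis by (auto simp: bd_support_def)
qed

lemma bd_support_sig0: "bd_support (sig 0)"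
  by (rule bd_support_if_box) (use sig_support[of 0] in auto)

lemma bd_support_rho: "bd_support \<rho>"
  by (rule bd_support_if_box) (rule rho_support)

lemma continuous_sig: "continuous_on UNIV (sig k)"
proof -
  have "continuous_on UNIV (\<lambda>\<xi>. sig 0 (\<xi> - lattice_pt k))"
    by (rule continuous_on_compose2[OF smooth_continuous[OF smooth_sig0]]) (auto intro!: continuous_intros)
  then show ?thesis using sig_shift[of k] by (simp add: fun_eq_iff)
qed

lemma borel_measurable_sig [measurable]: "sig k \<in> borel_measurable borel"
  using continuous_sig by (rule borel_measurable_continuous_onI)

lemma integrable_sig: "integrable lborel (sig k)"
proof -
  have "integrable lborel (\<lambda>\<xi>. sig 0 (- lattice_pt k + 1 *\<^sub>R \<xi>))"
    by (intro integrable_lborel_affine bd_support_integrable bd_support_sig0 continuous_sig) simp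
  moreover have "sig 0 (- lattice_pt k + 1 *\<^sub>R \<xi>) = sig k \<xi>" for \<xi> by (simp add: sig_shift[of k \<xi>])
  ultimately show ?thesis by simp
qed

text \<open>The convolution kernel of the multiplier \<open>sig k\<close>: the normalising constants
  of \<open>fourier\<close> and \<open>fourier_inv\<close> are merged into one factor.\<close>

definition kern :: "int^'n \<Rightarrow> real^'n \<Rightarrow> complex" where
  "kern k x = of_real ((2 * pi) powr (- real CARD('n))) * ftr (\<lambda>\<xi>. of_real (sig k \<xi>)) x"

lemma borel_measurable_kern [measurable]: "kern k \<in> borel_measurable borel"
  unfolding kern_def[abs_def] by measurable

lemma kern_shift: "kern k x = cis (x \<bullet> lattice_pt k) * kern 0 x"
proof -
  have "ftr (\<lambda>\<xi>. of_real (sig k \<xi>)) x = (LINT \<xi>|lborel. of_real (sig 0 \<xi>) * cis (x \<bullet> \<xi>) * cis (x \<bullet> lattice_pt k))"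
    unfolding ftr_def
    by (subst integral_lborel_affine[of 1 _ "lattice_pt k"])
       (simp_all add: sig_shift[of k] inner_add_right cis_mult[symmetric] mult_ac)
  also have "\<dots> = ftr (\<lambda>\<xi>. of_real (sig 0 \<xi>)) x * cis (x \<bullet> lattice_pt k)"
    unfolding ftr_def by (rule integral_mult_left_zero)
  finally show ?thesis by (simp add: kern_def)
qed

lemma norm_kern: "norm (kern k x) = norm (kern 0 x)"
  by (subst kern_shift) (simp add: norm_mult)

lemma kern_decay: obtains C where "C \<ge> 0" "\<And>k x. norm (kern k x) \<le> C * decay x"
proof -
  obtain C where C: "C \<ge> 0" "\<And>x. norm (ftr (\<lambda>\<xi>. of_real (sig 0 \<xi>)) x) \<le> C * decay x"
    using ftr_decay[OF smooth_sig0 bd_support_sig0] by metis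
  show ?thesis
  proof
    show "norm (kern k x) \<le> ((2 * pi) powr (- real CARD('n)) * C) * decay x" for k x
      using mult_left_mono[OF C(2)[of x], of "(2 * pi) powr (- real CARD('n))"]
      by (subst norm_kern) (simp add: kern_def norm_mult mult.assoc)
  qed (use C in auto)
qed

lemma integrable_kern: "integrable lborel (kern k)"
proof -
  obtain C where "C \<ge> 0" "\<And>k x. norm (kern k x) \<le> C * decay x" using kern_decay by metis
  then show ?thesis
    by (intro Bochner_Integration.integrable_bound[OF integrable_mult_right[OF integrable_decay, of C]])
       (auto simp: abs_mult decay_pos less_imp_le)
qed

lemma kern_bounded: obtains B where "B \<ge> 0" "\<And>k x. norm (kern k x) \<le> B"
proof -
  obtain C where C: "C \<ge> 0" "\<And>k x. norm (kern k x) \<le> C * decay x" using kern_decay by metis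
  have "decay (x::real^'n) \<le> 1" for x
  proof -
    have "1 / (1 + t\<^sup>2) \<le> 1" for t :: real by (simp add: divide_le_eq add_pos_nonneg)
    then show ?thesis unfolding decay_def by (intro prod_le_1) auto
  qed
  then have "norm (kern k x) \<le> C" for k x
    using C(2)[of k x] C(1) by (meson mult_left_le order_trans)
  then show ?thesis using that C(1) by blast
qed

text \<open>Fourier inversion for \<open>sig k\<close>. The reflection to \<open>- y\<close> arises
  because both integrals carry the same sign in the exponent.\<close>

lemma kern_inversion: "(LINT x|lborel. kern k x * cis (y \<bullet> x)) = of_real (sig k (- y))"
proof -
  let ?c = "of_real ((2 * pi) powr (- real CARD('n))) :: complex"
  let ?F = "ftr (\<lambda>\<xi>. of_real (sig k \<xi>))"
  have c: "(2 * pi) powr (- real CARD('n)) * (2 * pi) ^ CARD('n) = 1"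
  proof -
    have "(2 * pi) ^ CARD('n) = (2 * pi) powr real CARD('n)" by (simp add: powr_realpow)
    then show ?thesis by (simp only: powr_add[symmetric]) simp
  qed
  have "integrable lborel (\<lambda>x. (1 / ?c) * kern k x)" by (intro integrable_mult_right integrable_kern)
  then have "integrable lborel ?F" by (simp add: kern_def)
  then have "(LINT x|lborel. ?F x * cis (- (- y \<bullet> x))) = of_real ((2 * pi) ^ DIM(real^'n)) * of_real (sig k (- y))"
    by (intro ftr_inversion[where B = 1])
       (auto intro!: continuous_intros continuous_sig integrable_sig simp: abs_le_iff sig_le_1 order_trans[OF _ sig_nonneg])
  then have F: "(LINT x|lborel. ?F x * cis (y \<bullet> x)) = of_real ((2 * pi) ^ CARD('n)) * of_real (sig k (- y))"
    by simp
  have "(LINT x|lborel. kern k x * cis (y \<bullet> x)) = ?c * (LINT x|lborel. ?F x * cis (y \<bullet> x))"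
    unfolding kern_def mult.assoc by (rule integral_mult_right_zero)
  also have "\<dots> = of_real ((2 * pi) powr (- real CARD('n)) * (2 * pi) ^ CARD('n)) * of_real (sig k (- y))"
    unfolding F by simp
  finally show ?thesis unfolding c by simp
qed

lemma kern_inversion_shift:
  "(LINT x|lborel. kern k (x - y) * cis (x \<bullet> \<xi>)) = cis (y \<bullet> \<xi>) * of_real (sig k (- \<xi>))"
proof -
  have "(LINT x|lborel. kern k (x - y) * cis (x \<bullet> \<xi>)) = (LINT x|lborel. cis (y \<bullet> \<xi>) * (kern k x * cis (\<xi> \<bullet> x)))"
    by (subst integral_lborel_affine[of 1 _ y])
       (simp_all add: inner_add_right cis_mult[symmetric] mult_ac inner_commute)
  also have "\<dots> = cis (y \<bullet> \<xi>) * (LINT x|lborel. kern k x * cis (\<xi> \<bullet> x))" by (rule integral_mult_right_zero)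
  finally show ?thesis by (simp add: kern_inversion)
qed

lemma integrable_kern_affine: "b \<noteq> 0 \<Longrightarrow> integrable lborel (\<lambda>x. kern k (a + b *\<^sub>R x))"
  by (intro integrable_lborel_affine integrable_kern)

lemma integrable_kern_diff: "integrable lborel (\<lambda>x. kern k (x - y))" "integrable lborel (\<lambda>x. kern k (y - x))"
  using integrable_kern_affine[of 1 k "- y"] integrable_kern_affine[of "-1" k y] by simp_all

text \<open>Insert the integral that defines \<open>kern k\<close> and exchange the integrations.
  The formula moves pairings with kernels to the frequency side, where they vanish as soon as the
  transform of \<open>A\<close> is zero on the support of \<open>sig k\<close>; all orthogonality
  relations below follow this pattern.\<close>

lemma kern_parseval:
  assumes A: "integrable lborel A"
  shows "(LINT x|lborel. A x * kern k (a + b *\<^sub>R x)) = of_real ((2 * pi) powr (- real CARD('n))) *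
    (LINT \<xi>|lborel. of_real (sig k \<xi>) * (cis (a \<bullet> \<xi>) * (LINT x|lborel. A x * cis (x \<bullet> (b *\<^sub>R \<xi>)))))"
proof -
  let ?c = "of_real ((2 * pi) powr (- real CARD('n))) :: complex"
  have [measurable]: "A \<in> borel_measurable borel" using A by auto
  have "A x * kern k (a + b *\<^sub>R x) = ?c * (LINT \<xi>|lborel. of_real (sig k \<xi>) * (cis (a \<bullet> \<xi>) * (A x * cis (x \<bullet> (b *\<^sub>R \<xi>)))))" for x
  proof -
    have "(LINT \<xi>|lborel. of_real (sig k \<xi>) * (cis (a \<bullet> \<xi>) * (A x * cis (x \<bullet> (b *\<^sub>R \<xi>)))))
      = (LINT \<xi>|lborel. A x * (of_real (sig k \<xi>) * cis ((a + b *\<^sub>R x) \<bullet> \<xi>)))"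
      by (intro Bochner_Integration.integral_cong refl) (simp add: inner_add_left cis_mult[symmetric] mult_ac)
    also have "\<dots> = A x * ftr (\<lambda>\<xi>. of_real (sig k \<xi>)) (a + b *\<^sub>R x)"
      unfolding ftr_def by (rule integral_mult_right_zero)
    finally show ?thesis unfolding kern_def by (simp only: mult_ac)
  qed
  then have "(LINT x|lborel. A x * kern k (a + b *\<^sub>R x)) =
    ?c * (LINT x|lborel. LINT \<xi>|lborel. of_real (sig k \<xi>) * (cis (a \<bullet> \<xi>) * (A x * cis (x \<bullet> (b *\<^sub>R \<xi>)))))"
    by (simp only: integral_mult_right_zero)
  also have "(LINT x|lborel. LINT \<xi>|lborel. of_real (sig k \<xi>) * (cis (a \<bullet> \<xi>) * (A x * cis (x \<bullet> (b *\<^sub>R \<xi>)))))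
    = (LINT \<xi>|lborel. LINT x|lborel. of_real (sig k \<xi>) * (cis (a \<bullet> \<xi>) * (A x * cis (x \<bullet> (b *\<^sub>R \<xi>)))))"
  proof (rule Fubini_swap)
    have "(\<integral>\<^sup>+x. \<integral>\<^sup>+\<xi>. norm (of_real (sig k \<xi>) * (cis (a \<bullet> \<xi>) * (A x * cis (x \<bullet> (b *\<^sub>R \<xi>))))) \<partial>lborel \<partial>lborel)
      = (\<integral>\<^sup>+x. ennreal (norm (A x)) * (\<integral>\<^sup>+\<xi>. norm (sig k \<xi>) \<partial>lborel) \<partial>lborel)"
      by (subst nn_integral_cmult[symmetric]) (auto simp: norm_mult ennreal_mult mult.commute)
    also have "\<dots> = (\<integral>\<^sup>+x. ennreal (norm (A x)) \<partial>lborel) * (\<integral>\<^sup>+\<xi>. norm (sig k \<xi>) \<partial>lborel)"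
      by (rule nn_integral_multc) measurable
    also have "\<dots> < \<infinity>" using A integrable_sig[of k] by (auto simp: integrable_iff_bounded ennreal_mult_less_top)
    finally show "(\<integral>\<^sup>+x. \<integral>\<^sup>+\<xi>. norm (of_real (sig k \<xi>) * (cis (a \<bullet> \<xi>) * (A x * cis (x \<bullet> (b *\<^sub>R \<xi>))))) \<partial>lborel \<partial>lborel) < \<infinity>" .
  qed (auto intro: lborel.sigma_finite_measure_axioms)
  finally show ?thesis by (simp only: integral_mult_right_zero)
qed

text \<open>Each symbol lives within distance 1 of its lattice point in every coordinate, so indices
  more than 2 apart in one coordinate have disjoint symbols.\<close>

lemma kern_kern_zero:
  assumes "2 < \<bar>of_int (m $ i) - of_int (k $ i) :: real\<bar>"
  shows "(LINT x|lborel. kern m (w - x) * kern k (x - z)) = 0"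
proof -
  have "of_real (sig m \<zeta>) * (cis (w \<bullet> \<zeta>) * (LINT x|lborel. kern k (x - z) * cis (x \<bullet> (-1 *\<^sub>R \<zeta>)))) = 0" for \<zeta>
  proof (rule ccontr)
    assume "\<not> ?thesis"
    then have "sig m \<zeta> \<noteq> 0" "sig k \<zeta> \<noteq> 0"
      using kern_inversion_shift[of k z "-1 *\<^sub>R \<zeta>"] by auto
    from sig_support[OF this(1), of i] sig_support[OF this(2), of i] assms show False by linarith
  qed
  then have "(LINT x|lborel. kern k (x - z) * kern m (w + -1 *\<^sub>R x)) = 0"
    by (subst kern_parseval[OF integrable_kern_diff(1)]) (simp only: integral_zero mult_zero_right)
  then show ?thesis by (simp add: mult.commute)
qed

lemma integrable_kern_mult: "integrable lborel (\<lambda>x. kern m (x - y) * kern l (x - z))"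
proof -
  obtain B where B: "B \<ge> 0" "\<And>k x. norm (kern k x) \<le> B" using kern_bounded by metis
  show ?thesis
    by (rule Bochner_Integration.integrable_bound[OF integrable_mult_right[OF integrable_kern_diff(1), of "of_real B" m y]])
       (use B in \<open>auto simp: norm_mult mult.commute intro!: mult_right_mono\<close>)
qed

text \<open>The spectrum of a product lies in the sum of the spectra. After two applications of
  Parseval a nonzero integrand would require \<open>\<zeta>\<close> in the support of
  \<open>sig k\<close>, \<open>\<xi>\<close> in that of \<open>sig m\<close> and
  \<open>\<zeta> - \<xi>\<close> in that of \<open>sig l\<close>; the three half-widths 1 add up to
  the threshold 3.\<close>

lemma kern_triple_zero:
  assumes "3 < \<bar>of_int (k $ i) - of_int (m $ i) - of_int (l $ i) :: real\<bar>"
  shows "(LINT x|lborel. kern k (w - x) * (kern m (x - y) * kern l (x - z))) = 0"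
proof -
  have "of_real (sig k \<zeta>) * (cis (w \<bullet> \<zeta>) * (LINT x|lborel. (kern m (x - y) * kern l (x - z)) * cis (x \<bullet> (-1 *\<^sub>R \<zeta>)))) = 0" for \<zeta>
  proof (cases "sig k \<zeta> = 0")
    case False
    let ?A = "\<lambda>x. kern l (x - z) * cis (x \<bullet> (-1 *\<^sub>R \<zeta>))"
    have A: "integrable lborel ?A"
      by (intro integrable_mult_cis integrable_kern_diff) measurable
    have "of_real (sig m \<xi>) * (cis (- y \<bullet> \<xi>) * (LINT x|lborel. ?A x * cis (x \<bullet> (1 *\<^sub>R \<xi>)))) = 0" for \<xi>
    proof (rule ccontr)
      assume *: "\<not> ?thesis"
      then have m: "sig m \<xi> \<noteq> 0" by auto
      have "?A x * cis (x \<bullet> (1 *\<^sub>R \<xi>)) = kern l (x - z) * cis (x \<bullet> (\<xi> - \<zeta>))" for x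
        by (simp add: inner_diff_right mult.assoc cis_mult)
      then have "(LINT x|lborel. ?A x * cis (x \<bullet> (1 *\<^sub>R \<xi>))) = cis (z \<bullet> (\<xi> - \<zeta>)) * of_real (sig l (- (\<xi> - \<zeta>)))"
        by (simp only: kern_inversion_shift)
      with * have "sig l (\<zeta> - \<xi>) \<noteq> 0" by auto
      from sig_support[OF this, of i] sig_support[OF m, of i] sig_support[OF False, of i] assms
      show False by simp
    qed
    then have "(LINT x|lborel. ?A x * kern m (- y + 1 *\<^sub>R x)) = 0"
      by (subst kern_parseval[OF A]) (simp only: integral_zero mult_zero_right)
    then show ?thesis by (simp add: mult_ac)
  qed simp
  then have "(LINT x|lborel. (kern m (x - y) * kern l (x - z)) * kern k (w + -1 *\<^sub>R x)) = 0"
    by (subst kern_parseval[OF integrable_kern_mult]) (simp only: integral_zero mult_zero_right)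
  then show ?thesis by (simp add: mult.commute)
qed

end

subsection \<open>Functions annihilated by a scaled kernel\<close>

text \<open>For finite exponents \<open>u \<le> 1 + u powr p\<close> gives
  \<open>\<Psi> * u \<le> \<Psi> + B * u powr p\<close>. A function that is bounded and integrable
  can thus be paired with any \<open>L^p\<close> function without naming a dual exponent. The bound
  is qualitative, but uniform over all \<open>\<Psi>\<close> with the same mass and
  supremum.\<close>

lemma eLp_pair:
  assumes [measurable]: "u \<in> borel_measurable M" and p: "1 \<le> p" and fin: "eLp M p u < \<infinity>"
  obtains C where "C < \<infinity>"
    "\<And>\<Psi> B. \<Psi> \<in> borel_measurable M \<Longrightarrow> (\<And>x. \<Psi> x \<le> B) \<Longrightarrow> (\<integral>\<^sup>+x. \<Psi> x * u x \<partial>M) \<le> C * ((\<integral>\<^sup>+x. \<Psi> x \<partial>M) + B)"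
proof (cases "p = \<infinity>")
  case True
  show ?thesis
  proof (rule that[OF fin])
    fix \<Psi> :: "'a \<Rightarrow> ennreal" and B assume [measurable]: "\<Psi> \<in> borel_measurable M"
    have "AE x in M. u x \<le> eLp M p u" using eLp_inf_le_iff[OF assms(1)] True by blast
    then have "(\<integral>\<^sup>+x. \<Psi> x * u x \<partial>M) \<le> (\<integral>\<^sup>+x. eLp M p u * \<Psi> x \<partial>M)"
      by (intro nn_integral_mono_AE) (auto elim!: eventually_mono simp: mult.commute intro: mult_left_mono)
    also have "\<dots> = eLp M p u * (\<integral>\<^sup>+x. \<Psi> x \<partial>M)" by (rule nn_integral_cmult) measurable
    also have "\<dots> \<le> eLp M p u * ((\<integral>\<^sup>+x. \<Psi> x \<partial>M) + B)" by (intro mult_left_mono) auto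
    finally show "(\<integral>\<^sup>+x. \<Psi> x * u x \<partial>M) \<le> eLp M p u * ((\<integral>\<^sup>+x. \<Psi> x \<partial>M) + B)" .
  qed
next
  case False
  define a where "a = enn2real p"
  have a: "1 \<le> a" using enn2real_ge_1[OF p False] by (simp add: a_def)
  define J where "J = (\<integral>\<^sup>+x. ennpowr (u x) a \<partial>M)"
  have "J < \<infinity>" using fin False by (simp add: eLp_def J_def a_def less_top[symmetric])
  show ?thesis
  proof (rule that[of "1 + J"])
    show "1 + J < \<infinity>" using \<open>J < \<infinity>\<close> by simp
    fix \<Psi> :: "'a \<Rightarrow> ennreal" and B assume [measurable]: "\<Psi> \<in> borel_measurable M" and B: "\<And>x. \<Psi> x \<le> B"
    have "\<Psi> x * u x \<le> \<Psi> x + B * ennpowr (u x) a" for x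
    proof -
      have "u x \<le> 1 + ennpowr (u x) a"
      proof (cases "u x \<le> 1")
        case False
        then have "ennpowr (u x) 1 \<le> ennpowr (u x) a"
        proof (cases "u x")
          case (real r)
          have "r powr 1 \<le> r powr a" using a False real by (intro powr_mono) auto
          then show ?thesis using real by (simp add: ennreal_leI)
        qed simp
        then show ?thesis by (simp add: add_increasing)
      qed (simp add: add_increasing2)
      then have "\<Psi> x * u x \<le> \<Psi> x * (1 + ennpowr (u x) a)" by (rule mult_left_mono) simp
      also have "\<dots> \<le> \<Psi> x + B * ennpowr (u x) a" by (simp add: distrib_left mult_right_mono B)
      finally show ?thesis .
    qed
    then have "(\<integral>\<^sup>+x. \<Psi> x * u x \<partial>M) \<le> (\<integral>\<^sup>+x. \<Psi> x + B * ennpowr (u x) a \<partial>M)" by (intro nn_integral_mono)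
    also have "\<dots> = (\<integral>\<^sup>+x. \<Psi> x \<partial>M) + J * B" by (simp add: nn_integral_add nn_integral_cmult J_def mult.commute)
    also have "\<dots> \<le> (1 + J) * ((\<integral>\<^sup>+x. \<Psi> x \<partial>M) + B)"
      by (simp add: distrib_left distrib_right add_increasing2 add_mono add.assoc)
    finally show "(\<integral>\<^sup>+x. \<Psi> x * u x \<partial>M) \<le> (1 + J) * ((\<integral>\<^sup>+x. \<Psi> x \<partial>M) + B)" .
  qed
qed

lemma eLp_pair_finite:
  assumes "u \<in> borel_measurable M" "1 \<le> p" "eLp M p u < \<infinity>"
    and "\<Psi> \<in> borel_measurable M" "\<And>x. \<Psi> x \<le> B" "B < \<infinity>" "(\<integral>\<^sup>+x. \<Psi> x \<partial>M) < \<infinity>"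
  shows "(\<integral>\<^sup>+x. \<Psi> x * u x \<partial>M) < \<infinity>"
proof -
  obtain C where "C < \<infinity>" "(\<integral>\<^sup>+x. \<Psi> x * u x \<partial>M) \<le> C * ((\<integral>\<^sup>+x. \<Psi> x \<partial>M) + B)"
    using eLp_pair[OF assms(1-3)] assms(4,5) by metis
  then show ?thesis using assms(6,7) by (simp add: ennreal_mult_less_top le_less_trans)
qed

lemma integrable_mult_Lp:
  fixes h \<Psi> :: "'a \<Rightarrow> complex"
  assumes [measurable]: "h \<in> borel_measurable M" and "1 \<le> p" "eLp M p (\<lambda>x. ennreal (norm (h x))) < \<infinity>"
    and \<Psi>: "integrable M \<Psi>" "\<And>x. norm (\<Psi> x) \<le> B"
  shows "integrable M (\<lambda>x. h x * \<Psi> x)"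
proof (rule integrableI_bounded)
  have [measurable]: "\<Psi> \<in> borel_measurable M" using \<Psi> by auto
  have "(\<integral>\<^sup>+x. ennreal (norm (\<Psi> x)) * ennreal (norm (h x)) \<partial>M) < \<infinity>"
    by (rule eLp_pair_finite[OF _ assms(2,3), of _ "ennreal B"]) (use \<Psi> in \<open>auto simp: integrable_iff_bounded intro: ennreal_leI\<close>)
  then show "(\<integral>\<^sup>+x. ennreal (norm (h x * \<Psi> x)) \<partial>M) < \<infinity>"
    by (simp add: norm_mult ennreal_mult mult.commute)
  show "(\<lambda>x. h x * \<Psi> x) \<in> borel_measurable M" by measurable
qed

text \<open>Minkowski's inequality for a series indexed by \<open>bool\<close>.\<close>

lemma eLp_add:
  assumes "sigma_finite_measure M" and [measurable]: "u \<in> borel_measurable M" "v \<in> borel_measurable M" and "1 \<le> p"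
  shows "eLp M p (\<lambda>x. u x + v x) \<le> eLp M p u + eLp M p v"
proof -
  have "eLp M p (\<lambda>x. \<integral>\<^sup>+i. (if i then u else v) x \<partial>count_space UNIV)
     \<le> (\<integral>\<^sup>+i. eLp M p (if i then u else v) \<partial>count_space UNIV)"
    by (rule eLp_minkowski_series) (use assms in auto)
  then show ?thesis by (simp add: nn_integral_count_space_finite UNIV_bool add.commute)
qed

text \<open>Open boxes are stable under intersection and generate the Borel sets. Cutting
  \<open>h\<close> off to a large box makes it integrable, so the vanishing integrals extend from
  boxes to all Borel sets by a Dynkin argument; countably many cutoffs exhaust the space.\<close>

lemma AE_eq_0_if_boxes:
  fixes h :: "'a::euclidean_space \<Rightarrow> complex"
  assumes h: "\<And>l u. integrable lborel (\<lambda>x. indicator (box l u) x *\<^sub>R h x)"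
    and zero: "\<And>l u. (LINT x|lborel. indicator (box l u) x *\<^sub>R h x) = 0"
  shows "AE x in lborel. h x = 0"
proof -
  let ?A = "\<lambda>n::nat. box (- (real n *\<^sub>R One)) (real n *\<^sub>R One) :: 'a set"
  have "AE x in lborel. indicator (?A n) x *\<^sub>R h x = 0" for n
  proof (rule sigma_finite_measure.density_zero[OF sigma_finite_lborel h])
    let ?g = "\<lambda>x. indicator (?A n) x *\<^sub>R h x"
    let ?E = "range (\<lambda>(a, b). box a b::'a set)"
    have sint: "set_integrable lborel A ?g" if "A \<in> sets borel" for A
      unfolding set_integrable_def using that by (intro integrable_mult_indicator h) auto
    fix A :: "'a set" assume "A \<in> sets lborel"
    then have A: "A \<in> sigma_sets UNIV ?E" by (simp add: borel_eq_box)
    have "Int_stable ?E" by (auto simp: Int_stable_def box_Int_box)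
    moreover have "?E \<subseteq> Pow UNIV" by simp
    ultimately show "set_lebesgue_integral lborel A ?g = 0"
      using A
    proof (induction rule: sigma_sets_induct_disjoint)
      case (basic A)
      then obtain l u where A: "A = box l u" by auto
      obtain l' u' where "A \<inter> ?A n = box l' u'" unfolding A by (simp add: box_Int_box)
      then have "indicator A x *\<^sub>R ?g x = indicator (box l' u') x *\<^sub>R h x" for x
        by (metis indicator_inter_arith scaleR_scaleR)
      then show ?case using zero[of l' u'] by (simp only: set_lebesgue_integral_def)
    next
      case empty
      show ?case by (simp add: set_lebesgue_integral_def)
    next
      case (compl A)
      then have A: "A \<in> sets borel" by (simp add: borel_eq_box)
      have "set_lebesgue_integral lborel (A \<union> (UNIV - A)) ?g = 
        set_lebesgue_integral lborel A ?g + set_lebesgue_integral lborel (UNIV - A) ?g"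
        by (rule set_integral_Un) (use A in \<open>auto intro!: sint\<close>)
      moreover have "A \<union> (UNIV - A) = UNIV" by auto
      moreover have "set_lebesgue_integral lborel UNIV ?g = 0"
        using zero[of "- (real n *\<^sub>R One)" "real n *\<^sub>R One"] by (simp add: set_lebesgue_integral_def)
      ultimately show ?case using compl by simp
    next
      case (union A)
      have A: "A i \<in> sets borel" for i using union by (auto simp: borel_eq_box)
      have "set_lebesgue_integral lborel (\<Union>i. A i) ?g = (\<Sum>i. set_lebesgue_integral lborel (A i) ?g)"
        using union(1) A by (intro lebesgue_integral_countable_add sint) (auto simp: disjoint_family_on_def)
      then show ?case using union by simp
    qed
  qed
  then have "AE x in lborel. \<forall>n. indicator (?A n) x *\<^sub>R h x = 0"
    by (subst AE_all_countable) blast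
  then show ?thesis
  proof eventually_elim
    case (elim x)
    have "x \<in> (\<Union>n. ?A n)" unfolding UN_box_eq_UNIV by simp
    then show ?case using elim by (auto simp: indicator_def split: if_splits)
  qed
qed

text \<open>Smearing the box \<open>Q\<close> with the scaled kernel \<open>E\<close> turns the vanishing pairings into
  \<open>\<integral> E(u) (\<integral>\<^sub>Q h(a + u/j) da) du = 0\<close>; let \<open>j \<rightarrow> \<infinity>\<close>.\<close>

lemma AE_eq_0_if_scaled_pairings:
  fixes h :: "'a::euclidean_space \<Rightarrow> complex"
  assumes h [measurable]: "h \<in> borel_measurable borel" and p: "1 \<le> p" "eLp lborel p (\<lambda>x. ennreal (norm (h x))) < \<infinity>"
    and E: "integrable lborel E" "(LINT x|lborel. E x) \<noteq> 0"
    and zero: "\<And>j a. (LINT x|lborel. h x * E (real (Suc j) *\<^sub>R (x - a))) = 0"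
  shows "AE x in lborel. h x = 0"
proof (rule AE_eq_0_if_boxes)
  fix l u :: 'a
  define Q where "Q = box l u"
  have [measurable]: "Q \<in> sets borel" by (simp add: Q_def)
  have [measurable]: "E \<in> borel_measurable borel" using E by auto
  have fQ: "emeasure lborel Q < \<infinity>" unfolding Q_def by (rule emeasure_bounded_finite) simp
  obtain C where C: "C < \<infinity>" "\<And>\<Psi> B. \<Psi> \<in> borel_measurable borel \<Longrightarrow> (\<And>x. \<Psi> x \<le> B) \<Longrightarrow>
      (\<integral>\<^sup>+x. \<Psi> x * ennreal (norm (h x)) \<partial>lborel) \<le> C * ((\<integral>\<^sup>+x. \<Psi> x \<partial>lborel) + B)"
    using eLp_pair[of "\<lambda>x. ennreal (norm (h x))" lborel p] p by auto
  have loc: "(\<integral>\<^sup>+x. indicator S x * ennreal (norm (h x)) \<partial>lborel) \<le> C * (emeasure lborel S + 1)" if [measurable]: "S \<in> sets borel" for S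
  proof -
    have "indicator S x \<le> (1::ennreal)" for x by (simp add: indicator_def)
    from C(2)[of "indicator S" 1, OF _ this] show ?thesis by simp
  qed
  have bint: "integrable lborel (\<lambda>x. indicator S x *\<^sub>R h x)" if "bounded S" and [measurable]: "S \<in> sets borel" for S
  proof (rule integrableI_bounded)
    have "(\<integral>\<^sup>+x. ennreal (norm (indicator S x *\<^sub>R h x)) \<partial>lborel) = (\<integral>\<^sup>+x. indicator S x * ennreal (norm (h x)) \<partial>lborel)"
      by (intro nn_integral_cong) (auto simp: indicator_def)
    also have "\<dots> < \<infinity>" using loc[of S] C(1) emeasure_bounded_finite[OF \<open>bounded S\<close>]
      by (simp add: le_less_trans ennreal_mult_less_top)
    finally show "(\<integral>\<^sup>+x. ennreal (norm (indicator S x *\<^sub>R h x)) \<partial>lborel) < \<infinity>" .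
  qed measurable
  show "integrable lborel (\<lambda>x. indicator (box l u) x *\<^sub>R h x)" using bint[of Q] by (simp add: Q_def)
  define e where "e j = 1 / real (Suc j)" for j
  have e: "e j > 0" "e j \<le> 1" for j by (auto simp: e_def)
  have e0: "e \<longlonglongrightarrow> 0" unfolding e_def[abs_def] by (rule LIMSEQ_Suc[OF lim_1_over_n])
  \<comment> \<open>\<open>T v\<close> is the integral of \<open>h\<close> over the box translated
    by \<open>v\<close>; the goal is \<open>T 0 = 0\<close>.\<close>
  define T where "T v = (LINT a|lborel. indicator Q a *\<^sub>R h (a + v))" for v
  have [measurable]: "T \<in> borel_measurable borel" unfolding T_def[abs_def] by measurable
  \<comment> \<open>Uniform in \<open>v\<close>, because the constant of \<open>eLp_pair\<close>
    sees only the mass and the supremum of the translated indicator.\<close>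
  have nshift: "(\<integral>\<^sup>+a. indicator Q a * ennreal (norm (h (a + v))) \<partial>lborel) \<le> C * (emeasure lborel Q + 1)" for v
  proof -
    have "(\<integral>\<^sup>+a. indicator Q a * ennreal (norm (h (a + v))) \<partial>lborel) = (\<integral>\<^sup>+a. indicator Q (a - v) * ennreal (norm (h a)) \<partial>lborel)"
      using nn_integral_lborel_shift(1)[of "\<lambda>a. indicator Q a * ennreal (norm (h (a + v)))" v] by simp
    also have "\<dots> \<le> C * ((\<integral>\<^sup>+a. indicator Q (a - v) \<partial>lborel) + 1)" by (rule C(2)) (auto simp: indicator_def)
    also have "(\<integral>\<^sup>+a. indicator Q (a - v) \<partial>lborel) = emeasure lborel Q"
      using nn_integral_lborel_shift(1)[of "indicator Q" v] by simp
    finally show ?thesis .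
  qed
  define K where "K = C * (emeasure lborel Q + 1)"
  have K: "K < \<infinity>" using C(1) fQ by (simp add: K_def ennreal_mult_less_top)
  have Tb: "norm (T v) \<le> enn2real K" for v
  proof (cases "integrable lborel (\<lambda>a. indicator Q a *\<^sub>R h (a + v))")
    case True
    then have "ennreal (norm (T v)) \<le> (\<integral>\<^sup>+a. norm (indicator Q a *\<^sub>R h (a + v)) \<partial>lborel)"
      unfolding T_def by (rule integral_norm_bound_ennreal)
    also have "\<dots> = (\<integral>\<^sup>+a. indicator Q a * ennreal (norm (h (a + v))) \<partial>lborel)"
      by (intro nn_integral_cong) (auto simp: indicator_def)
    also have "\<dots> \<le> K" unfolding K_def by (rule nshift)
    finally show ?thesis using K by (cases K) auto
  qed (simp add: T_def not_integrable_integral_eq)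
  have TE: "(LINT u|lborel. E u * T (e j *\<^sub>R u)) = 0" for j
  proof -
    have z: "(LINT u|lborel. h (a + e j *\<^sub>R u) * E u) = 0" for a
    proof -
      have *: "real (Suc j) *\<^sub>R (e j *\<^sub>R u) = u" for u :: 'a by (simp add: e_def)
      have "(LINT x|lborel. h x * E (real (Suc j) *\<^sub>R (x - a))) = e j ^ DIM('a) *\<^sub>R (LINT u|lborel. h (a + e j *\<^sub>R u) * E u)"
        using e(1)[of j] by (subst integral_lborel_affine[of "e j" _ a]) (simp_all only: add_diff_cancel_left' *, auto)
      then show ?thesis using zero[of j a] e(1)[of j] by simp
    qed
    have "(LINT u|lborel. E u * T (e j *\<^sub>R u)) = (LINT u|lborel. LINT a|lborel. E u * (indicator Q a *\<^sub>R h (a + e j *\<^sub>R u)))"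
      by (simp only: T_def integral_mult_right_zero)
    also have "\<dots> = (LINT a|lborel. LINT u|lborel. E u * (indicator Q a *\<^sub>R h (a + e j *\<^sub>R u)))"
    proof (rule Fubini_swap)
      have "(\<integral>\<^sup>+u. \<integral>\<^sup>+a. ennreal (norm (E u * (indicator Q a *\<^sub>R h (a + e j *\<^sub>R u)))) \<partial>lborel \<partial>lborel)
        = (\<integral>\<^sup>+u. ennreal (norm (E u)) * (\<integral>\<^sup>+a. indicator Q a * ennreal (norm (h (a + e j *\<^sub>R u))) \<partial>lborel) \<partial>lborel)"
        by (subst nn_integral_cmult[symmetric]) (auto intro!: nn_integral_cong simp: norm_mult ennreal_mult indicator_def)
      also have "\<dots> \<le> (\<integral>\<^sup>+u. ennreal (norm (E u)) * K \<partial>lborel)"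
        unfolding K_def by (intro nn_integral_mono mult_left_mono nshift) auto
      also have "\<dots> = (\<integral>\<^sup>+u. ennreal (norm (E u)) \<partial>lborel) * K" by (rule nn_integral_multc) measurable
      also have "\<dots> < \<infinity>" using E(1) K by (auto simp: integrable_iff_bounded ennreal_mult_less_top)
      finally show "(\<integral>\<^sup>+u. \<integral>\<^sup>+a. ennreal (norm (E u * (indicator Q a *\<^sub>R h (a + e j *\<^sub>R u)))) \<partial>lborel \<partial>lborel) < \<infinity>" .
    qed (auto intro: lborel.sigma_finite_measure_axioms)
    also have "\<dots> = (LINT a|lborel. indicator Q a *\<^sub>R (LINT u|lborel. h (a + e j *\<^sub>R u) * E u))"
      by (simp flip: integral_scaleR_right add: mult.commute)
    finally show ?thesis by (simp add: z)
  qed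
  \<comment> \<open>\<open>h\<close> need not be continuous. Moving the translation onto the
    indicator leaves \<open>h\<close> fixed, and the indicators of the translated boxes converge off
    the frontier of \<open>Q\<close>, a null set.\<close>
  have T0: "(\<lambda>j. T (e j *\<^sub>R v)) \<longlonglongrightarrow> T 0" for v
  proof -
    have Tsh: "T w = (LINT x|lborel. indicator Q (x - w) *\<^sub>R h x)" for w
      unfolding T_def using integral_lborel_affine[of 1 "\<lambda>x. indicator Q (x - w) *\<^sub>R h x" w] by (simp add: add.commute)
    obtain R where R: "\<And>x. x \<in> Q \<Longrightarrow> norm x \<le> R" unfolding Q_def using bounded_box bounded_iff by metis
    have nf: "AE x in lborel. x \<notin> frontier Q"
    proof -
      have "negligible (frontier Q)" unfolding Q_def by (intro negligible_convex_frontier convex_box)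
      then have "frontier Q \<in> null_sets lborel"
        by (simp add: negligible_iff_null_sets null_sets_completion_iff frontier_closed)
      then show ?thesis by (rule AE_not_in)
    qed
    have "(\<lambda>j. LINT x|lborel. indicator Q (x - e j *\<^sub>R v) *\<^sub>R h x) \<longlonglongrightarrow> (LINT x|lborel. indicator Q (x - 0) *\<^sub>R h x)"
    proof (rule integral_dominated_convergence[where w = "\<lambda>x. norm (indicator (cball 0 (R + norm v)) x *\<^sub>R h x)"])
      show "integrable lborel (\<lambda>x. norm (indicator (cball 0 (R + norm v)) x *\<^sub>R h x))"
        by (intro integrable_norm bint) auto
      show "AE x in lborel. norm (indicator Q (x - e j *\<^sub>R v) *\<^sub>R h x) \<le> norm (indicator (cball 0 (R + norm v)) x *\<^sub>R h x)" for j
      proof (rule AE_I2)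
        fix x
        have "norm x \<le> R + norm v" if "x - e j *\<^sub>R v \<in> Q"
        proof -
          have "norm x \<le> norm (x - e j *\<^sub>R v) + norm (e j *\<^sub>R v)" by (metis diff_add_cancel norm_triangle_ineq)
          also have "norm (e j *\<^sub>R v) \<le> norm v" using e[of j] by (simp add: mult_left_le_one_le)
          finally show ?thesis using R[OF that] by simp
        qed
        then show "norm (indicator Q (x - e j *\<^sub>R v) *\<^sub>R h x) \<le> norm (indicator (cball 0 (R + norm v)) x *\<^sub>R h x)"
          by (auto simp: indicator_def)
      qed
      show "AE x in lborel. (\<lambda>j. indicator Q (x - e j *\<^sub>R v) *\<^sub>R h x) \<longlonglongrightarrow> indicator Q (x - 0) *\<^sub>R h x"
        using nf
      proof eventually_elim
        case (elim x)
        have lim: "(\<lambda>j. x - e j *\<^sub>R v) \<longlonglongrightarrow> x - 0 *\<^sub>R v" by (intro tendsto_intros e0)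
        have "\<forall>\<^sub>F j in sequentially. indicator Q (x - e j *\<^sub>R v) = (indicator Q x :: real)"
        proof (cases "x \<in> Q")
          case True
          have "open Q" by (simp add: Q_def open_box)
          from topological_tendstoD[OF lim this] True show ?thesis by (auto elim!: eventually_mono)
        next
          case False
          then have x: "x \<in> - closure Q"
            using elim interior_subset[of Q] by (auto simp: frontier_def)
          have "open (- closure Q)" by auto
          from topological_tendstoD[OF lim this] x have "\<forall>\<^sub>F j in sequentially. x - e j *\<^sub>R v \<in> - closure Q" by simp
          then show ?thesis by eventually_elim (use False closure_subset[of Q] in \<open>auto simp: indicator_def\<close>)
        qed
        then show ?case by (intro tendsto_eventually) (auto elim!: eventually_mono)
      qed
    qed measurable
    then show ?thesis by (simp add: Tsh)
  qed
  have "(\<lambda>j. LINT u|lborel. E u * T (e j *\<^sub>R u)) \<longlonglongrightarrow> (LINT u|lborel. E u * T 0)"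
  proof (rule integral_dominated_convergence[where w = "\<lambda>u. norm (E u) * enn2real K"])
    show "integrable lborel (\<lambda>u. norm (E u) * enn2real K)" using E by auto
    show "AE u in lborel. (\<lambda>j. E u * T (e j *\<^sub>R u)) \<longlonglongrightarrow> E u * T 0" by (intro AE_I2 tendsto_intros T0)
    show "AE u in lborel. norm (E u * T (e j *\<^sub>R u)) \<le> norm (E u) * enn2real K" for j
      by (intro AE_I2) (simp add: norm_mult mult_left_mono Tb)
  qed measurable
  then have "(LINT u|lborel. E u * T 0) = 0" unfolding TE by (simp add: LIMSEQ_const_iff)
  then have "T 0 = 0" using E(2) by simp
  then show "(LINT x|lborel. indicator (box l u) x *\<^sub>R h x) = 0" by (simp add: T_def Q_def)
qed

subsection \<open>Frequency pieces as convolutions\<close>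

lemma eLp_translate_le:
  fixes u :: "'a::euclidean_space \<Rightarrow> ennreal"
  assumes [measurable]: "u \<in> borel_measurable borel" and p: "1 \<le> p"
  shows "eLp lborel p (\<lambda>x. u (x - t)) \<le> eLp lborel p u"
proof (cases "p = \<infinity>")
  case True
  have "AE x in lborel. u x \<le> eLp lborel p u" using eLp_inf_le_iff[of u lborel] True by auto
  then have "AE x in distr lborel borel ((+) (- t)). u x \<le> eLp lborel p u" by (simp only: lborel_distr_plus)
  then have "AE x in lborel. u (- t + x) \<le> eLp lborel p u" by (subst (asm) AE_distr_iff) auto
  then show ?thesis using True by (simp add: eLp_top_le_iff)
next
  case False
  then show ?thesis
    using nn_integral_lborel_shift(1)[of "\<lambda>x. ennpowr (u x) (enn2real p)" t] by (simp add: eLp_def)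
qed

lemma eLp_diff_finite:
  fixes f g :: "'a \<Rightarrow> complex"
  assumes "sigma_finite_measure M" "1 \<le> p" and [measurable]: "f \<in> borel_measurable M" "g \<in> borel_measurable M"
    and "eLp M p (\<lambda>x. ennreal (norm (f x))) < \<infinity>" "eLp M p (\<lambda>x. ennreal (norm (g x))) < \<infinity>"
  shows "eLp M p (\<lambda>x. ennreal (norm (f x - g x))) < \<infinity>"
proof -
  have "eLp M p (\<lambda>x. ennreal (norm (f x - g x))) \<le> eLp M p (\<lambda>x. ennreal (norm (f x)) + ennreal (norm (g x)))"
    by (intro eLp_mono_AE assms AE_I2) (auto simp flip: ennreal_plus intro!: ennreal_leI norm_triangle_ineq4)
  also have "\<dots> \<le> eLp M p (\<lambda>x. ennreal (norm (f x))) + eLp M p (\<lambda>x. ennreal (norm (g x)))"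
    by (intro eLp_add assms) auto
  also have "\<dots> < \<infinity>" using assms by simp
  finally show ?thesis .
qed

section \<open>Borel representatives of Lebesgue measurable functions\<close>

lemma eLp_lebesgue:
  assumes "u \<in> borel_measurable borel" "1 \<le> p"
  shows "eLp lebesgue p u = eLp lborel p u"
proof (cases "p = \<infinity>")
  case True
  have u: "u \<in> borel_measurable lborel" "u \<in> borel_measurable lebesgue"
    using assms by (auto intro: measurable_completion)
  have "eLp lebesgue p u \<le> c \<longleftrightarrow> eLp lborel p u \<le> c" for c
    using True u by (simp add: eLp_top_le_iff AE_completion_iff)
  then show ?thesis by (metis order_antisym order_refl)
qed (simp add: eLp_def nn_integral_completion)

text \<open>The spaces consist of Lebesgue measurable functions, while the exchange of integrals is
  carried out for \<open>lborel\<close>. A Borel representative has the same norms and the same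
  pairings with Borel functions, so the analysis takes place on representatives.\<close>

lemma lebesgue_borel_rep:
  fixes f :: "'a::euclidean_space \<Rightarrow> complex"
  assumes "f \<in> borel_measurable lebesgue"
  obtains f' where "f' \<in> borel_measurable borel" "AE x in lebesgue. f x = f' x"
proof -
  have "(\<lambda>x. Re (f x)) \<in> borel_measurable lebesgue" "(\<lambda>x. Im (f x)) \<in> borel_measurable lebesgue"
    using assms by auto
  then obtain g h where [measurable]: "g \<in> borel_measurable lborel" "h \<in> borel_measurable lborel"
    and gh: "AE x in lborel. Re (f x) = g x" "AE x in lborel. Im (f x) = h x"
    by (metis completion_ex_borel_measurable_real)
  show ?thesis
  proof (rule that[of "\<lambda>x. Complex (g x) (h x)"])
    have "(\<lambda>x. of_real (g x) + \<i> * of_real (h x) :: complex) \<in> borel_measurable borel" by measurable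
    then show "(\<lambda>x. Complex (g x) (h x)) \<in> borel_measurable borel" by (simp add: Complex_eq)
    have "AE x in lborel. f x = Complex (g x) (h x)" using gh by eventually_elim (simp add: complex_eq_iff)
    then show "AE x in lebesgue. f x = Complex (g x) (h x)" by (rule AE_completion)
  qed
qed

lemma Lp_norm_eq_eLp:
  assumes "1 \<le> p" "f \<in> borel_measurable lebesgue" "g \<in> borel_measurable borel" "AE x in lebesgue. f x = g x"
  shows "Lp_norm p f = eLp lborel p (\<lambda>x. ennreal (norm (g x)))"
proof -
  have "Lp_norm p f = eLp lebesgue p (\<lambda>x. ennreal (norm (f x)))"
    by (simp add: Lp_norm_def eLp_def)
  also have "\<dots> = eLp lebesgue p (\<lambda>x. ennreal (norm (g x)))"
    using assms by (intro eLp_cong_AE) (auto elim!: eventually_mono intro: measurable_completion)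
  also have "\<dots> = eLp lborel p (\<lambda>x. ennreal (norm (g x)))"
    using assms by (intro eLp_lebesgue) auto
  finally show ?thesis .
qed

lemma distr_of_eq:
  assumes "f \<in> borel_measurable lebesgue" "g \<in> borel_measurable borel" "AE x in lebesgue. f x = g x"
    and "\<phi> \<in> borel_measurable borel"
  shows "distr_of f \<phi> = (LINT x|lborel. g x * \<phi> x)"
proof -
  have "distr_of f \<phi> = (LINT x|lebesgue. g x * \<phi> x)"
    unfolding distr_of_def using assms
    by (intro integral_cong_AE) (auto elim!: eventually_mono intro!: borel_measurable_times intro: measurable_completion)
  then show ?thesis using assms by (simp add: integral_completion)
qed

section \<open>Test functions\<close>

lemma partials_of_real:
  assumes "smooth f"
  shows "partials js (\<lambda>x. of_real (f x) :: complex) = (\<lambda>x. of_real (partials js f x))"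
proof (induction js)
  case (Cons j js)
  have "partials [j] (\<lambda>x. of_real (partials js f x) :: complex) = (\<lambda>x. of_real (frechet_derivative (partials js f) (at x) (axis j 1)))"
  proof (rule partials_single_eqI)
    fix x
    show "((\<lambda>x. of_real (partials js f x) :: complex) has_derivative (\<lambda>h. of_real (frechet_derivative (partials js f) (at x) h))) (at x)"
      using smooth_differentiable[OF smooth_partials[OF assms], of js x]
      by (intro has_derivative_of_real) (simp add: frechet_derivative_works)
  qed
  then show ?case using Cons by simp
qed simp

lemma bd_support_schwartz:
  assumes s: "smooth f" and "bd_support f"
  shows "(\<lambda>x. complex_of_real (f x)) \<in> schwartz"
  unfolding schwartz_def
proof (intro CollectI conjI allI)
  have "(\<lambda>x. complex_of_real (partials js f x)) differentiable (at x)" for js x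
    using smooth_differentiable[OF smooth_partials[OF s], of js x]
    by (auto simp: differentiable_def intro: has_derivative_of_real)
  then show "smooth (\<lambda>x. complex_of_real (f x))" by (simp add: smooth_def partials_of_real[OF s])
  fix N :: nat and js
  obtain R B where RB: "R > 0" "\<And>x. norm (partials js f x) \<le> B * indicator (cball 0 R) x" "B \<ge> 0"
    using bd_support_bounded[OF bd_support_partials[OF assms(2)] smooth_continuous[OF smooth_partials[OF s]], of js] by metis
  have "(1 + norm x) ^ N * norm (partials js (\<lambda>x. complex_of_real (f x)) x) \<le> (1 + R) ^ N * B" for x
  proof (cases "x \<in> cball 0 R")
    case True
    then show ?thesis using RB(2)[of x] RB(1,3) by (intro mult_mono power_mono) (auto simp: partials_of_real[OF s])
  next
    case False
    then show ?thesis using RB(2)[of x] RB(1,3) by (simp add: partials_of_real[OF s])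
  qed
  then show "\<exists>B. \<forall>x. (1 + norm x) ^ N * norm (partials js (\<lambda>x. complex_of_real (f x)) x) \<le> B" by blast
qed

lemma schwartz_borel: "\<phi> \<in> schwartz \<Longrightarrow> \<phi> \<in> borel_measurable borel"
  unfolding schwartz_def by (auto intro!: borel_measurable_continuous_onI smooth_continuous)

lemma schwartz_integrable: "\<phi> \<in> schwartz \<Longrightarrow> integrable lborel \<phi>"
proof -
  assume \<phi>: "\<phi> \<in> schwartz"
  \<comment> \<open>The order \<open>2 * DIM\<close> is the one that \<open>decay_ge\<close>
    converts into an integrable bound.\<close>
  then obtain B where B: "\<And>x. (1 + norm x) ^ (2 * DIM(real^'a)) * norm (partials [] \<phi> x) \<le> B"
    unfolding schwartz_def by blast
  have "norm (\<phi> x) \<le> norm (B * decay x)" for x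
  proof -
    have pos: "0 < (1 + norm x) ^ (2 * DIM(real^'a))" by (intro zero_less_power) (simp add: add_pos_nonneg)
    have B0: "0 \<le> B" using B[of 0] by (meson norm_ge_zero order_trans mult_nonneg_nonneg zero_le_power add_nonneg_nonneg zero_le_one)
    have "norm (\<phi> x) \<le> B * (1 / (1 + norm x) ^ (2 * DIM(real^'a)))"
      using B[of x] pos by (simp add: field_simps)
    also have "\<dots> \<le> B * decay x" using B0 decay_ge[of x] by (intro mult_left_mono) auto
    finally show ?thesis by simp
  qed
  then show ?thesis
    by (intro Bochner_Integration.integrable_bound[OF integrable_mult_right[OF integrable_decay, of B]])
       (auto intro: schwartz_borel \<phi>)
qed

context window
begin

definition conv :: "int^'n \<Rightarrow> (real^'n \<Rightarrow> complex) \<Rightarrow> real^'n \<Rightarrow> complex" where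
  "conv k f x = (LINT y|lborel. kern k (x - y) * f y)"

text \<open>Convolution with the modulus common to all kernels. It majorises every
  \<open>conv k f\<close> at once, and as an \<open>ennreal\<close> integral it is meaningful before
  convergence is known.\<close>

definition ncv :: "(real^'n \<Rightarrow> ennreal) \<Rightarrow> real^'n \<Rightarrow> ennreal" where
  "ncv u x = (\<integral>\<^sup>+y. ennreal (norm (kern 0 (x - y))) * u y \<partial>lborel)"

definition kern_mass :: ennreal where
  "kern_mass = (\<integral>\<^sup>+x. ennreal (norm (kern 0 x)) \<partial>lborel)"

abbreviation in_Lp :: "ennreal \<Rightarrow> (real^'n \<Rightarrow> complex) \<Rightarrow> bool" where
  "in_Lp p f \<equiv> f \<in> borel_measurable borel \<and> eLp lborel p (\<lambda>x. ennreal (norm (f x))) < \<infinity>"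

lemma kern_mass_finite: "kern_mass < \<infinity>"
  using integrable_kern[of 0] by (simp add: kern_mass_def integrable_iff_bounded)

lemma borel_measurable_conv [measurable]:
  assumes [measurable]: "f \<in> borel_measurable borel"
  shows "conv k f \<in> borel_measurable borel"
  unfolding conv_def[abs_def] by measurable

lemma borel_measurable_ncv [measurable]:
  assumes [measurable]: "u \<in> borel_measurable borel"
  shows "ncv u \<in> borel_measurable borel"
  unfolding ncv_def[abs_def] by measurable

lemma norm_conv_le:
  assumes [measurable]: "f \<in> borel_measurable borel"
  shows "ennreal (norm (conv k f x)) \<le> ncv (\<lambda>x. ennreal (norm (f x))) x"
proof (cases "integrable lborel (\<lambda>y. kern k (x - y) * f y)")
  case True
  then have "ennreal (norm (conv k f x)) \<le> (\<integral>\<^sup>+y. norm (kern k (x - y) * f y) \<partial>lborel)"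
    unfolding conv_def by (rule integral_norm_bound_ennreal)
  then show ?thesis by (simp add: ncv_def norm_mult norm_kern[of k] ennreal_mult)
qed (simp add: conv_def not_integrable_integral_eq)

lemma eLp_ncv_le:
  assumes [measurable]: "u \<in> borel_measurable borel" and p: "1 \<le> p"
  shows "eLp lborel p (ncv u) \<le> kern_mass * eLp lborel p u"
proof -
  have "ncv u = (\<lambda>x. \<integral>\<^sup>+t. ennreal (norm (kern 0 t)) * u (x - t) \<partial>lborel)"
  proof
    fix x
    show "ncv u x = (\<integral>\<^sup>+t. ennreal (norm (kern 0 t)) * u (x - t) \<partial>lborel)"
      using nn_integral_lborel_shift(2)[of "\<lambda>t. ennreal (norm (kern 0 t)) * u (x - t)" x]
      by (simp add: ncv_def)
  qed
  then show ?thesis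
    using kern_mass_finite unfolding kern_mass_def
    by (simp only:) (intro eLp_minkowski_weighted sigma_finite_lborel p
        eLp_translate_le[of u], measurable)
qed

lemma eLp_conv_le:
  assumes [measurable]: "f \<in> borel_measurable borel" and p: "1 \<le> p"
  shows "eLp lborel p (\<lambda>x. ennreal (norm (conv k f x))) \<le> kern_mass * eLp lborel p (\<lambda>x. ennreal (norm (f x)))"
  by (rule order_trans[OF eLp_mono_AE eLp_ncv_le]) (use p in \<open>auto simp: norm_conv_le\<close>)

text \<open>The kernel is integrable and bounded, so convolution maps every \<open>L^p\<close> into
  the bounded functions. This makes pairings of \<open>conv k f\<close> with functions that are
  merely integrable absolutely convergent.\<close>

lemma ncv_bounded:
  assumes f: "in_Lp p f" and p: "1 \<le> p"
  obtains K where "K < \<infinity>" "\<And>x. ncv (\<lambda>x. ennreal (norm (f x))) x \<le> K"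
proof -
  have [measurable]: "f \<in> borel_measurable borel" using f by simp
  obtain B where B: "B \<ge> 0" "\<And>k x. norm (kern k x) \<le> B" using kern_bounded by metis
  obtain C where C: "C < \<infinity>" "\<And>\<Psi> B. \<Psi> \<in> borel_measurable lborel \<Longrightarrow> (\<And>x. \<Psi> x \<le> B) \<Longrightarrow>
      (\<integral>\<^sup>+x. \<Psi> x * ennreal (norm (f x)) \<partial>lborel) \<le> C * ((\<integral>\<^sup>+x. \<Psi> x \<partial>lborel) + B)"
    using eLp_pair[of "\<lambda>x. ennreal (norm (f x))" lborel p] f p by auto
  show ?thesis
  proof
    show "C * (kern_mass + ennreal B) < \<infinity>"
      using C(1) kern_mass_finite by (simp add: ennreal_mult_less_top)
    fix x
    have "(\<integral>\<^sup>+y. ennreal (norm (kern 0 (x - y))) \<partial>lborel) = kern_mass"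
      unfolding kern_mass_def using nn_integral_lborel_shift(2)[of "\<lambda>y. ennreal (norm (kern 0 y))" x] by simp
    then show "ncv (\<lambda>x. ennreal (norm (f x))) x \<le> C * (kern_mass + ennreal B)"
      unfolding ncv_def using C(2)[of "\<lambda>y. ennreal (norm (kern 0 (x - y)))" "ennreal B"] B(2) by (simp add: ennreal_leI)
  qed
qed

lemma conv_in_Lp:
  assumes f: "in_Lp p f" and p: "1 \<le> p"
  shows "in_Lp p (conv k f)"
proof
  show "conv k f \<in> borel_measurable borel" using f by (intro borel_measurable_conv) simp
  show "eLp lborel p (\<lambda>x. ennreal (norm (conv k f x))) < \<infinity>"
    using eLp_conv_le[OF _ p, of f k] f kern_mass_finite by (auto simp: ennreal_mult_less_top intro: le_less_trans)
qed

lemma ncv_integrable_mult: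
  fixes \<Psi> :: "real^'n \<Rightarrow> complex"
  assumes f: "in_Lp p f" and p: "1 \<le> p" and \<Psi>: "integrable lborel \<Psi>"
  shows "(\<integral>\<^sup>+x. ennreal (norm (\<Psi> x)) * ncv (\<lambda>x. ennreal (norm (f x))) x \<partial>lborel) < \<infinity>"
proof -
  obtain K where K: "K < \<infinity>" "\<And>x. ncv (\<lambda>x. ennreal (norm (f x))) x \<le> K" using ncv_bounded[OF f p] by metis
  have "(\<integral>\<^sup>+x. ennreal (norm (\<Psi> x)) * ncv (\<lambda>x. ennreal (norm (f x))) x \<partial>lborel) \<le> (\<integral>\<^sup>+x. ennreal (norm (\<Psi> x)) * K \<partial>lborel)"
    by (intro nn_integral_mono mult_left_mono K) auto
  also have "\<dots> = (\<integral>\<^sup>+x. ennreal (norm (\<Psi> x)) \<partial>lborel) * K" 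
    using \<Psi> by (intro nn_integral_multc) auto
  also have "\<dots> < \<infinity>" using \<Psi> K by (auto simp: integrable_iff_bounded ennreal_mult_less_top)
  finally show ?thesis .
qed

text \<open>Fubini transposes the convolution onto the other factor. The second claim records
  integrability of the result, so that finitely many such pairings can be added under one
  integral.\<close>

lemma conv_pairing:
  assumes f: "in_Lp p f" and p: "1 \<le> p" and \<Psi>: "integrable lborel \<Psi>"
  shows "(LINT x|lborel. conv k f x * \<Psi> x) = (LINT y|lborel. f y * (LINT x|lborel. \<Psi> x * kern k (x - y)))"
    and "integrable lborel (\<lambda>y. f y * (LINT x|lborel. \<Psi> x * kern k (x - y)))"
proof -
  have [measurable]: "f \<in> borel_measurable borel" "\<Psi> \<in> borel_measurable borel" using f \<Psi> by auto
  have fin: "(\<integral>\<^sup>+x. \<integral>\<^sup>+y. ennreal (norm (f y * (\<Psi> x * kern k (x - y)))) \<partial>lborel \<partial>lborel) < \<infinity>"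
  proof -
    have "(\<integral>\<^sup>+x. \<integral>\<^sup>+y. ennreal (norm (f y * (\<Psi> x * kern k (x - y)))) \<partial>lborel \<partial>lborel)
      = (\<integral>\<^sup>+x. ennreal (norm (\<Psi> x)) * ncv (\<lambda>x. ennreal (norm (f x))) x \<partial>lborel)"
      unfolding ncv_def
      by (subst nn_integral_cmult[symmetric]) (auto intro!: nn_integral_cong simp: norm_mult ennreal_mult norm_kern[of k] mult_ac)
    also have "\<dots> < \<infinity>" by (rule ncv_integrable_mult[OF f p \<Psi>])
    finally show ?thesis .
  qed
  have "(LINT x|lborel. conv k f x * \<Psi> x) = (LINT x|lborel. LINT y|lborel. f y * (\<Psi> x * kern k (x - y)))"
    unfolding conv_def by (simp flip: integral_mult_left_zero add: mult_ac)
  also have "\<dots> = (LINT y|lborel. LINT x|lborel. f y * (\<Psi> x * kern k (x - y)))"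
    by (rule Fubini_swap[OF sigma_finite_lborel sigma_finite_lborel _ fin]) measurable
  finally show "(LINT x|lborel. conv k f x * \<Psi> x) = (LINT y|lborel. f y * (LINT x|lborel. \<Psi> x * kern k (x - y)))" by simp
  have "integrable lborel (\<lambda>y. LINT x|lborel. f y * (\<Psi> x * kern k (x - y)))"
    by (rule integrable_Fubini_snd[OF sigma_finite_lborel sigma_finite_lborel _ fin]) measurable
  then show "integrable lborel (\<lambda>y. f y * (LINT x|lborel. \<Psi> x * kern k (x - y)))" by simp
qed

text \<open>By duality \<open>freq_box\<close> acts on test functions in reversed order: inverse
  transform, multiplication by the symbol, transform. The composition integrates against a translate
  of \<open>kern k\<close>, and the two half powers of \<open>2 * pi\<close> multiply to the
  constant in \<open>kern\<close>.\<close>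

lemma fourier_sig_fourier_inv:
  assumes \<phi>: "integrable lborel \<phi>"
  shows "fourier (\<lambda>\<xi>. of_real (sig k \<xi>) * fourier_inv \<phi> \<xi>) x = (LINT y|lborel. \<phi> y * kern k (y - x))"
proof -
  let ?c = "of_real ((2 * pi) powr (- real CARD('n) / 2)) :: complex"
  have [measurable]: "\<phi> \<in> borel_measurable borel" using \<phi> by auto
  have inv: "fourier_inv \<phi> \<xi> = ?c * (LINT y|lborel. \<phi> y * cis (y \<bullet> \<xi>))" for \<xi>
    unfolding fourier_inv_def by (subst integral_completion) (auto simp: cis_conv_exp inner_commute)
  have m: "(\<lambda>\<xi>. of_real (sig k \<xi>) * fourier_inv \<phi> \<xi>) \<in> borel_measurable borel"
    unfolding inv[abs_def] by measurable
  have "fourier (\<lambda>\<xi>. of_real (sig k \<xi>) * fourier_inv \<phi> \<xi>) x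
    = ?c * (LINT \<xi>|lborel. of_real (sig k \<xi>) * fourier_inv \<phi> \<xi> * exp (- \<i> * of_real (\<xi> \<bullet> x)))"
    unfolding fourier_def using m by (subst integral_completion) (auto simp: inner_commute)
  also have "\<dots> = ?c * (LINT \<xi>|lborel. ?c * (of_real (sig k \<xi>) * (cis (- x \<bullet> \<xi>) * (LINT y|lborel. \<phi> y * cis (y \<bullet> (1 *\<^sub>R \<xi>))))))"
    by (simp add: inv cis_conv_exp inner_commute mult_ac)
  also have "\<dots> = ?c * ?c * (LINT \<xi>|lborel. (of_real (sig k \<xi>) * (cis (- x \<bullet> \<xi>) * (LINT y|lborel. \<phi> y * cis (y \<bullet> (1 *\<^sub>R \<xi>))))))"
    by simp
  also have "?c * ?c = of_real ((2 * pi) powr (- real CARD('n)))"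
    by (simp flip: of_real_mult powr_add)
  finally show ?thesis using kern_parseval[OF \<phi>, of k "- x" 1] by simp
qed

lemma freq_box_eq:
  assumes f0: "f0 \<in> borel_measurable lebesgue" "AE x in lebesgue. f0 x = f x"
    and f: "in_Lp p f" and p: "1 \<le> p" and \<phi>: "integrable lborel \<phi>"
  shows "freq_box \<rho> k f0 \<phi> = (LINT x|lborel. conv k f x * \<phi> x)"
proof -
  have [measurable]: "\<phi> \<in> borel_measurable borel" using \<phi> by auto
  have "freq_box \<rho> k f0 \<phi> = distr_of f0 (\<lambda>x. LINT y|lborel. \<phi> y * kern k (y - x))"
    unfolding freq_box_def distr_fourier_inv_def distr_mult_def distr_fourier_def
    by (simp add: fourier_sig_fourier_inv[OF \<phi>, abs_def])
  also have "\<dots> = (LINT x|lborel. f x * (LINT y|lborel. \<phi> y * kern k (y - x)))"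
    by (rule distr_of_eq) (use f0 f in auto)
  also have "\<dots> = (LINT x|lborel. conv k f x * \<phi> x)" by (rule conv_pairing(1)[OF f p \<phi>, symmetric])
  finally show ?thesis .
qed

lemma integral_rho_nz: "(LINT x|lborel. \<rho> x) \<noteq> 0" and integrable_rho: "integrable lborel \<rho>"
proof -
  show i: "integrable lborel \<rho>"
    by (intro bd_support_integrable bd_support_rho smooth_continuous smooth_rho)
  have "\<not> (AE x in lborel. \<rho> x = 0)"
  proof
    assume "AE x in lborel. \<rho> x = 0"
    moreover have "\<rho> x = 1" if "x \<in> box (\<chi> i. -1/2) (\<chi> i. 1/2)" for x
    proof (rule rho_one)
      fix i show "\<bar>x $ i\<bar> \<le> 1 / 2" using that by (auto simp: mem_box_cart abs_le_iff less_imp_le dest!: spec[of _ i])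
    qed
    ultimately have "AE x in lborel. x \<notin> box (\<chi> i. -1/2) (\<chi> i. 1/2 :: real^'n)" by (auto elim!: eventually_mono)
    then have "emeasure lborel (box (\<chi> i. -1/2) (\<chi> i. 1/2) :: (real^'n) set) = 0"
      by (subst (asm) AE_iff_measurable[OF _ refl]) (auto simp: )
    moreover have "emeasure lborel (box (\<chi> i. -1/2) (\<chi> i. 1/2) :: (real^'n) set) = (\<Prod>b\<in>(Basis :: (real^'n) set). 1)"
      by (subst emeasure_lborel_box) (auto simp: Basis_vec_def inner_axis inner_diff_left intro!: prod.neutral)
    ultimately show False by simp
  qed
  then show "(LINT x|lborel. \<rho> x) \<noteq> 0" using i by (subst integral_nonneg_eq_0_iff_AE) auto
qed

text \<open>The infimum is attained at \<open>conv k f\<close>: any other representing function has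
  the same pairings with all translated and dilated windows, so it agrees with
  \<open>conv k f\<close> almost everywhere.\<close>

lemma distr_Lp_norm_freq_box:
  assumes f0: "f0 \<in> borel_measurable lebesgue" "AE x in lebesgue. f0 x = f x"
    and f: "in_Lp p f" and p: "1 \<le> p"
  shows "distr_Lp_norm p (freq_box \<rho> k f0) = eLp lborel p (\<lambda>x. ennreal (norm (conv k f x)))"
proof (rule antisym)
  have F: "in_Lp p (conv k f)" by (rule conv_in_Lp[OF f p])
  have F': "conv k f \<in> borel_measurable lebesgue" using F by (auto intro: measurable_completion)
  have N: "Lp_norm p (conv k f) = eLp lborel p (\<lambda>x. ennreal (norm (conv k f x)))"
    using F F' p by (intro Lp_norm_eq_eLp) auto
  have "conv k f \<in> {h \<in> Lp p. \<forall>\<phi>\<in>schwartz. freq_box \<rho> k f0 \<phi> = distr_of h \<phi>}"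
    using F F' N freq_box_eq[OF f0 f p schwartz_integrable] distr_of_eq[OF F' _ _ schwartz_borel, of "conv k f"]
    by (auto simp: Lp_def)
  then show "distr_Lp_norm p (freq_box \<rho> k f0) \<le> eLp lborel p (\<lambda>x. ennreal (norm (conv k f x)))"
    unfolding distr_Lp_norm_def N[symmetric] by (rule INF_lower)
  show "eLp lborel p (\<lambda>x. ennreal (norm (conv k f x))) \<le> distr_Lp_norm p (freq_box \<rho> k f0)"
    unfolding distr_Lp_norm_def
  proof (rule INF_greatest)
    fix h assume "h \<in> {h \<in> Lp p. \<forall>\<phi>\<in>schwartz. freq_box \<rho> k f0 \<phi> = distr_of h \<phi>}"
    then have h: "h \<in> borel_measurable lebesgue" "Lp_norm p h < \<infinity>" "\<And>\<phi>. \<phi> \<in> schwartz \<Longrightarrow> freq_box \<rho> k f0 \<phi> = distr_of h \<phi>"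
      by (auto simp: Lp_def)
    obtain h' where h': "h' \<in> borel_measurable borel" "AE x in lebesgue. h x = h' x"
      using lebesgue_borel_rep[OF h(1)] by metis
    have Nh: "Lp_norm p h = eLp lborel p (\<lambda>x. ennreal (norm (h' x)))" by (rule Lp_norm_eq_eLp[OF p h(1) h'])
    have [measurable]: "h' \<in> borel_measurable borel" "conv k f \<in> borel_measurable borel" using h' F by auto
    have "AE x in lborel. h' x - conv k f x = 0"
    proof (rule AE_eq_0_if_scaled_pairings[OF _ p, where E = "\<lambda>x. of_real (\<rho> x)"])
      show "eLp lborel p (\<lambda>x. ennreal (norm (h' x - conv k f x))) < \<infinity>"
        using h(2) F by (intro eLp_diff_finite sigma_finite_lborel p) (auto simp: Nh)
      show "integrable lborel (\<lambda>x. complex_of_real (\<rho> x))" by (intro integrable_of_real integrable_rho)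
      show "(LINT x|lborel. complex_of_real (\<rho> x)) \<noteq> 0" using integral_rho_nz by simp
      fix j :: nat and a :: "real^'n"
      \<comment> \<open>The dilated and translated window in the form of
        \<open>smooth_affine\<close>. Being smooth with bounded support it is a Schwartz function,
        so \<open>h\<close> may be tested against it.\<close>
      let ?r = "\<lambda>x. \<rho> (real (Suc j) *\<^sub>R x + (- real (Suc j) *\<^sub>R a))"
      let ?\<phi> = "\<lambda>x. complex_of_real (?r x)"
      have "bd_support ?r"
      proof -
        obtain R where R: "\<And>x. R < norm x \<Longrightarrow> \<rho> x = 0" using bd_support_rho by (auto simp: bd_support_def)
        have "?r x = 0" if "\<bar>R\<bar> + norm (real (Suc j) *\<^sub>R a) < norm x" for x
        proof (rule R)
          have "norm x \<le> norm (real (Suc j) *\<^sub>R x)" by (simp add: distrib_right)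
          also have "\<dots> \<le> norm (real (Suc j) *\<^sub>R x + (- real (Suc j) *\<^sub>R a)) + norm (real (Suc j) *\<^sub>R a)"
            using norm_triangle_ineq[of "real (Suc j) *\<^sub>R x + (- real (Suc j) *\<^sub>R a)" "real (Suc j) *\<^sub>R a"]
            by (simp del: of_nat_Suc norm_scaleR)
          finally show "R < norm (real (Suc j) *\<^sub>R x + (- real (Suc j) *\<^sub>R a))" using that by linarith
        qed
        then show ?thesis by (auto simp: bd_support_def)
      qed
      then have \<phi>: "?\<phi> \<in> schwartz" by (intro bd_support_schwartz smooth_affine smooth_rho)
      have i\<phi>: "integrable lborel ?\<phi>" by (rule schwartz_integrable[OF \<phi>])
      have b\<phi>: "norm (?\<phi> x) \<le> 1" for x by (simp add: rho_le_1)
      have "(LINT x|lborel. h' x * ?\<phi> x) = (LINT x|lborel. conv k f x * ?\<phi> x)"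
        using h(3)[OF \<phi>] freq_box_eq[OF f0 f p i\<phi>] distr_of_eq[OF h(1) h' schwartz_borel[OF \<phi>]] by simp
      moreover have "integrable lborel (\<lambda>x. h' x * ?\<phi> x)"
        using h(2) by (intro integrable_mult_Lp[OF _ p _ i\<phi> b\<phi>]) (auto simp: Nh)
      moreover have "integrable lborel (\<lambda>x. conv k f x * ?\<phi> x)"
        using F by (intro integrable_mult_Lp[OF _ p _ i\<phi> b\<phi>]) auto
      ultimately have "(LINT x|lborel. (h' x - conv k f x) * ?\<phi> x) = 0" by (simp add: left_diff_distrib)
      then show "(LINT x|lborel. (h' x - conv k f x) * of_real (\<rho> (real (Suc j) *\<^sub>R (x - a)))) = 0"
        by (simp add: scaleR_right_diff_distrib del: of_nat_Suc)
    qed measurable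
    then have "eLp lborel p (\<lambda>x. ennreal (norm (conv k f x))) = eLp lborel p (\<lambda>x. ennreal (norm (h' x)))"
      by (intro eLp_cong_AE p) (auto elim!: eventually_mono)
    then show "eLp lborel p (\<lambda>x. ennreal (norm (conv k f x))) \<le> Lp_norm p h" by (simp add: Nh)
  qed
qed

end

subsection \<open>Frequency pieces of a product\<close>

text \<open>True for non-integrable \<open>f\<close> as well, whose integral is 0 by default; so the
  terms and sums of a series can be bounded before integrability is discussed.\<close>

lemma norm_integral_le_nn:
  fixes f :: "'a \<Rightarrow> 'b::{banach, second_countable_topology}"
  shows "ennreal (norm (LINT x|M. f x)) \<le> (\<integral>\<^sup>+x. ennreal (norm (f x)) \<partial>M)"
  by (cases "integrable M f") (auto intro: integral_norm_bound_ennreal simp: not_integrable_integral_eq)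

lemma measurable_count_space_snd:
  assumes "\<And>m. g m \<in> borel_measurable M"
  shows "(\<lambda>(x, m :: 'i::countable). g m x) \<in> borel_measurable (M \<Otimes>\<^sub>M count_space UNIV)"
  by (subst measurable_pair_swap_iff, rule measurable_pair_measure_countable1) (use assms in auto)

lemma Fubini_swap_count_space:
  fixes f :: "'i::countable \<Rightarrow> 'a \<Rightarrow> 'b::{banach, second_countable_topology}"
  assumes "sigma_finite_measure M" and f: "\<And>m. f m \<in> borel_measurable M"
    and "(\<integral>\<^sup>+x. \<integral>\<^sup>+m. norm (f m x) \<partial>count_space UNIV \<partial>M) < \<infinity>"
  shows "(LINT x|M. LINT m|count_space UNIV. f m x) = (LINT m|count_space UNIV. LINT x|M. f m x)"
  by (rule Fubini_swap) (use assms measurable_count_space_snd[OF f] sigma_finite_measure_count_space in auto)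

lemma borel_measurable_integral_count_space:
  fixes f :: "'i::countable \<Rightarrow> 'a \<Rightarrow> 'b::{banach, second_countable_topology}"
  assumes f: "\<And>m. f m \<in> borel_measurable M"
  shows "(\<lambda>x. LINT m|count_space UNIV. f m x) \<in> borel_measurable M"
  using sigma_finite_measure.borel_measurable_lebesgue_integral[OF sigma_finite_measure_count_space measurable_count_space_snd[OF f]] .

lemma borel_measurable_nn_integral_count_space:
  fixes f :: "'i::countable \<Rightarrow> 'a \<Rightarrow> ennreal"
  assumes f: "\<And>m. f m \<in> borel_measurable M"
  shows "(\<lambda>x. \<integral>\<^sup>+m. f m x \<partial>count_space UNIV) \<in> borel_measurable M"
  using sigma_finite_measure.borel_measurable_nn_integral[OF sigma_finite_measure_count_space measurable_count_space_snd[OF f]] .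

lemma nn_integral_member_le: "f i \<le> (\<integral>\<^sup>+i. f i \<partial>count_space UNIV)"
proof -
  have "(\<integral>\<^sup>+j. f j * indicator {i} j \<partial>count_space UNIV) \<le> (\<integral>\<^sup>+i. f i \<partial>count_space UNIV)"
    by (intro nn_integral_mono) (auto simp: indicator_def)
  then show ?thesis by (simp add: nn_integral_indicator_singleton)
qed

context window
begin

section \<open>Summing the pieces back to the function\<close>

lemma integral_kern0_nz: "(LINT x|lborel. kern 0 x) \<noteq> 0"
proof -
  have "\<rho> 0 = 1" by (rule rho_one) simp
  then have "sig 0 0 \<noteq> 0" using den_ge_1[of 0] by (simp add: sig_eq)
  then show ?thesis using kern_inversion[of 0 0] by simp
qed

text \<open>Pairing with \<open>kern 0 (J (x - a))\<close>, whose spectrum is compact, sees only finitely many of the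
  pieces \<open>conv m f\<close>, and these sum up to \<open>f\<close> there because \<open>sig\<close> is a partition of unity.\<close>

lemma sum_kern_pairings:
  assumes J: "0 < J"
  obtains A where "finite A"
    "\<And>m y. m \<notin> A \<Longrightarrow> (LINT x|lborel. kern 0 (J *\<^sub>R (x - a)) * kern m (x - y)) = 0"
    "\<And>y. (\<Sum>m\<in>A. LINT x|lborel. kern 0 (J *\<^sub>R (x - a)) * kern m (x - y)) = kern 0 (J *\<^sub>R (y - a))"
proof -
  let ?c = "of_real ((2 * pi) powr (- real CARD('n))) :: complex"
  define G where "G y \<xi> = of_real (sig 0 \<xi>) * (cis ((- J *\<^sub>R a) \<bullet> \<xi>) * cis (y \<bullet> (J *\<^sub>R \<xi>)))" for y \<xi>
  have R: "(LINT x|lborel. kern 0 (J *\<^sub>R (x - a)) * kern m (x - y)) = ?c * (LINT \<xi>|lborel. G y \<xi> * of_real (sig m (- (J *\<^sub>R \<xi>))))" for m y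
  proof -
    have "(LINT x|lborel. kern 0 (J *\<^sub>R (x - a)) * kern m (x - y)) = (LINT x|lborel. kern m (x - y) * kern 0 (- J *\<^sub>R a + J *\<^sub>R x))"
      by (simp add: mult.commute scaleR_right_diff_distrib)
    also have "\<dots> = ?c * (LINT \<xi>|lborel. of_real (sig 0 \<xi>) * (cis ((- J *\<^sub>R a) \<bullet> \<xi>) * (LINT x|lborel. kern m (x - y) * cis (x \<bullet> (J *\<^sub>R \<xi>)))))"
      by (rule kern_parseval[OF integrable_kern_diff(1)])
    also have "\<dots> = ?c * (LINT \<xi>|lborel. G y \<xi> * of_real (sig m (- (J *\<^sub>R \<xi>))))"
      by (simp only: kern_inversion_shift G_def mult.assoc)
    finally show ?thesis .
  qed
  have R0: "kern 0 (J *\<^sub>R (y - a)) = ?c * (LINT \<xi>|lborel. G y \<xi>)" for y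
  proof -
    have "cis ((- J *\<^sub>R a) \<bullet> \<xi>) * cis (y \<bullet> (J *\<^sub>R \<xi>)) = cis ((J *\<^sub>R (y - a)) \<bullet> \<xi>)" for \<xi>
      by (simp add: cis_mult inner_diff_left algebra_simps)
    then show ?thesis by (simp only: kern_def ftr_def G_def)
  qed
  \<comment> \<open>Scaling by \<open>J\<close> stretches the support of \<open>sig 0\<close> to
    half-width \<open>J\<close>; the half-width 1 of \<open>sig m\<close> is added.\<close>
  define A :: "(int^'n) set" where "A = {m. \<forall>i. \<bar>0 $ i - of_int (m $ i)\<bar> \<le> J + 1}"
  have A: "finite A" unfolding A_def by (rule finite_lattice_near)
  have supp: "m \<in> A" if "sig 0 \<xi> \<noteq> 0" "sig m (- (J *\<^sub>R \<xi>)) \<noteq> 0" for m \<xi>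
  proof -
    have "\<bar>0 $ i - of_int (m $ i)\<bar> \<le> J + 1" for i
    proof -
      have "\<bar>\<xi> $ i\<bar> \<le> 1" using sig_support[OF that(1), of i] by simp
      then have "\<bar>J * \<xi> $ i\<bar> \<le> J" using J by (simp add: abs_mult)
      then show ?thesis using sig_support[OF that(2), of i] by simp
    qed
    then show ?thesis by (simp add: A_def)
  qed
  show ?thesis
  proof (rule that[OF A])
    fix m y assume "m \<notin> A"
    then have "G y \<xi> * of_real (sig m (- (J *\<^sub>R \<xi>))) = 0" for \<xi> using supp[of \<xi> m] by (auto simp: G_def)
    then show "(LINT x|lborel. kern 0 (J *\<^sub>R (x - a)) * kern m (x - y)) = 0" by (simp only: R) simp
  next
    fix y
    have iG: "integrable lborel (G y)"
      unfolding G_def[abs_def] mult.assoc[symmetric]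
      by (intro integrable_mult_cis integrable_of_real integrable_sig) measurable
    have [measurable]: "G y \<in> borel_measurable borel" using iG by auto
    have iGm: "integrable lborel (\<lambda>\<xi>. G y \<xi> * of_real (sig m (- (J *\<^sub>R \<xi>))))" for m
      by (rule Bochner_Integration.integrable_bound[OF iG])
         (auto simp: norm_mult intro!: mult_left_le sig_le_1)
    have "(\<Sum>m\<in>A. G y \<xi> * of_real (sig m (- (J *\<^sub>R \<xi>)))) = G y \<xi>" for \<xi>
    proof (cases "sig 0 \<xi> = 0")
      case False
      let ?z = "- (J *\<^sub>R \<xi>)"
      have sub: "{m. sig m ?z \<noteq> 0} \<subseteq> A" using supp[OF False] by auto
      have "(\<Sum>m\<in>A. sig m ?z) = (\<Sum>m | sig m ?z \<noteq> 0. sig m ?z)"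
        using sub by (intro sum.mono_neutral_right A) auto
      also have "\<dots> = (LINT m|count_space UNIV. sig m ?z)"
        by (subst lebesgue_integral_count_space_finite_support) (use finite_subset[OF sub A] in auto)
      finally have "(\<Sum>m\<in>A. sig m ?z) = 1" by (simp add: sig_sum)
      then show ?thesis by (simp flip: sum_distrib_left of_real_sum)
    qed (simp add: G_def)
    then have "(LINT \<xi>|lborel. (\<Sum>m\<in>A. G y \<xi> * of_real (sig m (- (J *\<^sub>R \<xi>))))) = (LINT \<xi>|lborel. G y \<xi>)" by simp
    then show "(\<Sum>m\<in>A. LINT x|lborel. kern 0 (J *\<^sub>R (x - a)) * kern m (x - y)) = kern 0 (J *\<^sub>R (y - a))"
      unfolding R R0[of y] by (subst (asm) Bochner_Integration.integral_sum[OF iGm]) (simp flip: sum_distrib_left)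
  qed
qed

text \<open>By \<open>fin\<close> the series of moduli has finite \<open>L^p\<close> norm, so its
  sum \<open>S\<close> is in \<open>L^p\<close>, as is \<open>f\<close>. Both have the same pairing
  with every dilate and translate of \<open>kern 0\<close>: only finitely many pieces contribute,
  and transposed onto the kernels they reproduce the dilate itself. Uniqueness from scaled pairings
  concludes.\<close>

lemma conv_reconstruct:
  assumes f: "in_Lp p f" and p: "1 \<le> p"
    and fin: "eLp lborel p (\<lambda>x. \<integral>\<^sup>+m. ennreal (norm (conv m f x)) \<partial>count_space UNIV) < \<infinity>"
  shows "AE x in lborel. f x = (LINT m|count_space UNIV. conv m f x)"
proof -
  define S where "S x = (LINT m|count_space UNIV. conv m f x)" for x
  define \<Sigma> where "\<Sigma> x = (\<integral>\<^sup>+m. ennreal (norm (conv m f x)) \<partial>count_space UNIV)" for x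
  have mf [measurable]: "f \<in> borel_measurable borel" using f by simp
  have [measurable]: "S \<in> borel_measurable borel"
    unfolding S_def[abs_def] by (rule borel_measurable_integral_count_space) measurable
  have [measurable]: "\<Sigma> \<in> borel_measurable borel"
    unfolding \<Sigma>_def[abs_def] by (rule borel_measurable_nn_integral_count_space) measurable
  have S\<Sigma>: "ennreal (norm (S x)) \<le> \<Sigma> x" for x unfolding S_def \<Sigma>_def by (rule norm_integral_le_nn)
  have finS: "eLp lborel p (\<lambda>x. ennreal (norm (S x))) < \<infinity>"
    by (rule le_less_trans[OF eLp_mono_AE fin]) (use S\<Sigma> p in \<open>auto simp flip: \<Sigma>_def\<close>)
  have "AE x in lborel. f x - S x = 0"
  proof (rule AE_eq_0_if_scaled_pairings[OF _ p, where E = "kern 0"])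
    show "eLp lborel p (\<lambda>x. ennreal (norm (f x - S x))) < \<infinity>"
      using f finS by (intro eLp_diff_finite sigma_finite_lborel p) auto
    fix j :: nat and a :: "real^'n"
    define J where "J = real (Suc j)"
    have J: "0 < J" by (simp add: J_def)
    let ?\<Psi> = "\<lambda>x. kern 0 (J *\<^sub>R (x - a))"
    obtain A where A: "finite A" "\<And>m y. m \<notin> A \<Longrightarrow> (LINT x|lborel. ?\<Psi> x * kern m (x - y)) = 0"
      "\<And>y. (\<Sum>m\<in>A. LINT x|lborel. ?\<Psi> x * kern m (x - y)) = ?\<Psi> y"
      using sum_kern_pairings[OF J, of a] by blast
    have i\<Psi>: "integrable lborel ?\<Psi>"
      using integrable_kern_affine[of J 0 "- J *\<^sub>R a"] J by (simp add: scaleR_right_diff_distrib)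
    then have [measurable]: "?\<Psi> \<in> borel_measurable borel" by auto
    obtain B where B: "\<And>k x. norm (kern k x) \<le> B" using kern_bounded by metis
    have fin2: "(\<integral>\<^sup>+x. ennreal (norm (?\<Psi> x)) * \<Sigma> x \<partial>lborel) < \<infinity>"
      by (rule eLp_pair_finite[OF _ p, of _ _ _ "ennreal B"])
         (use fin i\<Psi> B in \<open>auto simp: integrable_iff_bounded \<Sigma>_def[abs_def, symmetric] intro: ennreal_leI\<close>)
    have "(LINT x|lborel. S x * ?\<Psi> x) = (LINT x|lborel. LINT m|count_space UNIV. conv m f x * ?\<Psi> x)"
      by (simp add: S_def)
    also have "\<dots> = (LINT m|count_space UNIV. LINT x|lborel. conv m f x * ?\<Psi> x)"
    proof (rule Fubini_swap_count_space[OF sigma_finite_lborel])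
      have "(\<integral>\<^sup>+x. \<integral>\<^sup>+m. ennreal (norm (conv m f x * ?\<Psi> x)) \<partial>count_space UNIV \<partial>lborel) = (\<integral>\<^sup>+x. ennreal (norm (?\<Psi> x)) * \<Sigma> x \<partial>lborel)"
        unfolding \<Sigma>_def by (subst nn_integral_cmult[symmetric]) (auto simp: norm_mult ennreal_mult mult.commute)
      then show "(\<integral>\<^sup>+x. \<integral>\<^sup>+m. ennreal (norm (conv m f x * ?\<Psi> x)) \<partial>count_space UNIV \<partial>lborel) < \<infinity>" using fin2 by simp
    qed measurable
    also have "\<dots> = (LINT m|count_space UNIV. LINT y|lborel. f y * (LINT x|lborel. ?\<Psi> x * kern m (x - y)))"
      by (simp only: conv_pairing(1)[OF f p i\<Psi>])
    also have "\<dots> = (\<Sum>m\<in>A. LINT y|lborel. f y * (LINT x|lborel. ?\<Psi> x * kern m (x - y)))"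
    proof -
      let ?r = "\<lambda>m. LINT y|lborel. f y * (LINT x|lborel. ?\<Psi> x * kern m (x - y))"
      have sub: "{m. ?r m \<noteq> 0} \<subseteq> A"
      proof
        fix m assume "m \<in> {m. ?r m \<noteq> 0}"
        then show "m \<in> A" using A(2)[of m] by (cases "m \<in> A") auto
      qed
      have "(LINT m|count_space UNIV. ?r m) = (\<Sum>m | ?r m \<noteq> 0. ?r m)"
        by (subst lebesgue_integral_count_space_finite_support) (use finite_subset[OF sub A(1)] in auto)
      also have "\<dots> = (\<Sum>m\<in>A. ?r m)" using sub by (intro sum.mono_neutral_left A(1)) auto
      finally show ?thesis .
    qed
    also have "\<dots> = (LINT y|lborel. (\<Sum>m\<in>A. f y * (LINT x|lborel. ?\<Psi> x * kern m (x - y))))"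
      by (rule Bochner_Integration.integral_sum[symmetric]) (rule conv_pairing(2)[OF f p i\<Psi>])
    also have "\<dots> = (LINT y|lborel. f y * ?\<Psi> y)"
      by (simp only: sum_distrib_left[symmetric] A(3))
    finally have eq: "(LINT x|lborel. S x * ?\<Psi> x) = (LINT y|lborel. f y * ?\<Psi> y)" .
    have "integrable lborel (\<lambda>x. f x * ?\<Psi> x)" "integrable lborel (\<lambda>x. S x * ?\<Psi> x)"
      using f finS by (auto intro!: integrable_mult_Lp[OF _ p _ i\<Psi> B])
    then have "(LINT x|lborel. (f x - S x) * ?\<Psi> x) = 0" using eq by (simp add: left_diff_distrib)
    then show "(LINT x|lborel. (f x - S x) * kern 0 (real (Suc j) *\<^sub>R (x - a))) = 0" by (simp only: J_def)
  qed (use integrable_kern integral_kern0_nz in auto)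
  then show ?thesis by (simp add: S_def)
qed

lemma conv_integrable_mult:
  assumes f: "in_Lp p f" and p: "1 \<le> p" and \<Psi>: "integrable lborel (\<Psi> :: real^'n \<Rightarrow> complex)"
  shows "integrable lborel (\<lambda>x. conv k f x * \<Psi> x)"
proof (rule integrableI_bounded)
  have [measurable]: "f \<in> borel_measurable borel" "\<Psi> \<in> borel_measurable borel" using f \<Psi> by auto
  show "(\<lambda>x. conv k f x * \<Psi> x) \<in> borel_measurable lborel" by measurable
  have "(\<integral>\<^sup>+x. ennreal (norm (conv k f x * \<Psi> x)) \<partial>lborel) \<le> (\<integral>\<^sup>+x. ennreal (norm (\<Psi> x)) * ncv (\<lambda>x. ennreal (norm (f x))) x \<partial>lborel)"
    by (intro nn_integral_mono) (simp add: norm_mult ennreal_mult mult.commute mult_left_mono norm_conv_le)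
  also have "\<dots> < \<infinity>" by (rule ncv_integrable_mult[OF f p \<Psi>])
  finally show "(\<integral>\<^sup>+x. ennreal (norm (conv k f x * \<Psi> x)) \<partial>lborel) < \<infinity>" .
qed

section \<open>Spectral localisation of pieces and of their products\<close>

lemma conv_conv_zero:
  assumes f: "in_Lp p f" and p: "1 \<le> p" and far: "2 < \<bar>of_int (m $ i) - of_int (k $ i) :: real\<bar>"
  shows "conv m (conv k f) w = 0"
proof -
  have "conv m (conv k f) w = (LINT x|lborel. conv k f x * kern m (w - x))"
    by (simp add: conv_def[of m] mult.commute)
  also have "\<dots> = (LINT z|lborel. f z * (LINT x|lborel. kern m (w - x) * kern k (x - z)))"
    by (rule conv_pairing(1)[OF f p integrable_kern_diff(2)])
  finally show ?thesis by (simp add: kern_kern_zero[OF far])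
qed

text \<open>Transposing \<open>conv m f\<close> and then \<open>conv l g\<close> leaves a triple
  product of kernels under the integral. At the outer step the other factor
  \<open>conv l g x * kern k (w - x)\<close> is merely known to be integrable, which is the
  generality of \<open>conv_pairing\<close>.\<close>

lemma conv_mult_zero:
  assumes f: "in_Lp p1 f" and g: "in_Lp p2 g" and p: "1 \<le> p1" "1 \<le> p2"
    and far: "3 < \<bar>of_int (k $ i) - of_int (m $ i) - of_int (l $ i) :: real\<bar>"
  shows "(LINT x|lborel. kern k (w - x) * (conv m f x * conv l g x)) = 0"
proof -
  have "(LINT x|lborel. kern k (w - x) * (conv m f x * conv l g x)) = (LINT x|lborel. conv m f x * (conv l g x * kern k (w - x)))"
    by (simp add: mult_ac)
  also have "\<dots> = (LINT y|lborel. f y * (LINT x|lborel. conv l g x * kern k (w - x) * kern m (x - y)))"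
    by (rule conv_pairing(1)[OF f p(1)]) (rule conv_integrable_mult[OF g p(2) integrable_kern_diff(2)])
  also have "\<dots> = (LINT y|lborel. f y * 0)"
  proof (intro Bochner_Integration.integral_cong refl arg_cong2[of _ _ _ _ "(*)"])
    fix y
    obtain B where B: "\<And>k x. norm (kern k x) \<le> B" using kern_bounded by metis
    have int: "integrable lborel (\<lambda>x. kern k (w - x) * kern m (x - y))"
      by (rule Bochner_Integration.integrable_bound[OF integrable_mult_right[OF integrable_kern_diff(1), of "of_real B" m y]])
         (auto simp: norm_mult intro!: mult_right_mono order_trans[OF B abs_ge_self])
    have "(LINT x|lborel. conv l g x * kern k (w - x) * kern m (x - y)) = (LINT x|lborel. conv l g x * (kern k (w - x) * kern m (x - y)))"
      by (simp add: mult.assoc)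
    also have "\<dots> = (LINT z|lborel. g z * (LINT x|lborel. kern k (w - x) * kern m (x - y) * kern l (x - z)))"
      by (rule conv_pairing(1)[OF g p(2) int])
    finally show "(LINT x|lborel. conv l g x * kern k (w - x) * kern m (x - y)) = 0"
      by (simp add: mult.assoc kern_triple_zero[OF far])
  qed
  finally show ?thesis by simp
qed

text \<open>The bound 3 is the sum of the half-widths of the three symbols involved.\<close>

definition close :: "int^'n \<Rightarrow> int^'n \<Rightarrow> int^'n \<Rightarrow> bool" where
  "close k m l \<longleftrightarrow> (\<forall>i. \<bar>k $ i - m $ i - l $ i\<bar> \<le> 3)"

text \<open>Expanding \<open>f\<close> and \<open>g\<close> into their pieces requires interchanging
  two series with the integral at individual points \<open>w\<close>. The common majorant is
  \<open>ncv (U V)\<close> with \<open>U\<close> and \<open>V\<close> the series of moduli; it has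
  finite \<open>L^p\<close> norm and is therefore finite almost everywhere. The terms that survive
  the spectral cutoff are estimated in norm one by one.\<close>

lemma eLp_conv_mult_le:
  assumes f: "in_Lp p1 f" and g: "in_Lp p2 g" and p: "1 \<le> p1" "1 \<le> p2" "1 \<le> p" "1 / p = 1 / p1 + 1 / p2"
    and finf: "eLp lborel p1 (\<lambda>x. \<integral>\<^sup>+m. ennreal (norm (conv m f x)) \<partial>count_space UNIV) < \<infinity>"
    and fing: "eLp lborel p2 (\<lambda>x. \<integral>\<^sup>+m. ennreal (norm (conv m g x)) \<partial>count_space UNIV) < \<infinity>"
  shows "eLp lborel p (\<lambda>x. ennreal (norm (conv k (\<lambda>x. f x * g x) x))) \<le>
    (\<integral>\<^sup>+m. \<integral>\<^sup>+l. of_bool (close k m l) * (kern_mass * (eLp lborel p1 (\<lambda>x. ennreal (norm (conv m f x)))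
      * eLp lborel p2 (\<lambda>x. ennreal (norm (conv l g x))))) \<partial>count_space UNIV \<partial>count_space UNIV)"
proof -
  have [measurable]: "f \<in> borel_measurable borel" "g \<in> borel_measurable borel" using f g by auto
  define F where "F m x = ennreal (norm (conv m f x))" for m x
  define G where "G m x = ennreal (norm (conv m g x))" for m x
  define U where "U x = (\<integral>\<^sup>+m. F m x \<partial>count_space UNIV)" for x
  define V where "V x = (\<integral>\<^sup>+m. G m x \<partial>count_space UNIV)" for x
  define S where "S x = (LINT m|count_space UNIV. conv m f x)" for x
  define T where "T x = (LINT m|count_space UNIV. conv m g x)" for x
  have [measurable]: "F m \<in> borel_measurable borel" "G m \<in> borel_measurable borel" for m
    unfolding F_def[abs_def] G_def[abs_def] by measurable
  have [measurable]: "U \<in> borel_measurable borel" "V \<in> borel_measurable borel"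
    unfolding U_def[abs_def] V_def[abs_def] by (rule borel_measurable_nn_integral_count_space; measurable)+
  have [measurable]: "S \<in> borel_measurable borel" "T \<in> borel_measurable borel"
    unfolding S_def[abs_def] T_def[abs_def] by (rule borel_measurable_integral_count_space; measurable)+
  have TV: "ennreal (norm (T x)) \<le> V x" for x unfolding T_def V_def G_def by (rule norm_integral_le_nn)
  have FU: "F m x \<le> U x" for m x unfolding U_def by (rule nn_integral_member_le)
  have fS: "AE x in lborel. f x = S x" unfolding S_def by (rule conv_reconstruct[OF f p(1) finf])
  have gT: "AE x in lborel. g x = T x" unfolding T_def by (rule conv_reconstruct[OF g p(2) fing])
  \<comment> \<open>Majorant of the term with indices \<open>m\<close> and \<open>l\<close>. The
    cutoff may be built in because the term vanishes when the indices are not close.\<close>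
  define N where "N m l w = of_bool (close k m l) * ncv (\<lambda>x. F m x * G l x) w" for m l w
  have [measurable]: "N m l \<in> borel_measurable borel" for m l unfolding N_def[abs_def] by measurable
  have Nb [measurable]: "(\<lambda>w. \<integral>\<^sup>+l. N m l w \<partial>count_space UNIV) \<in> borel_measurable borel" for m
    by (rule borel_measurable_nn_integral_count_space) measurable
  have [measurable]: "(\<lambda>w. \<integral>\<^sup>+m. \<integral>\<^sup>+l. N m l w \<partial>count_space UNIV \<partial>count_space UNIV) \<in> borel_measurable borel"
    by (rule borel_measurable_nn_integral_count_space) measurable
  \<comment> \<open>Young and Hoelder for the majorant; at every \<open>w\<close> where it is finite
    both interchanges below are legitimate.\<close>
  have "eLp lborel p (ncv (\<lambda>x. U x * V x)) \<le> kern_mass * (eLp lborel p1 U * eLp lborel p2 V)"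
    by (rule order_trans[OF eLp_ncv_le[OF _ p(3)]]) (use p in \<open>auto intro!: mult_left_mono eLp_holder\<close>)
  also have "\<dots> < \<infinity>"
    using kern_mass_finite finf fing by (simp add: ennreal_mult_less_top U_def[abs_def] V_def[abs_def] F_def G_def)
  finally have "AE w in lborel. ncv (\<lambda>x. U x * V x) w < \<infinity>"
    by (intro eLp_finite_AE[OF _ p(3)]) measurable
  then have "AE w in lborel. ennreal (norm (conv k (\<lambda>x. f x * g x) w)) \<le> (\<integral>\<^sup>+m. \<integral>\<^sup>+l. N m l w \<partial>count_space UNIV \<partial>count_space UNIV)"
  proof eventually_elim
    case (elim w)
    have "conv k (\<lambda>x. f x * g x) w = (LINT x|lborel. kern k (w - x) * (S x * T x))"
      unfolding conv_def by (intro integral_cong_AE) (measurable, use fS gT in eventually_elim, simp)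
    \<comment> \<open>Only \<open>f\<close> is expanded here, with \<open>T\<close> kept for the sum
      of the pieces of \<open>g\<close>. Each interchange thus involves a single lattice variable,
      and \<open>T\<close> is bounded by \<open>V\<close> in the majorant.\<close>
    also have "\<dots> = (LINT x|lborel. LINT m|count_space UNIV. kern k (w - x) * (conv m f x * T x))"
      by (simp add: S_def)
    also have "\<dots> = (LINT m|count_space UNIV. LINT x|lborel. kern k (w - x) * (conv m f x * T x))"
    proof (rule Fubini_swap_count_space[OF sigma_finite_lborel])
      have "(\<integral>\<^sup>+x. \<integral>\<^sup>+m. ennreal (norm (kern k (w - x) * (conv m f x * T x))) \<partial>count_space UNIV \<partial>lborel)
        = (\<integral>\<^sup>+x. \<integral>\<^sup>+m. ennreal (norm (kern 0 (w - x))) * ennreal (norm (T x)) * F m x \<partial>count_space UNIV \<partial>lborel)"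
        by (simp add: norm_mult ennreal_mult norm_kern[of k] F_def mult_ac)
      also have "\<dots> = (\<integral>\<^sup>+x. ennreal (norm (kern 0 (w - x))) * ennreal (norm (T x)) * U x \<partial>lborel)"
        unfolding U_def by (intro nn_integral_cong nn_integral_cmult) auto
      also have "\<dots> \<le> ncv (\<lambda>x. U x * V x) w"
        unfolding ncv_def by (intro nn_integral_mono) (simp add: mult.assoc mult.commute[of "U _"] mult_left_mono mult_right_mono TV)
      finally show "(\<integral>\<^sup>+x. \<integral>\<^sup>+m. ennreal (norm (kern k (w - x) * (conv m f x * T x))) \<partial>count_space UNIV \<partial>lborel) < \<infinity>"
        using elim by (rule le_less_trans)
    qed measurable
    finally have "ennreal (norm (conv k (\<lambda>x. f x * g x) w)) \<le> (\<integral>\<^sup>+m. ennreal (norm (LINT x|lborel. kern k (w - x) * (conv m f x * T x))) \<partial>count_space UNIV)"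
      by (simp only: norm_integral_le_nn)
    also have "\<dots> \<le> (\<integral>\<^sup>+m. \<integral>\<^sup>+l. N m l w \<partial>count_space UNIV \<partial>count_space UNIV)"
    proof (rule nn_integral_mono)
      fix m
      have "(LINT x|lborel. kern k (w - x) * (conv m f x * T x)) = (LINT x|lborel. LINT l|count_space UNIV. kern k (w - x) * (conv m f x * conv l g x))"
        by (simp add: T_def)
      also have "\<dots> = (LINT l|count_space UNIV. LINT x|lborel. kern k (w - x) * (conv m f x * conv l g x))"
      proof (rule Fubini_swap_count_space[OF sigma_finite_lborel])
        have "(\<integral>\<^sup>+x. \<integral>\<^sup>+l. ennreal (norm (kern k (w - x) * (conv m f x * conv l g x))) \<partial>count_space UNIV \<partial>lborel)
          = (\<integral>\<^sup>+x. \<integral>\<^sup>+l. ennreal (norm (kern 0 (w - x))) * F m x * G l x \<partial>count_space UNIV \<partial>lborel)"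
          by (simp add: norm_mult ennreal_mult norm_kern[of k] F_def G_def mult_ac)
        also have "\<dots> = (\<integral>\<^sup>+x. ennreal (norm (kern 0 (w - x))) * F m x * V x \<partial>lborel)"
          unfolding V_def by (intro nn_integral_cong nn_integral_cmult) auto
        also have "\<dots> \<le> ncv (\<lambda>x. U x * V x) w"
          unfolding ncv_def by (intro nn_integral_mono) (simp add: mult.assoc mult_left_mono mult_right_mono FU)
        finally show "(\<integral>\<^sup>+x. \<integral>\<^sup>+l. ennreal (norm (kern k (w - x) * (conv m f x * conv l g x))) \<partial>count_space UNIV \<partial>lborel) < \<infinity>"
          using elim by (rule le_less_trans)
      qed measurable
      finally have "ennreal (norm (LINT x|lborel. kern k (w - x) * (conv m f x * T x)))
        \<le> (\<integral>\<^sup>+l. ennreal (norm (LINT x|lborel. kern k (w - x) * (conv m f x * conv l g x))) \<partial>count_space UNIV)"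
        by (simp only: norm_integral_le_nn)
      also have "\<dots> \<le> (\<integral>\<^sup>+l. N m l w \<partial>count_space UNIV)"
      proof (rule nn_integral_mono)
        fix l
        show "ennreal (norm (LINT x|lborel. kern k (w - x) * (conv m f x * conv l g x))) \<le> N m l w"
        proof (cases "close k m l")
          case True
          have "ennreal (norm (LINT x|lborel. kern k (w - x) * (conv m f x * conv l g x)))
            \<le> (\<integral>\<^sup>+x. ennreal (norm (kern k (w - x) * (conv m f x * conv l g x))) \<partial>lborel)"
            by (rule norm_integral_le_nn)
          also have "\<dots> = N m l w"
            using True by (simp add: N_def ncv_def norm_mult ennreal_mult norm_kern[of k] F_def G_def)
          finally show ?thesis .
        next
          case False
          then obtain i where "\<not> \<bar>k $ i - m $ i - l $ i\<bar> \<le> 3" by (auto simp: close_def)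
          then have "3 < \<bar>of_int (k $ i) - of_int (m $ i) - of_int (l $ i) :: real\<bar>" by linarith
          from conv_mult_zero[OF f g p(1,2) this] show ?thesis by simp
        qed
      qed
      finally show "ennreal (norm (LINT x|lborel. kern k (w - x) * (conv m f x * T x))) \<le> (\<integral>\<^sup>+l. N m l w \<partial>count_space UNIV)" .
    qed
    finally show ?case .
  qed
  then have "eLp lborel p (\<lambda>x. ennreal (norm (conv k (\<lambda>x. f x * g x) x)))
     \<le> eLp lborel p (\<lambda>w. \<integral>\<^sup>+m. \<integral>\<^sup>+l. N m l w \<partial>count_space UNIV \<partial>count_space UNIV)"
    by (intro eLp_mono_AE p(3)) measurable
  also have "\<dots> \<le> (\<integral>\<^sup>+m. eLp lborel p (\<lambda>w. \<integral>\<^sup>+l. N m l w \<partial>count_space UNIV) \<partial>count_space UNIV)"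
    by (intro eLp_minkowski_series sigma_finite_lborel p(3)) measurable
  also have "\<dots> \<le> (\<integral>\<^sup>+m. \<integral>\<^sup>+l. eLp lborel p (N m l) \<partial>count_space UNIV \<partial>count_space UNIV)"
    by (intro nn_integral_mono eLp_minkowski_series sigma_finite_lborel p(3)) measurable
  also have "\<dots> \<le> (\<integral>\<^sup>+m. \<integral>\<^sup>+l. of_bool (close k m l) * (kern_mass * (eLp lborel p1 (F m) * eLp lborel p2 (G l))) \<partial>count_space UNIV \<partial>count_space UNIV)"
  proof (intro nn_integral_mono)
    fix m l
    have "eLp lborel p (N m l) \<le> of_bool (close k m l) * eLp lborel p (ncv (\<lambda>x. F m x * G l x))"
      unfolding N_def[abs_def] by (rule eLp_cmult[OF _ p(3)]) measurable
    also have "\<dots> \<le> of_bool (close k m l) * (kern_mass * eLp lborel p (\<lambda>x. F m x * G l x))"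
      by (intro mult_left_mono eLp_ncv_le p(3)) auto
    also have "\<dots> \<le> of_bool (close k m l) * (kern_mass * (eLp lborel p1 (F m) * eLp lborel p2 (G l)))"
      using p by (intro mult_left_mono eLp_holder) auto
    finally show "eLp lborel p (N m l) \<le> of_bool (close k m l) * (kern_mass * (eLp lborel p1 (F m) * eLp lborel p2 (G l)))" .
  qed
  finally show ?thesis by (simp only: F_def[abs_def] G_def[abs_def])
qed

end

subsection \<open>Lattice sums and the weight\<close>

text \<open>\<open>UM_norm\<close> is stated with \<open>infsum\<close>, the norm estimates with
  integrals for the counting measure. The sets of elements numbered below \<open>n\<close> are
  finite and exhaust the countable index type, so monotone convergence identifies the integral with
  the supremum of the finite sums.\<close>

lemma infsum_ennreal_eq_nn_integral:
  fixes f :: "'i::countable \<Rightarrow> ennreal"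
  shows "infsum f UNIV = (\<integral>\<^sup>+k. f k \<partial>count_space UNIV)"
proof (rule antisym)
  have fin: "(\<integral>\<^sup>+k. f k * indicator F k \<partial>count_space UNIV) = sum f F" if "finite F" for F
    using that by (simp add: nn_integral_count_space_indicator[symmetric] nn_integral_count_space_finite)
  have inf: "infsum f UNIV = (SUP F\<in>{F. finite F \<and> F \<subseteq> UNIV}. sum f F)"
    by (rule nonneg_infsum_complete) simp
  show "infsum f UNIV \<le> (\<integral>\<^sup>+k. f k \<partial>count_space UNIV)"
    unfolding inf
  proof (rule SUP_least)
    fix F :: "'i set" assume "F \<in> {F. finite F \<and> F \<subseteq> UNIV}"
    then have "sum f F = (\<integral>\<^sup>+k. f k * indicator F k \<partial>count_space UNIV)" using fin by simp
    also have "\<dots> \<le> (\<integral>\<^sup>+k. f k \<partial>count_space UNIV)" by (intro nn_integral_mono) (auto simp: indicator_def)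
    finally show "sum f F \<le> (\<integral>\<^sup>+k. f k \<partial>count_space UNIV)" .
  qed
  define F where "F n = {k :: 'i. to_nat k < n}" for n
  have F: "finite (F n)" for n
    unfolding F_def by (rule finite_imageD[of to_nat]) (auto intro: finite_subset[of _ "{..<n}"] inj_on_subset[OF inj_to_nat])
  have "(\<integral>\<^sup>+k. f k \<partial>count_space UNIV) = (\<integral>\<^sup>+k. (SUP n. f k * indicator (F n) k) \<partial>count_space UNIV)"
  proof (intro nn_integral_cong antisym)
    fix k
    have "f k = f k * indicator (F (Suc (to_nat k))) k" by (simp add: F_def)
    also have "\<dots> \<le> (SUP n. f k * indicator (F n) k)" by (rule SUP_upper) simp
    finally show "f k \<le> (SUP n. f k * indicator (F n) k)" .
    show "(SUP n. f k * indicator (F n) k) \<le> f k" by (intro SUP_least) (auto simp: indicator_def)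
  qed
  also have "\<dots> = (SUP n. \<integral>\<^sup>+k. f k * indicator (F n) k \<partial>count_space UNIV)"
    by (rule nn_integral_monotone_convergence_SUP) (auto simp: incseq_def le_fun_def indicator_def F_def)
  also have "\<dots> \<le> infsum f UNIV"
    unfolding inf fin[OF F] by (rule SUP_least) (auto intro: SUP_upper F)
  finally show "(\<integral>\<^sup>+k. f k \<partial>count_space UNIV) \<le> infsum f UNIV" .
qed

section \<open>Sequence norms on the lattice\<close>

lemma nn_integral_count_space_bij:
  assumes "bij f" shows "(\<integral>\<^sup>+i. g (f i) \<partial>count_space UNIV) = (\<integral>\<^sup>+i. g i \<partial>count_space UNIV)"
  using nn_integral_bij_count_space[OF assms, of g] by simp

lemma bij_diff_left: "bij (\<lambda>i. k - i :: 'a::ab_group_add)"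
  by (rule bij_betw_byWitness[of _ "\<lambda>i. k - i"]) auto

lemma eLp_count_space_reindex:
  assumes "bij f" "1 \<le> q"
  shows "eLp (count_space UNIV) q (\<lambda>k. u (f k)) = eLp (count_space UNIV) q u"
proof (cases "q = \<infinity>")
  case True
  have "eLp (count_space UNIV) q (\<lambda>k. u (f k)) \<le> c \<longleftrightarrow> eLp (count_space UNIV) q u \<le> c" for c
    using True bij_is_surj[OF assms(1)] by (auto simp: eLp_top_le_iff AE_count_space) (metis surjD)
  then show ?thesis by (metis order_antisym order_refl)
next
  case False
  then show ?thesis using nn_integral_count_space_bij[OF assms(1), of "\<lambda>k. ennpowr (u k) (enn2real q)"]
    by (simp add: eLp_def)
qed

lemma le_eLp_count_space:
  assumes "1 \<le> q" shows "u k \<le> eLp (count_space UNIV) q u"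
proof (cases "q = \<infinity>")
  case True
  have "AE k in count_space UNIV. u k \<le> eLp (count_space UNIV) q u"
    using eLp_top_le_iff[of u "count_space UNIV" "eLp (count_space UNIV) q u"] True by simp
  then show ?thesis by (simp add: AE_count_space)
next
  case False
  have q: "1 \<le> enn2real q" by (rule enn2real_ge_1[OF assms False])
  have "ennpowr (u k) (enn2real q) \<le> (\<integral>\<^sup>+k. ennpowr (u k) (enn2real q) \<partial>count_space UNIV)"
    by (rule nn_integral_member_le)
  then have "ennpowr (ennpowr (u k) (enn2real q)) (1 / enn2real q) \<le> eLp (count_space UNIV) q u"
    using q False by (simp add: eLp_def) (intro ennpowr_mono, auto)
  then show ?thesis using q by (simp add: ennpowr_ennpowr)
qed

section \<open>The bracket and the logarithmic weight\<close>

lemma jbracket_ge: "exp (exp 1) \<le> jbracket x" "norm x \<le> jbracket x" "1 + (norm x)\<^sup>2 \<le> (jbracket x)\<^sup>2"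
proof -
  have "exp (exp 1) = sqrt ((exp (exp 1))\<^sup>2)" by simp
  also have "(exp (exp 1))\<^sup>2 = exp (2 * exp 1 :: real)" by (simp add: exp_double)
  also have "sqrt \<dots> \<le> jbracket x" unfolding jbracket_def by (intro real_sqrt_le_mono) simp
  finally show "exp (exp 1) \<le> jbracket x" .
  have "sqrt ((norm x)\<^sup>2) \<le> jbracket x" unfolding jbracket_def by (intro real_sqrt_le_mono) simp
  then show "norm x \<le> jbracket x" by simp
  have "(jbracket x)\<^sup>2 = exp (2 * exp 1) + (norm x)\<^sup>2"
    unfolding jbracket_def by (rule real_sqrt_pow2) (simp add: add_nonneg_nonneg)
  moreover have "(1::real) \<le> exp (2 * exp 1)" by simp
  ultimately show "1 + (norm x)\<^sup>2 \<le> (jbracket x)\<^sup>2" by linarith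
qed

lemma jbracket_gt_1: "1 < jbracket x" and ln_jbracket_ge_1: "1 \<le> ln (jbracket x)" and ln_ln_jbracket_nonneg: "0 \<le> ln (ln (jbracket x))"
proof -
  have "(1::real) < exp (exp 1)" by simp
  then show "1 < jbracket x" using jbracket_ge(1)[of x] by linarith
  then have "exp 1 \<le> ln (jbracket x)" using jbracket_ge(1)[of x] by (subst ln_ge_iff) auto
  moreover have "(1::real) \<le> exp 1" by simp
  ultimately show "1 \<le> ln (jbracket x)" by linarith
  then show "0 \<le> ln (ln (jbracket x))" by simp
qed

text \<open>The function \<open>sqrt (c + r\<^sup>2)\<close> with \<open>c > 0\<close> has
  derivative at most 1 in modulus.\<close>

lemma jbracket_le:
  fixes x z :: "real^'n::finite"
  assumes "norm z \<le> norm x + s" "0 \<le> s"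
  shows "jbracket z \<le> jbracket x + s"
proof (rule power2_le_imp_le)
  have sq: "(jbracket y)\<^sup>2 = exp (2 * exp 1) + (norm y)\<^sup>2" for y :: "real^'n"
    unfolding jbracket_def by (rule real_sqrt_pow2) (simp add: add_nonneg_nonneg)
  have "(norm z)\<^sup>2 \<le> (norm x + s)\<^sup>2" using assms by (intro power_mono) auto
  moreover have "norm x * s \<le> jbracket x * s" using jbracket_ge(2) assms by (intro mult_right_mono) auto
  ultimately show "(jbracket z)\<^sup>2 \<le> (jbracket x + s)\<^sup>2"
    unfolding power2_sum sq by simp
  show "0 \<le> jbracket x + s" using jbracket_gt_1[of x] assms by linarith
qed

text \<open>Multiply \<open>ln (a + d) \<le> ln a + d / a\<close> by \<open>a + d\<close>; since
  \<open>a \<ge> 1\<close>, the quadratic remainder is at most \<open>d * d\<close>.\<close>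

lemma xlnx_add_le:
  fixes a d :: real
  assumes "1 \<le> a" "0 \<le> d"
  shows "(a + d) * ln (a + d) \<le> a * ln a + d * (1 + d + ln a)"
proof -
  have "a + d = a * (1 + d / a)" using assms by (simp add: field_simps)
  then have "ln (a + d) = ln (a * (1 + d / a))" by simp
  also have "\<dots> = ln a + ln (1 + d / a)" using assms by (subst ln_mult_pos) (auto simp: add_pos_nonneg)
  also have "ln (1 + d / a) \<le> d / a" using assms by (intro ln_add_one_self_le_self) auto
  finally have le: "ln (a + d) \<le> ln a + d / a" by simp
  have "d / a \<le> d" using assms by (simp add: divide_le_eq mult_le_cancel_left1)
  then have "d * ln (a + d) \<le> d * (ln a + d)" using le assms by (intro mult_left_mono) auto
  moreover have "a * ln (a + d) \<le> a * (ln a + d / a)" using le assms by (intro mult_left_mono) auto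
  moreover have "a * (ln a + d / a) = a * ln a + d" using assms by (simp add: field_simps)
  ultimately show ?thesis by (simp add: algebra_simps)
qed

text \<open>Either \<open>ln b \<ge> K\<close>, or \<open>b \<le> exp K\<close> and the constant
  covers the left side. With \<open>b\<close> the logarithm of the bracket this says that the
  exponential of the weight outgrows the power \<open>K\<close> of the bracket.\<close>

lemma linear_le_xlnx:
  fixes b K :: real
  assumes "1 \<le> b" "0 \<le> K"
  shows "K * b \<le> b * ln b + K * exp K"
proof (cases "K \<le> ln b")
  case True
  then have "b * K \<le> b * ln b" using assms by (intro mult_left_mono) auto
  moreover have "0 \<le> K * exp K" using assms by simp
  ultimately show ?thesis by (simp add: mult.commute)
next
  case False
  then have "b \<le> exp K" using assms by (metis exp_le_cancel_iff exp_ln less_eq_real_def linorder_not_le order_less_le_trans zero_less_one)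
  then have "K * b \<le> K * exp K" using assms by (intro mult_left_mono) auto
  moreover have "0 \<le> b * ln b" using assms by simp
  ultimately show ?thesis by linarith
qed

definition weight :: "int^'n::finite \<Rightarrow> real" where
  "weight k = ln (jbracket (lattice_pt k)) * ln (ln (jbracket (lattice_pt k)))"

lemma weight_ge:
  fixes k :: "int^'n::finite"
  assumes "0 \<le> K"
  shows "K * ln (jbracket (lattice_pt k)) - K * exp K \<le> weight k"
  using linear_le_xlnx[OF ln_jbracket_ge_1 assms, of "lattice_pt k"] by (simp add: weight_def)

text \<open>The smaller of the two frequencies pays for the defect: \<open>t ln t\<close> grows by at most
  \<open>d (1 + d + ln t)\<close> with \<open>d\<close> of order \<open><l>/<m>\<close>, which costs only \<open>O(ln ln <l>)\<close>.\<close>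

lemma weight_subadditive:
  fixes k m l :: "int^'n::finite"
  assumes ml: "norm (lattice_pt l) \<le> norm (lattice_pt m)"
    and s: "norm (lattice_pt k) \<le> norm (lattice_pt m) + norm (lattice_pt l) + s" "0 \<le> s" and N: "0 \<le> N"
  shows "weight k \<le> weight m + weight l - N * ln (jbracket (lattice_pt l))
    + ((1 + s) * (3 + s) + (N + 1 + s) * exp (N + 1 + s))"
proof -
  define X M L r where "X = jbracket (lattice_pt k)" and "M = jbracket (lattice_pt m)"
    and "L = jbracket (lattice_pt l)" and "r = 1 + s"
  have pos: "1 < X" "1 < M" "1 < L" "1 \<le> ln X" "1 \<le> ln M" "1 \<le> ln L" "0 \<le> ln (ln L)" "0 \<le> ln (ln M)"
    unfolding X_def M_def L_def by (simp_all add: jbracket_gt_1 ln_jbracket_ge_1 ln_ln_jbracket_nonneg)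
  have r: "1 \<le> r" using s by (simp add: r_def)
  have LM: "L \<le> M" unfolding L_def M_def jbracket_def
    using ml by (intro real_sqrt_le_mono add_left_mono power_mono) auto
  have "X \<le> M + (norm (lattice_pt l) + s)"
    unfolding X_def M_def by (rule jbracket_le) (use s in auto)
  also have "norm (lattice_pt l) \<le> L" unfolding L_def by (rule jbracket_ge)
  \<comment> \<open>As \<open>L \<ge> 1\<close>, the slack \<open>s\<close> is absorbed into the
    factor \<open>r = 1 + s\<close>.\<close>
  also have "L + s \<le> r * L" using mult_left_mono[of 1 L s] s pos by (simp add: r_def algebra_simps)
  finally have XM: "X \<le> M + r * L" by simp
  \<comment> \<open>\<open>d\<close> bounds the increase from \<open>ln M\<close> to
    \<open>ln X\<close>. It is at most \<open>r\<close> because \<open>L \<le> M\<close>, and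
    \<open>d * (M / L) = r\<close> will cancel the ratio that appears below.\<close>
  define d where "d = r * L / M"
  have d: "0 \<le> d" "d \<le> r" using r pos LM by (auto simp: d_def divide_le_eq)
  have "ln X \<le> ln (M + r * L)" using XM pos by (subst ln_le_cancel_iff) auto
  also have "M + r * L = M * (1 + d)" using pos by (simp add: d_def field_simps)
  also have "ln \<dots> = ln M + ln (1 + d)" using pos d by (subst ln_mult) auto
  also have "ln (1 + d) \<le> d" using d(1) by (rule ln_add_one_self_le_self)
  finally have lnX: "ln X \<le> ln M + d" by simp
  have "weight k = ln X * ln (ln X)" by (simp add: weight_def X_def)
  also have "\<dots> \<le> (ln M + d) * ln (ln M + d)" using lnX pos d by (intro mult_mono) auto
  also have "\<dots> \<le> ln M * ln (ln M) + d * (1 + d + ln (ln M))" by (rule xlnx_add_le) (use pos d in auto)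
  also have "ln M * ln (ln M) = weight m" by (simp add: weight_def M_def)
  finally have 1: "weight k \<le> weight m + d * (1 + d) + d * ln (ln M)" by (simp add: algebra_simps)
  have 2: "d * (1 + d) \<le> r * (1 + r)" using d by (intro mult_mono) auto
  \<comment> \<open>Shifts the iterated logarithm from the larger bracket to the smaller one. The
    error \<open>M / L\<close> is tolerable because it gets multiplied by \<open>d\<close>.\<close>
  have "ln (ln M) \<le> ln (ln L) + M / L"
  proof -
    have "ln M = ln L + ln (M / L)" using pos by (simp add: ln_div)
    moreover have "0 \<le> ln (M / L)" using LM pos by simp
    moreover have "ln (M / L) \<le> M / L" using pos by (intro ln_bound) auto
    ultimately have LL: "ln M \<le> ln L + M / L" and q: "0 \<le> M / L" using pos by auto
    have "ln (ln M) \<le> ln (ln L + M / L)" using LL pos by (subst ln_le_cancel_iff) auto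
    also have "ln L + M / L = ln L * (1 + M / L / ln L)" using pos by (simp add: field_simps)
    also have "ln \<dots> = ln (ln L) + ln (1 + M / L / ln L)" using pos q by (subst ln_mult_pos) (auto simp: add_pos_nonneg)
    also have "ln (1 + M / L / ln L) \<le> M / L / ln L" using pos q by (intro ln_add_one_self_le_self) auto
    also have "M / L / ln L \<le> M / L" using divide_left_mono[of 1 "ln L" "M / L"] pos q by simp
    finally show ?thesis by simp
  qed
  then have "d * ln (ln M) \<le> d * ln (ln L) + d * (M / L)" using d by (metis distrib_left mult_left_mono)
  also have "d * (M / L) = r" using pos by (simp add: d_def)
  also have "d * ln (ln L) \<le> r * ln (ln L)" using d pos by (intro mult_right_mono) auto
  also have "ln (ln L) \<le> ln L" using pos by (intro ln_bound) auto
  finally have 3: "d * ln (ln M) \<le> r * ln L + r" using r by (simp add: mult_left_mono)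
  \<comment> \<open>A multiple \<open>N + r\<close> of \<open>ln L\<close> is taken out of
    \<open>weight l\<close>: the part \<open>r\<close> pays for the term in \<open>3\<close>, and
    the part \<open>N\<close> is the gain.\<close>
  have 4: "(N + r) * ln L \<le> weight l + (N + r) * exp (N + r)"
    using weight_ge[of "N + r" l] N r by (simp add: L_def)
  have "weight k \<le> weight m + weight l - N * ln L + (r * (2 + r) + (N + r) * exp (N + r))"
    using 1 2 3 4 by (simp add: algebra_simps)
  then show ?thesis by (simp add: r_def L_def add.assoc)
qed

text \<open>Comparison with the integral over the open unit cubes with a corner at the lattice
  points: on each cube \<open>decay\<close> varies by at most a factor 3 per coordinate, and a point
  lies in at most one cube.\<close>

lemma summable_decay_lattice: "(\<integral>\<^sup>+l. ennreal (decay (lattice_pt (l :: int^'n::finite))) \<partial>count_space UNIV) < \<infinity>"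
proof -
  define Q where "Q l = box (lattice_pt l) (lattice_pt l + (\<chi> i. 1))" for l :: "int^'n"
  have Q: "x \<in> Q l \<longleftrightarrow> (\<forall>i. of_int (l $ i) < x $ i \<and> x $ i < of_int (l $ i) + 1)" for x l
    by (simp add: Q_def mem_box_cart)
  have [measurable]: "Q l \<in> sets borel" for l by (simp add: Q_def)
  have Q1: "emeasure lborel (Q l) = 1" for l
  proof -
    have "emeasure lborel (Q l) = (\<Prod>b\<in>(Basis :: (real^'n) set). 1)"
      unfolding Q_def by (subst emeasure_lborel_box) (auto simp: Basis_vec_def inner_axis intro!: prod.neutral)
    then show ?thesis by simp
  qed
  let ?C = "3 ^ DIM(real^'n) :: real"
  have le: "decay (lattice_pt l) \<le> ?C * decay x" if "x \<in> Q l" for l x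
  proof -
    have "decay (lattice_pt l) = (\<Prod>i\<in>UNIV. 1 / (1 + (of_int (l $ i))\<^sup>2))"
      unfolding decay_def using prod_Basis_vec[of "\<lambda>t. 1 / (1 + t\<^sup>2)" "lattice_pt l"] by simp
    also have "\<dots> \<le> (\<Prod>i\<in>UNIV. 3 * (1 / (1 + (x $ i)\<^sup>2)))"
    proof (intro prod_mono conjI)
      fix i
      have x: "of_int (l $ i) < x $ i" "x $ i < of_int (l $ i) + 1" using that by (auto simp: Q)
      \<comment> \<open>The factor 3: from \<open>\<bar>x $ i\<bar> \<le> \<bar>t\<bar> + 1\<close>
        follows that the square of \<open>x $ i\<close> is at most \<open>2 * t\<^sup>2 + 2\<close>,
        and adding 1 stays below \<open>3 * (1 + t\<^sup>2)\<close>.\<close>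
      define t where "t = (of_int (l $ i) :: real)"
      have "(x $ i)\<^sup>2 \<le> (\<bar>t\<bar> + 1)\<^sup>2" using x by (intro abs_le_square_iff[THEN iffD1]) (auto simp: t_def abs_if)
      also have "\<dots> \<le> 2 * t\<^sup>2 + 2"
        using zero_le_power2[of "\<bar>t\<bar> - 1"] by (simp add: power2_eq_square algebra_simps)
      finally have "1 + (x $ i)\<^sup>2 \<le> 3 * (1 + t\<^sup>2)" using zero_le_power2[of t] by (smt (verit))
      moreover have "0 < 1 + (x $ i)\<^sup>2" "0 < 1 + t\<^sup>2" by (simp_all add: add_pos_nonneg)
      ultimately show "1 / (1 + (of_int (l $ i))\<^sup>2) \<le> 3 * (1 / (1 + (x $ i)\<^sup>2))"
        unfolding t_def[symmetric] by (simp add: field_simps)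
    qed auto
    also have "\<dots> = ?C * decay x"
      unfolding decay_def using prod_Basis_vec[of "\<lambda>t. 1 / (1 + t\<^sup>2)" x] by (simp only: prod.distrib) simp
    finally show ?thesis .
  qed
  have "(\<integral>\<^sup>+l. ennreal (decay (lattice_pt (l :: int^'n))) \<partial>count_space UNIV) = (\<integral>\<^sup>+l. \<integral>\<^sup>+x. ennreal (decay (lattice_pt l)) * indicator (Q l) x \<partial>lborel \<partial>count_space UNIV)"
    by (simp add: nn_integral_cmult_indicator Q1)
  also have "\<dots> \<le> (\<integral>\<^sup>+l. \<integral>\<^sup>+x. ennreal (?C * decay x) * indicator (Q l) x \<partial>lborel \<partial>count_space UNIV)"
    using le by (intro nn_integral_mono) (auto simp: indicator_def intro!: ennreal_leI)
  also have "\<dots> = (\<integral>\<^sup>+x. \<integral>\<^sup>+l. ennreal (?C * decay x) * indicator (Q l) x \<partial>count_space UNIV \<partial>lborel)"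
    by (rule nn_integral_count_space_nn_integral[symmetric]) auto
  also have "\<dots> \<le> (\<integral>\<^sup>+x. ennreal (?C * decay (x :: real^'n)) \<partial>lborel)"
  proof (rule nn_integral_mono)
    fix x :: "real^'n"
    have "l = (\<chi> i. \<lfloor>x $ i\<rfloor>)" if "x \<in> Q l" for l
    proof (rule vec_eq_iff[THEN iffD2], rule allI)
      fix i show "l $ i = (\<chi> i. \<lfloor>x $ i\<rfloor>) $ i" using that floor_unique[of "l $ i" "x $ i"] by (auto simp: Q less_imp_le)
    qed
    then have "indicator (Q l) x \<le> (indicator {\<chi> i. \<lfloor>x $ i\<rfloor>} l :: ennreal)" for l
      by (auto simp: indicator_def)
    then have "(\<integral>\<^sup>+l. ennreal (?C * decay x) * indicator (Q l) x \<partial>count_space UNIV) \<le> (\<integral>\<^sup>+l. ennreal (?C * decay x) * indicator {\<chi> i. \<lfloor>x $ i\<rfloor>} l \<partial>count_space UNIV)"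
      by (intro nn_integral_mono mult_left_mono) auto
    also have "\<dots> = ennreal (?C * decay x)" by (simp add: nn_integral_cmult_indicator)
    finally show "(\<integral>\<^sup>+l. ennreal (?C * decay x) * indicator (Q l) x \<partial>count_space UNIV) \<le> ennreal (?C * decay x)" .
  qed
  also have "\<dots> < \<infinity>"
    by (subst nn_integral_eq_integral)
       (auto intro!: integrable_mult_right integrable_decay simp: decay_pos less_imp_le)
  finally show ?thesis .
qed

text \<open>The bracket to the power \<open>- 2 * CARD('n)\<close>, in exponential form because it
  is combined with exponentials of the weight.\<close>

definition small :: "int^'n::finite \<Rightarrow> real" where
  "small l = exp (- (2 * real CARD('n)) * ln (jbracket (lattice_pt l)))"

text \<open>Distribute the \<open>CARD('n)\<close> factors, each the inverse square of the bracket,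
  over the coordinates: the square of the bracket exceeds 1 plus the square of any single
  coordinate.\<close>

lemma summable_small: "(\<integral>\<^sup>+l. ennreal (small (l :: int^'n::finite)) \<partial>count_space UNIV) < \<infinity>"
proof -
  have "small l \<le> decay (lattice_pt l)" for l :: "int^'n"
  proof -
    let ?x = "lattice_pt l"
    have J: "0 < jbracket ?x" using jbracket_gt_1[of ?x] by linarith
    have "small l = (\<Prod>i\<in>(UNIV::'n set). 1 / (jbracket ?x)\<^sup>2)"
    proof -
      have "small l = (jbracket ?x powr - real (2 * CARD('n)))"
        using J by (simp add: small_def powr_def)
      also have "\<dots> = 1 / jbracket ?x ^ (2 * CARD('n))"
        using J by (simp only: powr_minus powr_realpow inverse_eq_divide)
      finally show ?thesis by (simp add: power_mult power_one_over)
    qed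
    also have "\<dots> \<le> (\<Prod>i\<in>UNIV. 1 / (1 + (?x $ i)\<^sup>2))"
    proof (intro prod_mono conjI)
      fix i
      have "(?x $ i)\<^sup>2 \<le> (norm ?x)\<^sup>2"
        using component_le_norm_cart[of ?x i] by (metis abs_le_square_iff abs_norm_cancel)
      then have "1 + (?x $ i)\<^sup>2 \<le> (jbracket ?x)\<^sup>2" using jbracket_ge(3)[of ?x] by linarith
      then show "1 / (jbracket ?x)\<^sup>2 \<le> 1 / (1 + (?x $ i)\<^sup>2)" using J
        by (intro divide_left_mono) (auto intro!: mult_pos_pos add_pos_nonneg)
    qed auto
    also have "\<dots> = decay ?x"
      unfolding decay_def using prod_Basis_vec[of "\<lambda>t. 1 / (1 + t\<^sup>2)" ?x] by simp
    finally show ?thesis .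
  qed
  then have "(\<integral>\<^sup>+l. ennreal (small (l :: int^'n)) \<partial>count_space UNIV) \<le> (\<integral>\<^sup>+l. ennreal (decay (lattice_pt (l :: int^'n))) \<partial>count_space UNIV)"
    by (intro nn_integral_mono ennreal_leI)
  then show ?thesis using summable_decay_lattice by (rule le_less_trans)
qed

subsection \<open>The bilinear estimate\<close>

context window
begin

lemma close_commute: "close k m l = close k l m"
  by (auto simp: close_def algebra_simps)

lemma close_shift: "close k (k - i) l = close i l 0"
  by (simp add: close_def)

text \<open>In value \<open>7 ^ CARD('n)\<close>: seven admissible integers in each
  coordinate.\<close>

definition close_count :: ennreal where
  "close_count = (\<integral>\<^sup>+j. of_bool (close j 0 (0 :: int^'n)) \<partial>count_space UNIV)"

lemma close_count_finite: "close_count < \<infinity>"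
proof -
  have "finite {j :: int^'n. \<forall>i. j $ i \<in> {-3..3}}" by (rule finite_int_vec) simp
  then have "finite {j. close j 0 (0 :: int^'n)}" by (rule rev_finite_subset) (auto simp: close_def abs_le_iff minus_le_iff)
  then have "finite {j. (0::ennreal) < of_bool (close j 0 (0 :: int^'n))}" by simp
  then show ?thesis unfolding close_count_def by (subst nn_integral_count_space) (auto simp: less_top[symmetric])
qed

lemma nn_integral_close: "(\<integral>\<^sup>+i. of_bool (close i l (0 :: int^'n)) \<partial>count_space UNIV) = close_count"
  "(\<integral>\<^sup>+i. of_bool (close l i (0 :: int^'n)) \<partial>count_space UNIV) = close_count"
proof -
  have "bij (\<lambda>i. i + l)" by (rule bij_betw_byWitness[of _ "\<lambda>i. i - l"]) auto
  from nn_integral_count_space_bij[OF this, of "\<lambda>i. of_bool (close i l 0)"]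
  show "(\<integral>\<^sup>+i. of_bool (close i l (0 :: int^'n)) \<partial>count_space UNIV) = close_count"
    by (simp add: close_count_def close_def)
  from nn_integral_count_space_bij[OF bij_diff_left[of l], of "\<lambda>i. of_bool (close l i 0)"]
  show "(\<integral>\<^sup>+i. of_bool (close l i (0 :: int^'n)) \<partial>count_space UNIV) = close_count"
    by (simp add: close_count_def close_def)
qed

definition lattice_mass :: ennreal where
  "lattice_mass = (\<integral>\<^sup>+l. ennreal (small (l :: int^'n)) \<partial>count_space UNIV) * close_count"

lemma lattice_mass_finite: "lattice_mass < \<infinity>"
  using summable_small[where 'n = 'n] close_count_finite by (simp add: lattice_mass_def ennreal_mult_less_top)

text \<open>Substituting \<open>m = k - i\<close> exhibits the double sum as the lattice convolution
  of \<open>u\<close> with the kernel \<open>\<kappa> i\<close>, the sum of \<open>small l\<close>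
  over the \<open>l\<close> close to \<open>i\<close>. Summing over \<open>i\<close> before
  \<open>l\<close> counts every \<open>l\<close> exactly \<open>close_count\<close> times and gives
  the mass of the kernel.\<close>

lemma lattice_young:
  assumes q: "1 \<le> q"
  shows "eLp (count_space UNIV) q (\<lambda>k. \<integral>\<^sup>+m. \<integral>\<^sup>+l. of_bool (close k m l) * (ennreal (small l) * u m) \<partial>count_space UNIV \<partial>count_space UNIV)
    \<le> lattice_mass * eLp (count_space UNIV) q u"
proof -
  define \<kappa> where "\<kappa> i = (\<integral>\<^sup>+l. of_bool (close i l 0) * ennreal (small l) \<partial>count_space UNIV)" for i :: "int^'n"
  have mass: "(\<integral>\<^sup>+i. \<kappa> i \<partial>count_space UNIV) = lattice_mass"
  proof -
    have "(\<integral>\<^sup>+i. \<kappa> i \<partial>count_space UNIV) = (\<integral>\<^sup>+l. \<integral>\<^sup>+i. of_bool (close i l 0) * ennreal (small l) \<partial>count_space UNIV \<partial>count_space UNIV)"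
      unfolding \<kappa>_def by (rule nn_integral_count_space_nn_integral) auto
    also have "\<dots> = (\<integral>\<^sup>+l. close_count * ennreal (small (l :: int^'n)) \<partial>count_space UNIV)"
      by (subst nn_integral_multc) (auto simp: nn_integral_close)
    also have "\<dots> = lattice_mass" by (subst nn_integral_cmult) (auto simp: lattice_mass_def mult.commute)
    finally show ?thesis .
  qed
  have "(\<integral>\<^sup>+m. \<integral>\<^sup>+l. of_bool (close k m l) * (ennreal (small l) * u m) \<partial>count_space UNIV \<partial>count_space UNIV)
    = (\<integral>\<^sup>+i. \<kappa> i * u (k - i) \<partial>count_space UNIV)" for k
  proof -
    have "(\<integral>\<^sup>+m. \<integral>\<^sup>+l. of_bool (close k m l) * (ennreal (small l) * u m) \<partial>count_space UNIV \<partial>count_space UNIV)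
      = (\<integral>\<^sup>+i. \<integral>\<^sup>+l. of_bool (close k (k - i) l) * (ennreal (small l) * u (k - i)) \<partial>count_space UNIV \<partial>count_space UNIV)"
      by (rule nn_integral_count_space_bij[OF bij_diff_left, symmetric])
    also have "\<dots> = (\<integral>\<^sup>+i. \<kappa> i * u (k - i) \<partial>count_space UNIV)"
      unfolding \<kappa>_def by (subst nn_integral_multc[symmetric]) (auto simp: close_shift mult.assoc)
    finally show ?thesis .
  qed
  then have "eLp (count_space UNIV) q (\<lambda>k. \<integral>\<^sup>+m. \<integral>\<^sup>+l. of_bool (close k m l) * (ennreal (small l) * u m) \<partial>count_space UNIV \<partial>count_space UNIV)
    = eLp (count_space UNIV) q (\<lambda>k. \<integral>\<^sup>+i. \<kappa> i * u (k - i) \<partial>count_space UNIV)" by simp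
  also have "\<dots> \<le> (\<integral>\<^sup>+i. \<kappa> i \<partial>count_space UNIV) * eLp (count_space UNIV) q u"
  proof (rule eLp_minkowski_weighted[OF sigma_finite_measure_count_space sigma_finite_measure_count_space _ _ q])
    show "(\<lambda>(x, t). u (x - t)) \<in> borel_measurable (count_space UNIV \<Otimes>\<^sub>M count_space UNIV)"
      by (rule measurable_count_space_snd) simp
    fix t
    have "bij (\<lambda>k. k - t :: int^'n)" by (rule bij_betw_byWitness[of _ "\<lambda>i. i + t"]) auto
    from eLp_count_space_reindex[OF this q, of u]
    show "eLp (count_space UNIV) q (\<lambda>k. u (k - t)) \<le> eLp (count_space UNIV) q u" by simp
  qed (use lattice_mass_finite mass in auto)
  finally show ?thesis by (simp only: mass)
qed

text \<open>The exponent \<open>2 * CARD('n)\<close> makes \<^const>\<open>small\<close> summable; the slack \<open>3 * CARD('n)\<close> bounds the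
  distance of \<open>k\<close> from \<open>m + l\<close>.\<close>

definition weight_const :: real where
  "weight_const = (let n = real CARD('n); s = 3 * n; N = 2 * n in
     (1 + s) * (3 + s) + (N + 1 + s) * exp (N + 1 + s))"

text \<open>The gain belongs to the smaller of the two frequencies. Adding both possible gains gives
  a bound without case distinction, whose two terms can be summed separately over the whole
  lattice.\<close>

lemma weight_le_close:
  assumes "close k m (l :: int^'n)"
  shows "exp (weight k) \<le> exp weight_const * (exp (weight m) * exp (weight l) * (small l + small m))"
proof -
  have norm: "norm (lattice_pt k) \<le> norm (lattice_pt m) + norm (lattice_pt l) + 3 * real CARD('n)"
  proof -
    let ?d = "lattice_pt (k - m - l)"
    have "norm ?d \<le> (\<Sum>i\<in>(UNIV::'n set). 3)"
      by (rule order_trans[OF norm_le_l1_cart sum_mono])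
         (use assms in \<open>simp add: close_def flip: of_int_diff of_int_abs\<close>)
    moreover have "lattice_pt k = lattice_pt m + lattice_pt l + ?d" by (simp add: vec_eq_iff)
    moreover have "norm (lattice_pt m + lattice_pt l + ?d) \<le> norm (lattice_pt m) + norm (lattice_pt l) + norm ?d"
      by (meson norm_triangle_ineq norm_triangle_mono order_refl)
    ultimately show ?thesis by simp
  qed
  have *: "exp (weight k) \<le> exp weight_const * (exp (weight m) * exp (weight l) * small l)"
    if "norm (lattice_pt l) \<le> norm (lattice_pt m)" "norm (lattice_pt k) \<le> norm (lattice_pt m) + norm (lattice_pt l) + 3 * real CARD('n)"
    for m l :: "int^'n"
    using weight_subadditive[OF that, of "2 * real CARD('n)"]
    by (simp add: weight_const_def small_def Let_def exp_add[symmetric] mult_exp_exp algebra_simps)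
  have pos: "0 \<le> exp weight_const * (exp (weight m) * exp (weight l) * small l)" "0 \<le> exp weight_const * (exp (weight m) * exp (weight l) * small m)"
    by (simp_all add: small_def)
  show ?thesis
  proof (cases "norm (lattice_pt l) \<le> norm (lattice_pt m)")
    case True
    from *[OF True norm] pos show ?thesis by (simp add: distrib_left)
  next
    case False
    with *[of m l] norm pos show ?thesis by (simp add: distrib_left mult.commute[of "exp (weight l)"] add.commute)
  qed
qed

text \<open>A special case of the superpolynomial growth of the exponential weight, with the
  constant enlarged to \<open>weight_const\<close>. It makes the unweighted norms of the pieces
  summable.\<close>

lemma weight_inverse_le: "exp (- weight (k :: int^'n)) \<le> exp weight_const * small k"
proof -
  let ?K = "2 * real CARD('n)"
  have "?K * exp ?K \<le> weight_const"
  proof -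
    have "?K * exp ?K \<le> (?K + 1 + 3 * real CARD('n)) * exp (?K + 1 + 3 * real CARD('n))"
      by (intro mult_mono) auto
    then show ?thesis unfolding weight_const_def Let_def by (simp add: add_increasing)
  qed
  then have "- weight k \<le> weight_const + - ?K * ln (jbracket (lattice_pt k))"
    using weight_ge[of ?K k] by simp
  then show ?thesis unfolding small_def exp_add[symmetric] by simp
qed

section \<open>The norm of the space in terms of functions\<close>

definition Lpn :: "ennreal \<Rightarrow> (real^'n \<Rightarrow> complex) \<Rightarrow> ennreal" where
  "Lpn p f = eLp lborel p (\<lambda>x. ennreal (norm (f x)))"

text \<open>The norm of a Borel function computed from its convolution pieces, free of
  distributions; \<open>UM_norm_eq\<close> identifies it with \<open>UM_norm\<close>.\<close>

definition UMn :: "ennreal \<Rightarrow> ennreal \<Rightarrow> (real^'n \<Rightarrow> complex) \<Rightarrow> ennreal" where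
  "UMn p q f = eLp (count_space UNIV) q (\<lambda>k. ennreal (exp (weight k)) * Lpn p (conv k f))"

lemma UM_norm_eq:
  assumes f0: "f0 \<in> borel_measurable lebesgue" "AE x in lebesgue. f0 x = f x"
    and f: "in_Lp p f" and p: "1 \<le> p" and q: "1 \<le> q"
  shows "UM_norm \<rho> p q f0 = UMn p q f"
proof (cases "q = \<infinity>")
  case True
  have "UM_norm \<rho> p q f0 = (SUP k. ennreal (exp (weight k)) * Lpn p (conv k f))"
    using True by (simp add: UM_norm_def distr_Lp_norm_freq_box[OF f0 f p] weight_def Lpn_def)
  moreover have "UMn p q f \<le> c \<longleftrightarrow> (SUP k. ennreal (exp (weight k)) * Lpn p (conv k f)) \<le> c" for c
    using True by (simp add: UMn_def eLp_top_le_iff AE_count_space SUP_le_iff)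
  ultimately show ?thesis by (metis order_antisym order_refl)
next
  case False
  have "1 \<le> enn2real q" by (rule enn2real_ge_1[OF q False])
  have "ennpowr (ennreal (exp w) * a) (enn2real q) = ennreal (exp (enn2real q * w)) * ennpowr a (enn2real q)" for w a
    by (simp add: ennpowr_mult powr_def)
  then show ?thesis
    using False by (simp add: UM_norm_def UMn_def eLp_def distr_Lp_norm_freq_box[OF f0 f p] weight_def Lpn_def infsum_ennreal_eq_nn_integral)
qed

text \<open>For every \<open>q\<close> a single weighted term is bounded by the \<open>l^q\<close>
  norm. Removing the weight leaves the summable factor \<open>small m\<close>, so the pieces are
  summable in norm whatever \<open>q\<close> is.\<close>

lemma sum_Lpn_conv_finite:
  assumes q: "1 \<le> q" and fin: "UMn p q f < \<infinity>"
  shows "(\<integral>\<^sup>+m. Lpn p (conv m f) \<partial>count_space UNIV) < \<infinity>"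
proof -
  have "Lpn p (conv m f) \<le> ennreal (small m) * (ennreal (exp weight_const) * UMn p q f)" for m
  proof -
    have "Lpn p (conv m f) = ennreal (exp (- weight m)) * (ennreal (exp (weight m)) * Lpn p (conv m f))"
      by (simp add: mult.assoc[symmetric] ennreal_mult[symmetric] exp_minus)
    also have "\<dots> \<le> ennreal (exp weight_const * small m) * UMn p q f"
      unfolding UMn_def
      by (intro mult_mono ennreal_leI weight_inverse_le le_eLp_count_space[OF q, of "\<lambda>k. ennreal (exp (weight k)) * Lpn p (conv k f)"]) auto
    finally show ?thesis by (simp add: ennreal_mult' small_def mult_ac)
  qed
  then have "(\<integral>\<^sup>+m. Lpn p (conv m f) \<partial>count_space UNIV) \<le> (\<integral>\<^sup>+m. ennreal (small (m :: int^'n)) * (ennreal (exp weight_const) * UMn p q f) \<partial>count_space UNIV)"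
    by (intro nn_integral_mono)
  also have "\<dots> = (\<integral>\<^sup>+m. ennreal (small (m :: int^'n)) \<partial>count_space UNIV) * (ennreal (exp weight_const) * UMn p q f)"
    by (rule nn_integral_multc) simp
  also have "\<dots> < \<infinity>" using summable_small[where 'n = 'n] fin by (simp add: ennreal_mult_less_top)
  finally show ?thesis .
qed

lemma sum_conv_finite:
  assumes f: "f \<in> borel_measurable borel" and p: "1 \<le> p" and fin: "(\<integral>\<^sup>+m. Lpn p (conv m f) \<partial>count_space UNIV) < \<infinity>"
  shows "eLp lborel p (\<lambda>x. \<integral>\<^sup>+m. ennreal (norm (conv m f x)) \<partial>count_space UNIV) < \<infinity>"
  by (rule le_less_trans[OF eLp_minkowski_series fin[unfolded Lpn_def]]) (use f p sigma_finite_lborel in auto)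

text \<open>By \<open>weight_le_close\<close> the weight of \<open>k\<close> splits into two terms.
  In the one with \<open>small l\<close> the number \<open>B l\<close> is bounded by
  \<open>NB\<close>, which leaves the lattice convolution of \<open>A\<close> with a summable
  kernel; in the one with \<open>small m\<close> the roles are exchanged. Each yields
  \<open>lattice_mass * NA * NB\<close>, whence the factor 2.\<close>

lemma UMn_mult_le:
  assumes f: "in_Lp p1 f" "UMn p1 q f < \<infinity>" and g: "in_Lp p2 g" "UMn p2 q g < \<infinity>"
    and p: "1 \<le> p1" "1 \<le> p2" "1 \<le> p" "1 / p = 1 / p1 + 1 / p2" and q: "1 \<le> q"
  shows "UMn p q (\<lambda>x. f x * g x) \<le> 2 * ennreal (exp weight_const) * kern_mass * lattice_mass * UMn p1 q f * UMn p2 q g"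
proof -
  define A where "A m = ennreal (exp (weight m)) * Lpn p1 (conv m f)" for m
  define B where "B m = ennreal (exp (weight m)) * Lpn p2 (conv m g)" for m
  define NA NB where "NA = UMn p1 q f" and "NB = UMn p2 q g"
  let ?c = "ennreal (exp weight_const) * kern_mass"
  define P where "P u k = (\<integral>\<^sup>+m. \<integral>\<^sup>+l. of_bool (close k m l) * (ennreal (small l) * u m) \<partial>count_space UNIV \<partial>count_space UNIV)"
    for u :: "int^'n \<Rightarrow> ennreal" and k
  have AN: "A m \<le> NA" for m unfolding NA_def UMn_def A_def by (rule le_eLp_count_space[OF q])
  have BN: "B m \<le> NB" for m unfolding NB_def UMn_def B_def by (rule le_eLp_count_space[OF q])
  have finf: "eLp lborel p1 (\<lambda>x. \<integral>\<^sup>+m. ennreal (norm (conv m f x)) \<partial>count_space UNIV) < \<infinity>"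
    using f by (intro sum_conv_finite p sum_Lpn_conv_finite[OF q]) auto
  have fing: "eLp lborel p2 (\<lambda>x. \<integral>\<^sup>+m. ennreal (norm (conv m g x)) \<partial>count_space UNIV) < \<infinity>"
    using g by (intro sum_conv_finite p sum_Lpn_conv_finite[OF q]) auto
  have pw: "ennreal (exp (weight k)) * Lpn p (conv k (\<lambda>x. f x * g x)) \<le> ?c * (NB * P A k + NA * P B k)" for k
  proof -
    have trm: "ennreal (exp (weight k)) * (of_bool (close k m l) * (kern_mass * (Lpn p1 (conv m f) * Lpn p2 (conv l g))))
      \<le> ?c * (NB * (of_bool (close k m l) * (ennreal (small l) * A m)) + NA * (of_bool (close k l m) * (ennreal (small m) * B l)))" for m l
    proof (cases "close k m l")
      case True
      have "ennreal (exp (weight k)) \<le> ennreal (exp weight_const) * (ennreal (exp (weight m)) * ennreal (exp (weight l)) * (ennreal (small l) + ennreal (small m)))"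
        using ennreal_leI[OF weight_le_close[OF True]] by (simp add: ennreal_mult ennreal_plus small_def)
      then have "ennreal (exp (weight k)) * (kern_mass * (Lpn p1 (conv m f) * Lpn p2 (conv l g))) \<le>
        ennreal (exp weight_const) * (ennreal (exp (weight m)) * ennreal (exp (weight l)) * (ennreal (small l) + ennreal (small m))) * (kern_mass * (Lpn p1 (conv m f) * Lpn p2 (conv l g)))"
        by (rule mult_right_mono) simp
      also have "\<dots> = ?c * (B l * (ennreal (small l) * A m) + A m * (ennreal (small m) * B l))"
        by (simp add: A_def B_def distrib_left distrib_right mult_ac)
      also have "\<dots> \<le> ?c * (NB * (ennreal (small l) * A m) + NA * (ennreal (small m) * B l))"
        by (intro mult_left_mono add_mono mult_right_mono AN BN) auto
      finally show ?thesis using True close_commute[of k m l] by simp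
    qed simp
    have "ennreal (exp (weight k)) * Lpn p (conv k (\<lambda>x. f x * g x)) \<le> ennreal (exp (weight k)) *
      (\<integral>\<^sup>+m. \<integral>\<^sup>+l. of_bool (close k m l) * (kern_mass * (Lpn p1 (conv m f) * Lpn p2 (conv l g))) \<partial>count_space UNIV \<partial>count_space UNIV)"
      unfolding Lpn_def by (intro mult_left_mono eLp_conv_mult_le f g p finf fing) auto
    also have "\<dots> = (\<integral>\<^sup>+m. \<integral>\<^sup>+l. ennreal (exp (weight k)) * (of_bool (close k m l) * (kern_mass * (Lpn p1 (conv m f) * Lpn p2 (conv l g)))) \<partial>count_space UNIV \<partial>count_space UNIV)"
      by (simp add: nn_integral_cmult)
    also have "\<dots> \<le> (\<integral>\<^sup>+m. \<integral>\<^sup>+l. ?c * (NB * (of_bool (close k m l) * (ennreal (small l) * A m)) + NA * (of_bool (close k l m) * (ennreal (small m) * B l))) \<partial>count_space UNIV \<partial>count_space UNIV)"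
      by (intro nn_integral_mono trm)
    also have "\<dots> = ?c * (NB * P A k + NA * (\<integral>\<^sup>+m. \<integral>\<^sup>+l. of_bool (close k l m) * (ennreal (small m) * B l) \<partial>count_space UNIV \<partial>count_space UNIV))"
      by (simp add: nn_integral_cmult nn_integral_add P_def)
    also have "(\<integral>\<^sup>+m. \<integral>\<^sup>+l. of_bool (close k l m) * (ennreal (small m) * B l) \<partial>count_space UNIV \<partial>count_space UNIV) = P B k"
      unfolding P_def by (rule nn_integral_count_space_nn_integral) auto
    finally show ?thesis .
  qed
  have "UMn p q (\<lambda>x. f x * g x) \<le> eLp (count_space UNIV) q (\<lambda>k. ?c * (NB * P A k + NA * P B k))"
    unfolding UMn_def by (rule eLp_mono_AE) (use pw q in auto)
  also have "\<dots> \<le> ?c * eLp (count_space UNIV) q (\<lambda>k. NB * P A k + NA * P B k)"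
    by (rule eLp_cmult[OF _ q]) simp
  also have "\<dots> \<le> ?c * (eLp (count_space UNIV) q (\<lambda>k. NB * P A k) + eLp (count_space UNIV) q (\<lambda>k. NA * P B k))"
    by (intro mult_left_mono eLp_add sigma_finite_measure_count_space q) auto
  also have "\<dots> \<le> ?c * (NB * (lattice_mass * NA) + NA * (lattice_mass * NB))"
  proof (intro mult_left_mono add_mono)
    have "eLp (count_space UNIV) q (\<lambda>k. NB * P A k) \<le> NB * eLp (count_space UNIV) q (P A)"
      by (rule eLp_cmult[OF _ q]) simp
    also have "\<dots> \<le> NB * (lattice_mass * NA)"
      using lattice_young[OF q, of A] by (intro mult_left_mono) (simp_all add: P_def[abs_def] NA_def UMn_def A_def[abs_def])
    finally show "eLp (count_space UNIV) q (\<lambda>k. NB * P A k) \<le> NB * (lattice_mass * NA)" .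
    have "eLp (count_space UNIV) q (\<lambda>k. NA * P B k) \<le> NA * eLp (count_space UNIV) q (P B)"
      by (rule eLp_cmult[OF _ q]) simp
    also have "\<dots> \<le> NA * (lattice_mass * NB)"
      using lattice_young[OF q, of B] by (intro mult_left_mono) (simp_all add: P_def[abs_def] NB_def UMn_def B_def[abs_def])
    finally show "eLp (count_space UNIV) q (\<lambda>k. NA * P B k) \<le> NA * (lattice_mass * NB)" .
  qed simp
  also have "\<dots> = 2 * ennreal (exp weight_const) * kern_mass * lattice_mass * NA * NB"
    by (simp add: mult_ac distrib_left flip: mult_2)
  finally show ?thesis by (simp only: NA_def NB_def)
qed

text \<open>A pointwise bound that is linear in the norm of \<open>f\<close>, unlike the qualitative
  one in \<open>ncv_bounded\<close>. For finite \<open>p\<close> it is Jensen's inequality with the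
  kernel as weight, followed by the uniform bound \<open>B\<close> on the kernel; the constant
  depends on \<open>p\<close>.\<close>

lemma ncv_le_Lpn:
  assumes p: "1 \<le> p"
  obtains C where "C < \<infinity>" "\<And>(f :: real^'n \<Rightarrow> complex) x. f \<in> borel_measurable borel \<Longrightarrow> ncv (\<lambda>x. ennreal (norm (f x))) x \<le> C * Lpn p f"
proof (cases "p = \<infinity>")
  case True
  show ?thesis
  proof (rule that[OF kern_mass_finite])
    fix f :: "real^'n \<Rightarrow> complex" and x assume [measurable]: "f \<in> borel_measurable borel"
    have "AE y in lborel. ennreal (norm (f y)) \<le> Lpn p f"
      using eLp_top_le_iff[of "\<lambda>x. ennreal (norm (f x))" lborel "Lpn p f"] True by (simp add: Lpn_def)
    then have "ncv (\<lambda>x. ennreal (norm (f x))) x \<le> (\<integral>\<^sup>+y. ennreal (norm (kern 0 (x - y))) * Lpn p f \<partial>lborel)"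
      unfolding ncv_def by (intro nn_integral_mono_AE) (auto elim!: eventually_mono intro: mult_left_mono)
    also have "\<dots> = kern_mass * Lpn p f"
      using nn_integral_lborel_shift(2)[of "\<lambda>y. ennreal (norm (kern 0 y))" x]
      by (simp add: nn_integral_multc kern_mass_def)
    finally show "ncv (\<lambda>x. ennreal (norm (f x))) x \<le> kern_mass * Lpn p f" .
  qed
next
  case False
  define a where "a = enn2real p"
  have a: "1 \<le> a" using enn2real_ge_1[OF p False] by (simp add: a_def)
  obtain B where B: "B \<ge> 0" "\<And>k x. norm (kern k x) \<le> B" using kern_bounded by metis
  show ?thesis
  proof (rule that[of "ennpowr (ennpowr kern_mass (a - 1) * ennreal B) (1 / a)"])
    have "ennpowr kern_mass (a - 1) * ennreal B \<noteq> top"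
      using kern_mass_finite by (auto simp: ennreal_mult_eq_top_iff)
    then have "ennpowr (ennpowr kern_mass (a - 1) * ennreal B) (1 / a) \<noteq> top"
      by (simp only: ennpowr_eq_top_iff not_False_eq_True)
    then show "ennpowr (ennpowr kern_mass (a - 1) * ennreal B) (1 / a) < \<infinity>"
      by (simp only: infinity_ennreal_def less_top)
    fix f :: "real^'n \<Rightarrow> complex" and x assume [measurable]: "f \<in> borel_measurable borel"
    have km: "(\<integral>\<^sup>+y. ennreal (norm (kern 0 (x - y))) \<partial>lborel) = kern_mass"
      unfolding kern_mass_def using nn_integral_lborel_shift(2)[of "\<lambda>y. ennreal (norm (kern 0 y))" x] by simp
    have "ennpowr (ncv (\<lambda>x. ennreal (norm (f x))) x) a \<le> ennpowr kern_mass (a - 1) *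
      (\<integral>\<^sup>+y. ennreal (norm (kern 0 (x - y))) * ennpowr (ennreal (norm (f y))) a \<partial>lborel)"
      unfolding ncv_def km[symmetric] by (rule nn_integral_jensen) (use a kern_mass_finite km in auto)
    also have "\<dots> \<le> ennpowr kern_mass (a - 1) * (\<integral>\<^sup>+y. ennreal B * ennpowr (ennreal (norm (f y))) a \<partial>lborel)"
      by (intro mult_left_mono nn_integral_mono mult_right_mono ennreal_leI B) auto
    also have "\<dots> = ennpowr kern_mass (a - 1) * ennreal B * (\<integral>\<^sup>+y. ennpowr (ennreal (norm (f y))) a \<partial>lborel)"
      by (subst nn_integral_cmult) (auto simp: mult.assoc)
    finally have "ennpowr (ennpowr (ncv (\<lambda>x. ennreal (norm (f x))) x) a) (1 / a)
       \<le> ennpowr (ennpowr kern_mass (a - 1) * ennreal B * (\<integral>\<^sup>+y. ennpowr (ennreal (norm (f y))) a \<partial>lborel)) (1 / a)"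
      using a by (intro ennpowr_mono) auto
    then show "ncv (\<lambda>x. ennreal (norm (f x))) x \<le> ennpowr (ennpowr kern_mass (a - 1) * ennreal B) (1 / a) * Lpn p f"
      using a False unfolding Lpn_def eLp_def a_def[symmetric] ennpowr_mult by (simp add: ennpowr_ennpowr)
  qed
qed

text \<open>Bernstein's inequality: \<open>conv k f\<close> is the finite sum of the \<open>conv m (conv k f)\<close> with \<open>m\<close> near \<open>k\<close>.\<close>

lemma Lpn_top_conv_le:
  assumes p: "1 \<le> p"
  obtains C where "C < \<infinity>" "\<And>f k. in_Lp p f \<Longrightarrow> Lpn \<infinity> (conv k f) \<le> C * Lpn p (conv k f)"
proof -
  obtain C where C: "C < \<infinity>" "\<And>(f :: real^'n \<Rightarrow> complex) x. f \<in> borel_measurable borel \<Longrightarrow> ncv (\<lambda>x. ennreal (norm (f x))) x \<le> C * Lpn p f"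
    using ncv_le_Lpn[OF p] by metis
  show ?thesis
  proof (rule that[of "close_count * C"])
    show "close_count * C < \<infinity>" using C close_count_finite by (simp add: ennreal_mult_less_top)
    fix f k assume f: "in_Lp p f"
    define h where "h = conv k f"
    have h: "in_Lp p h" unfolding h_def by (rule conv_in_Lp[OF f p])
    have [measurable]: "h \<in> borel_measurable borel" using h by simp
    \<comment> \<open>The pieces vanish already beyond distance 2; the wider relation
      \<open>close\<close> is used so that \<open>close_count\<close> counts the remaining
      indices.\<close>
    have zero: "conv m h x = 0" if far: "\<not> close k m 0" for m x
    proof -
      obtain i where "\<not> \<bar>k $ i - m $ i\<bar> \<le> 3" using far by (auto simp: close_def)
      then have "2 < \<bar>of_int (m $ i) - of_int (k $ i) :: real\<bar>" by linarith
      from conv_conv_zero[OF f p this] show ?thesis by (simp add: h_def)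
    qed
    have "(\<integral>\<^sup>+m. Lpn p (conv m h) \<partial>count_space UNIV) \<le> (\<integral>\<^sup>+m. of_bool (close k m 0) * (kern_mass * Lpn p h) \<partial>count_space UNIV)"
    proof (rule nn_integral_mono)
      fix m
      show "Lpn p (conv m h) \<le> of_bool (close k m 0) * (kern_mass * Lpn p h)"
        using eLp_conv_le[OF _ p, of h m] zero[of m] eLp_eq_0_iff[OF _ p, of "\<lambda>x. ennreal (norm (conv m h x))" lborel]
        by (cases "close k m 0") (auto simp: Lpn_def)
    qed
    also have "\<dots> = close_count * (kern_mass * Lpn p h)"
      by (subst nn_integral_multc) (auto simp: nn_integral_close)
    also have "\<dots> < \<infinity>" using h close_count_finite kern_mass_finite by (simp add: Lpn_def ennreal_mult_less_top)
    finally have fin: "eLp lborel p (\<lambda>x. \<integral>\<^sup>+m. ennreal (norm (conv m h x)) \<partial>count_space UNIV) < \<infinity>"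
      by (intro sum_conv_finite p) auto
    have "AE x in lborel. ennreal (norm (h x)) \<le> close_count * (C * Lpn p h)"
      using conv_reconstruct[OF h p fin]
    proof eventually_elim
      case (elim x)
      have "ennreal (norm (h x)) \<le> (\<integral>\<^sup>+m. ennreal (norm (conv m h x)) \<partial>count_space UNIV)"
        by (subst elim) (rule norm_integral_le_nn)
      also have "\<dots> \<le> (\<integral>\<^sup>+m. of_bool (close k m 0) * (C * Lpn p h) \<partial>count_space UNIV)"
      proof (rule nn_integral_mono)
        fix m
        have "ennreal (norm (conv m h x)) \<le> C * Lpn p h"
          by (rule order_trans[OF norm_conv_le C(2)]) auto
        then show "ennreal (norm (conv m h x)) \<le> of_bool (close k m 0) * (C * Lpn p h)"
          using zero[of m x] by (cases "close k m 0") auto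
      qed
      also have "\<dots> = close_count * (C * Lpn p h)"
        by (subst nn_integral_multc) (auto simp: nn_integral_close)
      finally show ?case .
    qed
    then show "Lpn \<infinity> (conv k f) \<le> close_count * C * Lpn p (conv k f)"
      by (simp add: Lpn_def eLp_top_le_iff h_def[symmetric] mult.assoc)
  qed
qed

text \<open>Bernstein's inequality holds with one constant for all \<open>k\<close>, so it passes
  through the weighted \<open>l^q\<close> norm. That \<open>f\<close> itself is bounded follows from
  the convergence of its pieces in the supremum norm together with the reconstruction
  formula.\<close>

lemma UMn_top_le:
  assumes p: "1 \<le> p" and q: "1 \<le> q"
  obtains C where "C < \<infinity>"
    "\<And>f. in_Lp p f \<Longrightarrow> UMn p q f < \<infinity> \<Longrightarrow> in_Lp \<infinity> f \<and> UMn \<infinity> q f \<le> C * UMn p q f"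
proof -
  obtain C where C: "C < \<infinity>" "\<And>f k. in_Lp p f \<Longrightarrow> Lpn \<infinity> (conv k f) \<le> C * Lpn p (conv k f)"
    using Lpn_top_conv_le[OF p] by metis
  show ?thesis
  proof (rule that[OF C(1)], rule conjI)
    fix f assume f: "in_Lp p f" and fin: "UMn p q f < \<infinity>"
    have [measurable]: "f \<in> borel_measurable borel" using f by simp
    have s: "(\<integral>\<^sup>+m. Lpn p (conv m f) \<partial>count_space UNIV) < \<infinity>" by (rule sum_Lpn_conv_finite[OF q fin])
    have r: "AE x in lborel. f x = (LINT m|count_space UNIV. conv m f x)"
      by (rule conv_reconstruct[OF f p sum_conv_finite[OF _ p s]]) simp
    have "(\<integral>\<^sup>+m. Lpn \<infinity> (conv m f) \<partial>count_space UNIV) \<le> (\<integral>\<^sup>+m. C * Lpn p (conv m f) \<partial>count_space UNIV)"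
      by (intro nn_integral_mono C f)
    also have "\<dots> < \<infinity>" using s C(1) by (simp add: nn_integral_cmult ennreal_mult_less_top)
    finally have "eLp lborel \<infinity> (\<lambda>x. \<integral>\<^sup>+m. ennreal (norm (conv m f x)) \<partial>count_space UNIV) < \<infinity>"
      by (intro sum_conv_finite) auto
    moreover have "AE x in lborel. ennreal (norm (f x)) \<le> (\<integral>\<^sup>+m. ennreal (norm (conv m f x)) \<partial>count_space UNIV)"
      using r by eventually_elim (metis norm_integral_le_nn)
    then have "eLp lborel \<infinity> (\<lambda>x. ennreal (norm (f x))) \<le> eLp lborel \<infinity> (\<lambda>x. \<integral>\<^sup>+m. ennreal (norm (conv m f x)) \<partial>count_space UNIV)"
      by (intro eLp_mono_AE borel_measurable_nn_integral_count_space) auto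
    ultimately show "in_Lp \<infinity> f" by (auto intro: le_less_trans)
    have "UMn \<infinity> q f \<le> eLp (count_space UNIV) q (\<lambda>k. C * (ennreal (exp (weight k)) * Lpn p (conv k f)))"
      unfolding UMn_def
    proof (intro eLp_mono_AE q AE_I2)
      fix k
      show "ennreal (exp (weight k)) * Lpn \<infinity> (conv k f) \<le> C * (ennreal (exp (weight k)) * Lpn p (conv k f))"
        using mult_left_mono[OF C(2)[OF f, of k], of "ennreal (exp (weight k))"] by (simp add: mult_ac)
    qed auto
    also have "\<dots> \<le> C * UMn p q f" unfolding UMn_def by (rule eLp_cmult[OF _ q]) simp
    finally show "UMn \<infinity> q f \<le> C * UMn p q f" .
  qed
qed

section \<open>Return to the spaces of Lebesgue measurable functions\<close>

lemma UM_representative: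
  assumes f: "f \<in> UM \<rho> p q" and p: "1 \<le> p" and q: "1 \<le> q"
  obtains f' where "in_Lp p f'" "AE x in lebesgue. f x = f' x" "UM_norm \<rho> p q f = UMn p q f'" "UMn p q f' < \<infinity>"
    "f \<in> borel_measurable lebesgue"
proof -
  have f: "f \<in> borel_measurable lebesgue" "Lp_norm p f < \<infinity>" "UM_norm \<rho> p q f < \<infinity>"
    using f by (auto simp: UM_def Lp_def)
  obtain f' where f': "f' \<in> borel_measurable borel" "AE x in lebesgue. f x = f' x"
    using lebesgue_borel_rep[OF f(1)] by metis
  have L: "in_Lp p f'" using f f' Lp_norm_eq_eLp[OF p f(1) f'] by simp
  have U: "UM_norm \<rho> p q f = UMn p q f'" by (rule UM_norm_eq[OF f(1) f'(2) L p q])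
  show ?thesis by (rule that[OF L f'(2) U _ f(1)]) (use f(3) U in simp)
qed

text \<open>Stated for independent exponents so that it serves twice: for the bilinear estimate, and
  with \<open>p2 = \<infinity>\<close> for the algebra property.\<close>

lemma UM_mult_representative:
  assumes f: "in_Lp p1 f'" "AE x in lebesgue. f x = f' x" "UMn p1 q f' < \<infinity>" "f \<in> borel_measurable lebesgue"
    and g: "in_Lp p2 g'" "AE x in lebesgue. g x = g' x" "UMn p2 q g' < \<infinity>" "g \<in> borel_measurable lebesgue"
    and p: "1 \<le> p1" "1 \<le> p2" "1 \<le> p" "1 / p = 1 / p1 + 1 / p2" and q: "1 \<le> q"
  shows "(\<lambda>x. f x * g x) \<in> UM \<rho> p q"
    and "UM_norm \<rho> p q (\<lambda>x. f x * g x) \<le> 2 * ennreal (exp weight_const) * kern_mass * lattice_mass * UMn p1 q f' * UMn p2 q g'"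
proof -
  let ?h = "\<lambda>x. f' x * g' x"
  have [measurable]: "f' \<in> borel_measurable borel" "g' \<in> borel_measurable borel" using f g by auto
  have m: "(\<lambda>x. f x * g x) \<in> borel_measurable lebesgue" using f g by (intro borel_measurable_times)
  have ae: "AE x in lebesgue. f x * g x = ?h x" using f(2) g(2) by eventually_elim simp
  have "eLp lborel p (\<lambda>x. ennreal (norm (?h x))) \<le> eLp lborel p1 (\<lambda>x. ennreal (norm (f' x))) * eLp lborel p2 (\<lambda>x. ennreal (norm (g' x)))"
    using eLp_holder[of "\<lambda>x. ennreal (norm (f' x))" lborel "\<lambda>x. ennreal (norm (g' x))" p p1 p2] p by (simp add: norm_mult ennreal_mult)
  also have "\<dots> < \<infinity>" using f g by (simp add: ennreal_mult_less_top)
  finally have h: "in_Lp p ?h" by simp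
  have "UM_norm \<rho> p q (\<lambda>x. f x * g x) = UMn p q ?h" by (rule UM_norm_eq[OF m ae h p(3) q])
  then show le: "UM_norm \<rho> p q (\<lambda>x. f x * g x) \<le> 2 * ennreal (exp weight_const) * kern_mass * lattice_mass * UMn p1 q f' * UMn p2 q g'"
    using UMn_mult_le[OF f(1,3) g(1,3) p q] by simp
  also have "\<dots> < \<infinity>" using f g kern_mass_finite lattice_mass_finite by (simp add: ennreal_mult_less_top)
  finally show "(\<lambda>x. f x * g x) \<in> UM \<rho> p q"
    using m h Lp_norm_eq_eLp[OF p(3) m _ ae] by (simp add: UM_def Lp_def)
qed

end

lemma ennreal_le_pos_real:
  assumes "C < (\<infinity> :: ennreal)" obtains c where "c > 0" "C \<le> ennreal c"
proof (rule that)
  show "enn2real C + 1 > 0" by (simp add: add_nonneg_pos)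
  show "C \<le> ennreal (enn2real C + 1)" using assms by (cases C) (auto intro: ennreal_leI)
qed

theorem theorem4p6:
  fixes \<rho> :: "real^'n::finite \<Rightarrow> real" and q :: ennreal
  assumes "freq_window \<rho>" and "1 \<le> q"
  shows "(\<exists>C::real. C > 0 \<and>
           (\<forall>(p1::ennreal) (p2::ennreal) (p::ennreal) f g.
              1 \<le> p1 \<longrightarrow> 1 \<le> p2 \<longrightarrow> 1 / p = 1 / p1 + 1 / p2 \<longrightarrow> 1 \<le> p \<longrightarrow>
              f \<in> UM \<rho> p1 q \<longrightarrow> g \<in> UM \<rho> p2 q \<longrightarrow>
              (\<lambda>x. f x * g x) \<in> UM \<rho> p q \<and>
              UM_norm \<rho> p q (\<lambda>x. f x * g x)
                \<le> ennreal C * UM_norm \<rho> p1 q f * UM_norm \<rho> p2 q g))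
       \<and> (\<forall>p::ennreal. 1 \<le> p \<longrightarrow>
           (\<exists>C1::real. C1 > 0 \<and>
             (\<forall>f g. f \<in> UM \<rho> p q \<longrightarrow> g \<in> UM \<rho> p q \<longrightarrow>
                (\<lambda>x. f x * g x) \<in> UM \<rho> p q \<and>
                UM_norm \<rho> p q (\<lambda>x. f x * g x)
                  \<le> ennreal C1 * UM_norm \<rho> p q f * UM_norm \<rho> p q g)))"
proof (intro conjI allI impI)
  interpret window \<rho> by standard (rule assms(1))
  \<comment> \<open>The window enters through \<open>kern_mass\<close>, the dimension through the
    other factors; the exponents \<open>p1\<close>, \<open>p2\<close> and \<open>p\<close> do not
    occur.\<close>
  let ?C = "2 * ennreal (exp weight_const) * kern_mass * lattice_mass"
  have C: "?C < \<infinity>" using kern_mass_finite lattice_mass_finite by (simp add: ennreal_mult_less_top)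
  obtain c where c: "c > 0" "?C \<le> ennreal c" by (rule ennreal_le_pos_real[OF C])
  show "\<exists>C::real. C > 0 \<and>
           (\<forall>(p1::ennreal) (p2::ennreal) (p::ennreal) f g.
              1 \<le> p1 \<longrightarrow> 1 \<le> p2 \<longrightarrow> 1 / p = 1 / p1 + 1 / p2 \<longrightarrow> 1 \<le> p \<longrightarrow>
              f \<in> UM \<rho> p1 q \<longrightarrow> g \<in> UM \<rho> p2 q \<longrightarrow>
              (\<lambda>x. f x * g x) \<in> UM \<rho> p q \<and>
              UM_norm \<rho> p q (\<lambda>x. f x * g x)
                \<le> ennreal C * UM_norm \<rho> p1 q f * UM_norm \<rho> p2 q g)"
  proof (rule exI[of _ c], rule conjI[OF c(1)], intro allI impI conjI)
    fix p1 p2 p :: ennreal and f g :: "real^'n \<Rightarrow> complex"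
    assume p: "1 \<le> p1" "1 \<le> p2" "1 / p = 1 / p1 + 1 / p2" "1 \<le> p" and fg: "f \<in> UM \<rho> p1 q" "g \<in> UM \<rho> p2 q"
    obtain f' where f': "in_Lp p1 f'" "AE x in lebesgue. f x = f' x" "UM_norm \<rho> p1 q f = UMn p1 q f'" "UMn p1 q f' < \<infinity>"
      "f \<in> borel_measurable lebesgue" by (rule UM_representative[OF fg(1) p(1) assms(2)])
    obtain g' where g': "in_Lp p2 g'" "AE x in lebesgue. g x = g' x" "UM_norm \<rho> p2 q g = UMn p2 q g'" "UMn p2 q g' < \<infinity>"
      "g \<in> borel_measurable lebesgue" by (rule UM_representative[OF fg(2) p(2) assms(2)])
    note mult = UM_mult_representative[OF f'(1,2,4,5) g'(1,2,4,5) p(1,2,4,3) assms(2)]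
    show "(\<lambda>x. f x * g x) \<in> UM \<rho> p q" by (rule mult(1))
    have "?C * UMn p1 q f' * UMn p2 q g' \<le> ennreal c * UM_norm \<rho> p1 q f * UM_norm \<rho> p2 q g"
      unfolding f'(3) g'(3) by (intro mult_right_mono c) auto
    with mult(2) show "UM_norm \<rho> p q (\<lambda>x. f x * g x) \<le> ennreal c * UM_norm \<rho> p1 q f * UM_norm \<rho> p2 q g"
      by (rule order_trans)
  qed
  fix p :: ennreal assume p: "1 \<le> p"
  obtain D where D: "D < \<infinity>" "\<And>f. in_Lp p f \<Longrightarrow> UMn p q f < \<infinity> \<Longrightarrow> in_Lp \<infinity> f \<and> UMn \<infinity> q f \<le> D * UMn p q f"
    using UMn_top_le[OF p assms(2)] by metis
  have "?C * D < \<infinity>" using C D(1) by (simp add: ennreal_mult_less_top)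
  then obtain d where d: "d > 0" "?C * D \<le> ennreal d" by (rule ennreal_le_pos_real)
  show "\<exists>C1::real. C1 > 0 \<and>
             (\<forall>f g. f \<in> UM \<rho> p q \<longrightarrow> g \<in> UM \<rho> p q \<longrightarrow>
                (\<lambda>x. f x * g x) \<in> UM \<rho> p q \<and>
                UM_norm \<rho> p q (\<lambda>x. f x * g x)
                  \<le> ennreal C1 * UM_norm \<rho> p q f * UM_norm \<rho> p q g)"
  proof (rule exI[of _ d], rule conjI[OF d(1)], intro allI impI conjI)
    fix f g :: "real^'n \<Rightarrow> complex" assume fg: "f \<in> UM \<rho> p q" "g \<in> UM \<rho> p q"
    obtain f' where f': "in_Lp p f'" "AE x in lebesgue. f x = f' x" "UM_norm \<rho> p q f = UMn p q f'" "UMn p q f' < \<infinity>"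
      "f \<in> borel_measurable lebesgue" by (rule UM_representative[OF fg(1) p assms(2)])
    obtain g' where g': "in_Lp p g'" "AE x in lebesgue. g x = g' x" "UM_norm \<rho> p q g = UMn p q g'" "UMn p q g' < \<infinity>"
      "g \<in> borel_measurable lebesgue" by (rule UM_representative[OF fg(2) p assms(2)])
    \<comment> \<open>Only the second factor is moved to the exponent \<open>\<infinity>\<close>;
      the product then keeps the exponent \<open>p\<close> of the first one.\<close>
    have gtop: "in_Lp \<infinity> g'" "UMn \<infinity> q g' \<le> D * UMn p q g'" using D(2)[OF g'(1,4)] by auto
    have gfin: "UMn \<infinity> q g' < \<infinity>"
      using gtop(2) D(1) g'(4) by (auto simp: ennreal_mult_less_top intro: le_less_trans)
    have pp: "1 / p = 1 / p + 1 / \<infinity>" "(1::ennreal) \<le> \<infinity>" by simp_all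
    note mult = UM_mult_representative[OF f'(1,2,4,5) gtop(1) g'(2) gfin g'(5) p pp(2) p pp(1) assms(2)]
    show "(\<lambda>x. f x * g x) \<in> UM \<rho> p q" by (rule mult(1))
    have "?C * UMn p q f' * UMn \<infinity> q g' \<le> ?C * UMn p q f' * (D * UMn p q g')"
      by (intro mult_left_mono gtop) simp
    also have "\<dots> = (?C * D) * UMn p q f' * UMn p q g'" by (simp only: mult_ac)
    also have "\<dots> \<le> ennreal d * UM_norm \<rho> p q f * UM_norm \<rho> p q g"
      unfolding f'(3) g'(3) by (intro mult_right_mono d) auto
    finally show "UM_norm \<rho> p q (\<lambda>x. f x * g x) \<le> ennreal d * UM_norm \<rho> p q f * UM_norm \<rho> p q g"
      using mult(2) by (rule order_trans[rotated])
  qed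
qed

end
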